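(* The three fundamental invariants for $3\times3\times3$ arrays are the polynomials $I_6$, $I_9$, $I_{12}$ defined explicitly in the context; that is, the algebra of polynomials in $P=\mathbb{C}[x_{ijk}\mid 1\le i,j,k\le 3]$ invariant under $SL_3(\mathbb{C})\times SL_3(\mathbb{C})\times SL_3(\mathbb{C})$ is freely generated (as a commutative polynomial algebra over $\mathbb{C}$) by the homogeneous polynomials $I_6$, $I_9$, $I_{12}$ of degrees $6$, $9$, $12$. Moreover: (1) $I_6$ is a linear combination of the $8$ symmetric orbit sums in degree $6$ (there are exactly $8$ $G$-orbits of weight zero monomials in degree $6$), and has altogether $1152$ terms; (2) $I_9$ is the sum of $14$ alternating orbit sums in degree $9$, and has altogether $9216$ terms; (3) $I_{12}$ is a linear combination of $235$ symmetric orbit sums in degree $12$ (with nonzero coefficients), and has altogether $209061$ terms. Here the number of terms is the number of distinct monomials with nonzero coefficient.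
   Context: Group action and invariants. $P=\mathbb{C}[x_{ijk}\mid 1\le i,j,k\le3]$ (27 variables). A triple $(A,B,C)$ of invertible $3\times 3$ complex matrices acts on $P$ by algebra automorphisms with $(A,B,C)\cdot x_{ijk}=\sum_{p,q,r=1}^3 a_{pi}b_{qj}c_{rk}x_{pqr}$. A polynomial $f$ is an invariant if $(A,B,C)\cdot f=f$ whenever $\det A=\det B=\det C=1$. Monomials. For a $3\times3\times3$ array $E=(e_{ijk})$ of non-negative integers, $M(E)=\prod_{i,j,k}x_{ijk}^{e_{ijk}}$. $M(E)$ has weight zero if parallel slices of $E$ have the same sum: $\sum_{j,k}e_{ijk}$ is independent of $i$, $\sum_{i,k}e_{ijk}$ is independent of $j$, and $\sum_{i,j}e_{ijk}$ is independent of $k$. Finite group and orbit sums. $G=(S_3\times S_3\times S_3)\rtimes S_3$ acts on arrays by $((\alpha,\beta,\gamma)\cdot E)_{i,j,k}=e_{\alpha(i),\beta(j),\gamma(k)}$, and $\delta$ in the last $S_3$ permutes the three directions: $(\delta\cdot E)_{t_1,t_2,t_3}=e_{t_{\delta(1)},t_{\delta(2)},t_{\delta(3)}}$. The orbit of $M=M(E)$ is $\mathcal{O}(M)=\{M(g\cdot E)\mid g\in G\}$. The symmetric and alternating orbit sums are $$\mathcal{O}^+(M)=\frac{|\mathcal{O}(M)|}{|G|}\sum_{g\in G}M(g\cdot E),\qquad \mathcal{O}^-(M)=\frac{|\mathcal{O}(M)|}{|G|}\sum_{g\in G}\epsilon(g)M(g\cdot E),$$ where $\epsilon(g)$ is the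 product of the signs of the four components of $g=(\alpha,\beta,\gamma,\delta)$. Definition of $I_6$: $$\begin{aligned}I_6={}&-10\,\mathcal{O}^+(x_{123}x_{132}x_{213}x_{231}x_{312}x_{321})-4\,\mathcal{O}^+(x_{132}x_{133}x_{213}x_{221}x_{311}x_{322})\\&-2\,\mathcal{O}^+(x_{133}^2x_{221}x_{222}x_{311}x_{312})+\mathcal{O}^+(x_{133}^2x_{222}^2x_{311}^2)\\&+2\,\mathcal{O}^+(x_{132}x_{133}x_{221}x_{223}x_{311}x_{312})+2\,\mathcal{O}^+(x_{132}x_{133}x_{213}x_{222}x_{311}x_{321})\\&+4\,\mathcal{O}^+(x_{133}^2x_{212}x_{221}x_{311}x_{322})+8\,\mathcal{O}^+(x_{123}x_{132}x_{213}x_{231}x_{311}x_{322}).\end{aligned}$$ Definition of $I_9$: $$\begin{aligned}I_9={}&\mathcal{O}^-(x_{123}x_{132}x_{133}x_{213}x_{221}x_{232}x_{311}^2x_{322})+\mathcal{O}^-(x_{123}x_{132}x_{133}x_{213}x_{221}x_{231}x_{312}^2x_{321})\\&+\mathcal{O}^-(x_{123}x_{132}x_{133}x_{213}x_{221}x_{222}x_{311}x_{312}x_{331})+\mathcal{O}^-(x_{123}x_{132}x_{133}x_{213}x_{221}^2x_{311}x_{312}x_{332})\\&+\mathcal{O}^-(x_{123}x_{132}x_{133}x_{212}x_{223}x_{231}x_{311}x_{312}x_{321})+\mathcal{O}^-(x_{123}x_{132}x_{133}x_{212}x_{222}x_{231}x_{311}^2x_{323})\\&+\mathcal{O}^-(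x_{123}x_{132}x_{133}x_{212}x_{221}x_{232}x_{311}x_{313}x_{321})+\mathcal{O}^-(x_{123}x_{132}x_{133}x_{212}x_{221}x_{231}x_{311}x_{313}x_{322})\\&+\mathcal{O}^-(x_{123}x_{132}x_{133}x_{212}x_{213}x_{221}x_{312}x_{321}x_{331})+\mathcal{O}^-(x_{123}x_{132}x_{133}x_{212}^2x_{231}x_{313}x_{321}^2)\\&+\mathcal{O}^-(x_{123}x_{132}x_{133}x_{211}x_{212}x_{232}x_{311}x_{321}x_{323})+\mathcal{O}^-(x_{123}x_{132}^2x_{213}x_{221}x_{231}x_{311}x_{312}x_{323})\\&+\mathcal{O}^-(x_{123}x_{132}^2x_{213}x_{221}x_{222}x_{311}^2x_{333})+\mathcal{O}^-(x_{123}x_{132}^2x_{213}^2x_{231}x_{312}x_{321}^2).\end{aligned}$$ Definition of $I_{12}$. An exponent array $E$ is written as a string of 27 digits in three blocks $B_1|B_2|B_3$ of nine digits, where $B_i$ lists $e_{i11},e_{i12},e_{i13},e_{i21},e_{i22},e_{i23},e_{i31},e_{i32},e_{i33}$ in this order. $I_{12}=\sum c\,\mathcal{O}^+(M(E))$, the sum being over all the entries of the following list. The entries are grouped by first block $B_1$; in each group an entry "$c$: $B_2|B_3$" means coefficient $c$ and array $E=B_1|B_2|B_3$. Group $B_1=000001012$: 1: 001110010|210100000; -1: 001110010|300010000; -1: 001110100|120100000; 1: 001110100|210010000; -1: 001120000|210000100; 1: 001120000|300000010; -1: 001200010|120100000; 1: 001200010|210010000; 1: 001200100|030100000; 2: 001210000|120000100;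 -2: 001210000|210000010; -1: 001300000|030000100; 1: 001300000|120000010; -2: 010101010|210100000; 2: 010101010|300010000; 1: 010101100|120100000; -1: 010101100|210010000; 1: 010110010|201100000; -1: 010110010|300001000; 1: 010110100|201010000; -1: 010110100|210001000; 1: 010200010|111100000; -2: 010200010|201010000; 1: 010200010|210001000; -1: 010200100|021100000; 1: 010200100|111010000; -1: 010201000|120000100; 1: 010201000|210000010; -1: 010210000|111000100; 1: 010210000|201000010; -1: 010300000|111000010; -2: 011100100|020200000; 4: 011100100|110110000; -2: 011100100|200020000; 2: 011200000|020100100; -3: 011200000|110010100; -1: 011200000|110100010; 2: 011200000|200010010; 2: 020200000|101010100; 1: 020200000|101100010; -2: 020200000|200001010; -1: 100011100|120100000; 1: 100011100|210010000; 1: 100020100|111100000; -1: 100020100|210001000; 2: 100101010|120100000; -2: 100101010|210010000; -2: 100110010|111100000; -2: 100110100|111010000; 1: 100110100|120001000; -1: 100111000|120000100; 1: 100111000|210000010; 1: 100120000|111000100; -1: 100200010|120001000; -1: 100201000|120000010; -2: 101010100|110110000; -2: 101100010|110110000; 1: 101100010|200020000; 4: 101110000|110100010; -1: 101110000|200010010; -2: 110100010|110101000; -1: 110100010|200011000; 2: 110110000|200001010. Group $B_1=000001021$: 1: 001011100|300010000; -1: 001020100|300001000; 1: 001110001|300010000; 2: 001110100|111100000; -2: 001110100|201010000; -1: 001120000|300000001; 1: 001200001|120100000; -1: 001200001|210010000; 1: 001200100|111010000; 1: 001200100|120001000; -1: 001201000|120000100; -3: 001210000|111000100; 2: 001210000|210000001;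 2: 001300000|021000100; 1: 002010100|110200000; -1: 002010100|200110000; 2: 002100100|020200000; -4: 002100100|110110000; 2: 002100100|200020000; -1: 002110000|200010100; -2: 002200000|020100100; 3: 002200000|110010100; 1: 010002100|300010000; -1: 010011100|300001000; -2: 010101001|300010000; -2: 010101100|111100000; 2: 010101100|210001000; 1: 010111000|300000001; -1: 010200001|111100000; 2: 010200001|201010000; -1: 010200100|102010000; -1: 010200100|111001000; 3: 010201000|111000100; 1: 010210000|102000100; -2: 010300000|012000100; 3: 011001100|110200000; -3: 011001100|200110000; 3: 011010100|200101000; 1: 011100001|200110000; 2: 011100100|101110000; -2: 011100100|110101000; -2: 011101000|110100100; 3: 011101000|200010100; 2: 011110000|101100100; -3: 011110000|200001100; 1: 011110000|200100001; -1: 011200000|101010100; 1: 011200000|110001100; -2: 011200000|200010001; -2: 012100000|100110100; 1: 020001100|200101000; -1: 020100001|200101000; 4: 020100100|101101000; -2: 020100100|200002000; 1: 020101000|200001100; -1: 020101000|200100001; -3: 020200000|101001100; 2: 020200000|200001001; 2: 021100000|100101100; -2: 100101001|120100000; -2: 100101100|120001000; 2: 100110001|111100000; 4: 101001100|110110000; 1: 101010001|110200000; 2: 101010100|101110000; -2: 101010100|110101000; -2: 101020000|101100100; 2: 101100001|110110000; -4: 101101000|110010100; 2: 101110000|110001100; -4: 101110000|110100001; -2: 110001001|110200000; -2: 110001100|110101000; 2: 110002000|110100100. Group $B_1=000001030$: 1: 001011100|300001000; -1: 001101100|210001000; -2: 001110001|300001000; 2: 001200001|210001000; 3: 002100100|110101000;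 -2: 002100100|200011000; 2: 002200000|200010001; 1: 003000100|010300000; -4: 011100100|101101000; 2: 100101001|111100000; 2: 100101100|111001000; 2: 101010100|101101000. Group $B_1=000001111$: -4: 001020100|111100000; 3: 001020100|210001000; -2: 001110010|210001000; 4: 001120000|111000100; -1: 001120000|210000001; -3: 002010100|020200000; 4: 002010100|110110000; -1: 002010100|200020000; 4: 002110000|020100100; -4: 002110000|110010100; 2: 010101010|111100000; 2: 010101100|111010000; -2: 010110001|201010000; -4: 010111000|111000100; -2: 010200001|111010000; -2: 010200010|111001000; -4: 011001100|110110000; 2: 011010100|101110000; -2: 011010100|110101000; 2: 011011000|110100100; -2: 011100001|110110000; 2: 011100010|200011000; 2: 011100100|110011000; 6: 011101000|110100010; -4: 011101000|200010010; 2: 011110000|200010001; 4: 110001001|110110000. Group $B_1=000001120$: 2: 001110001|210001000; -4: 001200001|120001000; 1: 002020000|200100001; -1: 002100001|020200000; 4: 002110000|110100001; -3: 002110000|200010001; 2: 010101001|201010000; -2: 010200001|102010000; 2: 011100001|110101000; -2: 011100001|200011000; -4: 011101000|110100001; 1: 011101000|200010001; 3: 011110000|200001001; -2: 020100001|101101000; 4: 020101000|101100001; -2: 021100000|100101001; 2: 101010001|101110000; -4: 101110000|110001001. Group $B_1=000002020$: -4: 002000200|020200000; 6: 002000200|110110000; -2: 002000200|200020000; -5: 002100100|110010100; -12: 011100100|011100100; 4: 011100100|101010100; -8: 101000101|110110000; -4: 101010100|101010100; 4: 101010100|110100001; 2: 101100001|110010100. Group $B_1=000002110$: 8: 011000101|110110000;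 -6: 011010100|101100010; -2: 011010100|110100001; 5: 011010100|200010001; -6: 011100001|110100010; -2: 011100010|101010100; -1: 011100010|200010001; -4: 011100100|110010001; 2: 011110000|110000101; -6: 011110000|200000011; 4: 110010001|110100001. Group $B_1=000011011$: 24: 011100100|011100100; -8: 011100100|101010100; 10: 101000101|110110000; -8: 101000110|101110000; -2: 101000110|110101000; 4: 101010100|101100010; -2: 101010100|110100001. Group $B_1=000011101$: -12: 011000110|101110000; -4: 011000110|110101000; 2: 011001100|110100010; 4: 011010100|101100010; 6: 011100010|101100010; 4: 011100010|110001100. Group $B_1=001001110$: 8: 001020100|110100001; -4: 001110010|110100001; 4: 010101010|200010001; -4: 010110001|110100001. Group $B_1=001010101$: -2: 010110001|200001010; 6: 100011010|110100001. Group $B_1=001010200$: 2: 020100001|100002010. *)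

theory Defs
  imports
    "HOL-Analysis.Analysis"
    "HOL-Combinatorics.Permutations"
    "HOL-Library.Poly_Mapping"
begin

section \<open>Complex polynomials in variables indexed by \<open>'v\<close>\<close>

text \<open>A monomial is a finitely supported exponent function, a polynomial a finitely supported
  family of coefficients; the ring structure is the convolution product of \<open>Poly_Mapping\<close>.\<close>

type_synonym 'v cpoly = "('v \<Rightarrow>\<^sub>0 nat) \<Rightarrow>\<^sub>0 complex"

definition pconst :: "complex \<Rightarrow> 'v cpoly" where
  "pconst c = Poly_Mapping.single 0 c"

definition pvar :: "'v \<Rightarrow> 'v cpoly" where
  "pvar v = Poly_Mapping.single (Poly_Mapping.single v 1) 1"

text \<open>\<open>psubst \<phi>\<close> is the homomorphism of algebras that sends each variable \<open>v\<close> to \<open>\<phi> v\<close>.\<close>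

definition psubst :: "('v \<Rightarrow> 'w cpoly) \<Rightarrow> 'v cpoly \<Rightarrow> 'w cpoly" where
  "psubst \<phi> f =
     (\<Sum>m\<in>Poly_Mapping.keys f. pconst (Poly_Mapping.lookup f m) *
        (\<Prod>v\<in>Poly_Mapping.keys m. \<phi> v ^ Poly_Mapping.lookup m v))"

definition homogeneous :: "nat \<Rightarrow> 'v cpoly \<Rightarrow> bool" where
  "homogeneous d f \<longleftrightarrow>
     (\<forall>m\<in>Poly_Mapping.keys f. (\<Sum>v\<in>Poly_Mapping.keys m. Poly_Mapping.lookup m v) = d)"

definition num_terms :: "'v cpoly \<Rightarrow> nat" where
  "num_terms f = card (Poly_Mapping.keys f)"

text \<open>A family \<open>\<phi>\<close> freely generates \<open>S\<close> if the evaluation homomorphism from the polynomial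
  algebra with one variable for each member of \<open>\<phi>\<close> is an isomorphism onto \<open>S\<close>: injectivity is
  algebraic independence, and the image is the subalgebra generated by \<open>\<phi>\<close>.\<close>

definition freely_generates :: "('v \<Rightarrow> 'w cpoly) \<Rightarrow> 'w cpoly set \<Rightarrow> bool" where
  "freely_generates \<phi> S \<longleftrightarrow> bij_betw (psubst \<phi>) UNIV S"

section \<open>The polynomial ring of the cube and the invariants\<close>

text \<open>The numeral type \<open>3\<close> has the elements 1, 2 and 3 (where 3 = 0), as in HOL-Analysis;
  they serve as the values of the three subscripts and as the names of the three directions.\<close>

type_synonym idx = "3 \<times> 3 \<times> 3"

type_synonym cube_poly = "idx cpoly"

definition act :: "complex^3^3 \<Rightarrow> complex^3^3 \<Rightarrow> complex^3^3 \<Rightarrow> cube_poly \<Rightarrow> cube_poly" where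
  "act A B C = psubst (\<lambda>(i, j, k).
     \<Sum>p\<in>UNIV. \<Sum>q\<in>UNIV. \<Sum>r\<in>UNIV.
       pconst (A $ p $ i * B $ q $ j * C $ r $ k) * pvar (p, q, r))"

definition invariants :: "cube_poly set" where
  "invariants = {f. \<forall>A B C. det A = 1 \<and> det B = 1 \<and> det C = 1 \<longrightarrow> act A B C f = f}"

section \<open>Exponent arrays, the finite group and orbit sums\<close>

type_synonym arr = "idx \<Rightarrow> nat"

definition mon :: "arr \<Rightarrow> cube_poly" where
  "mon E = (\<Prod>t\<in>UNIV. pvar t ^ E t)"

definition degree_arr :: "arr \<Rightarrow> nat" where
  "degree_arr E = (\<Sum>t\<in>UNIV. E t)"

definition weight_zero :: "arr \<Rightarrow> bool" where
  "weight_zero E \<longleftrightarrow>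
     (\<forall>i i'. (\<Sum>j\<in>UNIV. \<Sum>k\<in>UNIV. E (i, j, k)) = (\<Sum>j\<in>UNIV. \<Sum>k\<in>UNIV. E (i', j, k))) \<and>
     (\<forall>j j'. (\<Sum>i\<in>UNIV. \<Sum>k\<in>UNIV. E (i, j, k)) = (\<Sum>i\<in>UNIV. \<Sum>k\<in>UNIV. E (i, j', k))) \<and>
     (\<forall>k k'. (\<Sum>i\<in>UNIV. \<Sum>j\<in>UNIV. E (i, j, k)) = (\<Sum>i\<in>UNIV. \<Sum>j\<in>UNIV. E (i, j, k')))"

definition weight_zero_arrays :: "nat \<Rightarrow> arr set" where
  "weight_zero_arrays d = {E. weight_zero E \<and> degree_arr E = d}"

type_synonym grp = "(3 \<Rightarrow> 3) \<times> (3 \<Rightarrow> 3) \<times> (3 \<Rightarrow> 3) \<times> (3 \<Rightarrow> 3)"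

definition perms3 :: "(3 \<Rightarrow> 3) set" where
  "perms3 = {\<sigma>. \<sigma> permutes UNIV}"

text \<open>The elements of the semidirect product as quadruples; orbits and orbit sums depend only on
  the set of transformations of arrays, so the group multiplication is not needed.\<close>

definition G :: "grp set" where
  "G = perms3 \<times> perms3 \<times> perms3 \<times> perms3"

definition coord :: "idx \<Rightarrow> 3 \<Rightarrow> 3" where
  "coord = (\<lambda>(t1, t2, t3) d. if d = 1 then t1 else if d = 2 then t2 else t3)"

definition slice_act :: "(3 \<Rightarrow> 3) \<Rightarrow> (3 \<Rightarrow> 3) \<Rightarrow> (3 \<Rightarrow> 3) \<Rightarrow> arr \<Rightarrow> arr" where
  "slice_act \<alpha> \<beta> \<gamma> E = (\<lambda>(i, j, k). E (\<alpha> i, \<beta> j, \<gamma> k))"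

definition dir_act :: "(3 \<Rightarrow> 3) \<Rightarrow> arr \<Rightarrow> arr" where
  "dir_act \<delta> E = (\<lambda>t. E (coord t (\<delta> 1), coord t (\<delta> 2), coord t (\<delta> 3)))"

text \<open>The element \<open>(\<alpha>, \<beta>, \<gamma>, \<delta>)\<close> acts as \<open>(\<alpha>, \<beta>, \<gamma>)\<close> after \<open>\<delta>\<close>. The opposite order gives the
  same orbits and orbit sums, because conjugation by \<open>\<delta>\<close> only permutes \<open>\<alpha>, \<beta>, \<gamma>\<close>.\<close>

definition gact :: "grp \<Rightarrow> arr \<Rightarrow> arr" where
  "gact = (\<lambda>(\<alpha>, \<beta>, \<gamma>, \<delta>) E. slice_act \<alpha> \<beta> \<gamma> (dir_act \<delta> E))"

definition gsign :: "grp \<Rightarrow> int" where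
  "gsign = (\<lambda>(\<alpha>, \<beta>, \<gamma>, \<delta>). sign \<alpha> * sign \<beta> * sign \<gamma> * sign \<delta>)"

text \<open>Orbits and orbit sums of the monomial \<open>mon E\<close>, as functions of the array \<open>E\<close>.\<close>

definition orbit :: "arr \<Rightarrow> cube_poly set" where
  "orbit E = {mon (gact g E) | g. g \<in> G}"

definition sym_orbit_sum :: "arr \<Rightarrow> cube_poly" where
  "sym_orbit_sum E =
     pconst (of_nat (card (orbit E)) / of_nat (card G)) * (\<Sum>g\<in>G. mon (gact g E))"

definition alt_orbit_sum :: "arr \<Rightarrow> cube_poly" where
  "alt_orbit_sum E =
     pconst (of_nat (card (orbit E)) / of_nat (card G)) *
       (\<Sum>g\<in>G. of_int (gsign g) * mon (gact g E))"

section \<open>The three polynomials\<close>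

text \<open>A product of variables is written as the list of its subscripts, repeated according to
  the exponents: \<open>[133,133,221,222,311,312]\<close> stands for the array of
  \<open>x\<^sub>1\<^sub>3\<^sub>3\<^sup>2 x\<^sub>2\<^sub>2\<^sub>1 x\<^sub>2\<^sub>2\<^sub>2 x\<^sub>3\<^sub>1\<^sub>1 x\<^sub>3\<^sub>1\<^sub>2\<close>.\<close>

definition subscripts :: "nat \<Rightarrow> idx" where
  "subscripts n = (of_nat (n div 100), of_nat (n div 10 mod 10), of_nat (n mod 10))"

definition array_of :: "nat list \<Rightarrow> arr" where
  "array_of ns = count_list (map subscripts ns)"

definition I6 :: cube_poly where
  "I6 =
   - 10 * sym_orbit_sum (array_of [123,132,213,231,312,321])
   - 4 * sym_orbit_sum (array_of [132,133,213,221,311,322])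
   - 2 * sym_orbit_sum (array_of [133,133,221,222,311,312])
   + sym_orbit_sum (array_of [133,133,222,222,311,311])
   + 2 * sym_orbit_sum (array_of [132,133,221,223,311,312])
   + 2 * sym_orbit_sum (array_of [132,133,213,222,311,321])
   + 4 * sym_orbit_sum (array_of [133,133,212,221,311,322])
   + 8 * sym_orbit_sum (array_of [123,132,213,231,311,322])"

definition I9 :: cube_poly where
  "I9 =
   alt_orbit_sum (array_of [123,132,133,213,221,232,311,311,322])
   + alt_orbit_sum (array_of [123,132,133,213,221,231,312,312,321])
   + alt_orbit_sum (array_of [123,132,133,213,221,222,311,312,331])
   + alt_orbit_sum (array_of [123,132,133,213,221,221,311,312,332])
   + alt_orbit_sum (array_of [123,132,133,212,223,231,311,312,321])
   + alt_orbit_sum (array_of [123,132,133,212,222,231,311,311,323])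
   + alt_orbit_sum (array_of [123,132,133,212,221,232,311,313,321])
   + alt_orbit_sum (array_of [123,132,133,212,221,231,311,313,322])
   + alt_orbit_sum (array_of [123,132,133,212,213,221,312,321,331])
   + alt_orbit_sum (array_of [123,132,133,212,212,231,313,321,321])
   + alt_orbit_sum (array_of [123,132,133,211,212,232,311,321,323])
   + alt_orbit_sum (array_of [123,132,132,213,221,231,311,312,323])
   + alt_orbit_sum (array_of [123,132,132,213,221,222,311,311,333])
   + alt_orbit_sum (array_of [123,132,132,213,213,231,312,321,321])"

text \<open>For \<open>I12\<close> an array is given by three blocks of nine decimal digits, block \<open>i\<close> listing the
  entries \<open>(i, 1, 1), (i, 1, 2), (i, 1, 3), (i, 2, 1), \<dots>, (i, 3, 3)\<close>. Each block is read as one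
  decimal numeral (its leading zeros are lost, but \<open>div\<close> and \<open>mod\<close> recover them).\<close>

definition digit_pos :: "3 \<Rightarrow> nat" where
  "digit_pos i = (if i = 1 then 0 else if i = 2 then 1 else 2)"

definition block_array :: "nat \<Rightarrow> nat \<Rightarrow> nat \<Rightarrow> arr" where
  "block_array b1 b2 b3 = (\<lambda>(i, j, k).
     (if i = 1 then b1 else if i = 2 then b2 else b3)
       div 10 ^ (8 - (3 * digit_pos j + digit_pos k)) mod 10)"

text \<open>The list of pairs of a first block and the entries (coefficient, second block, third block)
  with this first block.\<close>

definition I12_data :: "(nat \<times> (int \<times> nat \<times> nat) list) list" where
  "I12_data = [
   (000001012,
     [(1, 001110010, 210100000), (-1, 001110010, 300010000), (-1, 001110100, 120100000),
      (1, 001110100, 210010000), (-1, 001120000, 210000100), (1, 001120000, 300000010),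
      (-1, 001200010, 120100000), (1, 001200010, 210010000), (1, 001200100, 030100000),
      (2, 001210000, 120000100), (-2, 001210000, 210000010), (-1, 001300000, 030000100),
      (1, 001300000, 120000010), (-2, 010101010, 210100000), (2, 010101010, 300010000),
      (1, 010101100, 120100000), (-1, 010101100, 210010000), (1, 010110010, 201100000),
      (-1, 010110010, 300001000), (1, 010110100, 201010000), (-1, 010110100, 210001000),
      (1, 010200010, 111100000), (-2, 010200010, 201010000), (1, 010200010, 210001000),
      (-1, 010200100, 021100000), (1, 010200100, 111010000), (-1, 010201000, 120000100),
      (1, 010201000, 210000010), (-1, 010210000, 111000100), (1, 010210000, 201000010),
      (-1, 010300000, 111000010), (-2, 011100100, 020200000), (4, 011100100, 110110000),
      (-2, 011100100, 200020000), (2, 011200000, 020100100), (-3, 011200000, 110010100),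
      (-1, 011200000, 110100010), (2, 011200000, 200010010), (2, 020200000, 101010100),
      (1, 020200000, 101100010), (-2, 020200000, 200001010), (-1, 100011100, 120100000),
      (1, 100011100, 210010000), (1, 100020100, 111100000), (-1, 100020100, 210001000),
      (2, 100101010, 120100000), (-2, 100101010, 210010000), (-2, 100110010, 111100000),
      (-2, 100110100, 111010000), (1, 100110100, 120001000), (-1, 100111000, 120000100),
      (1, 100111000, 210000010), (1, 100120000, 111000100), (-1, 100200010, 120001000),
      (-1, 100201000, 120000010), (-2, 101010100, 110110000), (-2, 101100010, 110110000),
      (1, 101100010, 200020000), (4, 101110000, 110100010), (-1, 101110000, 200010010),
      (-2, 110100010, 110101000), (-1, 110100010, 200011000), (2, 110110000, 200001010)]),
   (000001021,
     [(1, 001011100, 300010000), (-1, 001020100, 300001000), (1, 001110001, 300010000),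
      (2, 001110100, 111100000), (-2, 001110100, 201010000), (-1, 001120000, 300000001),
      (1, 001200001, 120100000), (-1, 001200001, 210010000), (1, 001200100, 111010000),
      (1, 001200100, 120001000), (-1, 001201000, 120000100), (-3, 001210000, 111000100),
      (2, 001210000, 210000001), (2, 001300000, 021000100), (1, 002010100, 110200000),
      (-1, 002010100, 200110000), (2, 002100100, 020200000), (-4, 002100100, 110110000),
      (2, 002100100, 200020000), (-1, 002110000, 200010100), (-2, 002200000, 020100100),
      (3, 002200000, 110010100), (1, 010002100, 300010000), (-1, 010011100, 300001000),
      (-2, 010101001, 300010000), (-2, 010101100, 111100000), (2, 010101100, 210001000),
      (1, 010111000, 300000001), (-1, 010200001, 111100000), (2, 010200001, 201010000),
      (-1, 010200100, 102010000), (-1, 010200100, 111001000), (3, 010201000, 111000100),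
      (1, 010210000, 102000100), (-2, 010300000, 012000100), (3, 011001100, 110200000),
      (-3, 011001100, 200110000), (3, 011010100, 200101000), (1, 011100001, 200110000),
      (2, 011100100, 101110000), (-2, 011100100, 110101000), (-2, 011101000, 110100100),
      (3, 011101000, 200010100), (2, 011110000, 101100100), (-3, 011110000, 200001100),
      (1, 011110000, 200100001), (-1, 011200000, 101010100), (1, 011200000, 110001100),
      (-2, 011200000, 200010001), (-2, 012100000, 100110100), (1, 020001100, 200101000),
      (-1, 020100001, 200101000), (4, 020100100, 101101000), (-2, 020100100, 200002000),
      (1, 020101000, 200001100), (-1, 020101000, 200100001), (-3, 020200000, 101001100),
      (2, 020200000, 200001001), (2, 021100000, 100101100), (-2, 100101001, 120100000),
      (-2, 100101100, 120001000), (2, 100110001, 111100000), (4, 101001100, 110110000),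
      (1, 101010001, 110200000), (2, 101010100, 101110000), (-2, 101010100, 110101000),
      (-2, 101020000, 101100100), (2, 101100001, 110110000), (-4, 101101000, 110010100),
      (2, 101110000, 110001100), (-4, 101110000, 110100001), (-2, 110001001, 110200000),
      (-2, 110001100, 110101000), (2, 110002000, 110100100)]),
   (000001030,
     [(1, 001011100, 300001000), (-1, 001101100, 210001000), (-2, 001110001, 300001000),
      (2, 001200001, 210001000), (3, 002100100, 110101000), (-2, 002100100, 200011000),
      (2, 002200000, 200010001), (1, 003000100, 010300000), (-4, 011100100, 101101000),
      (2, 100101001, 111100000), (2, 100101100, 111001000), (2, 101010100, 101101000)]),
   (000001111,
     [(-4, 001020100, 111100000), (3, 001020100, 210001000), (-2, 001110010, 210001000),
      (4, 001120000, 111000100), (-1, 001120000, 210000001), (-3, 002010100, 020200000),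
      (4, 002010100, 110110000), (-1, 002010100, 200020000), (4, 002110000, 020100100),
      (-4, 002110000, 110010100), (2, 010101010, 111100000), (2, 010101100, 111010000),
      (-2, 010110001, 201010000), (-4, 010111000, 111000100), (-2, 010200001, 111010000),
      (-2, 010200010, 111001000), (-4, 011001100, 110110000), (2, 011010100, 101110000),
      (-2, 011010100, 110101000), (2, 011011000, 110100100), (-2, 011100001, 110110000),
      (2, 011100010, 200011000), (2, 011100100, 110011000), (6, 011101000, 110100010),
      (-4, 011101000, 200010010), (2, 011110000, 200010001), (4, 110001001, 110110000)]),
   (000001120,
     [(2, 001110001, 210001000), (-4, 001200001, 120001000), (1, 002020000, 200100001),
      (-1, 002100001, 020200000), (4, 002110000, 110100001), (-3, 002110000, 200010001),
      (2, 010101001, 201010000), (-2, 010200001, 102010000), (2, 011100001, 110101000),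
      (-2, 011100001, 200011000), (-4, 011101000, 110100001), (1, 011101000, 200010001),
      (3, 011110000, 200001001), (-2, 020100001, 101101000), (4, 020101000, 101100001),
      (-2, 021100000, 100101001), (2, 101010001, 101110000), (-4, 101110000, 110001001)]),
   (000002020,
     [(-4, 002000200, 020200000), (6, 002000200, 110110000), (-2, 002000200, 200020000),
      (-5, 002100100, 110010100), (-12, 011100100, 011100100), (4, 011100100, 101010100),
      (-8, 101000101, 110110000), (-4, 101010100, 101010100), (4, 101010100, 110100001),
      (2, 101100001, 110010100)]),
   (000002110,
     [(8, 011000101, 110110000), (-6, 011010100, 101100010), (-2, 011010100, 110100001),
      (5, 011010100, 200010001), (-6, 011100001, 110100010), (-2, 011100010, 101010100),
      (-1, 011100010, 200010001), (-4, 011100100, 110010001), (2, 011110000, 110000101),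
      (-6, 011110000, 200000011), (4, 110010001, 110100001)]),
   (000011011,
     [(24, 011100100, 011100100), (-8, 011100100, 101010100), (10, 101000101, 110110000),
      (-8, 101000110, 101110000), (-2, 101000110, 110101000), (4, 101010100, 101100010),
      (-2, 101010100, 110100001)]),
   (000011101,
     [(-12, 011000110, 101110000), (-4, 011000110, 110101000), (2, 011001100, 110100010),
      (4, 011010100, 101100010), (6, 011100010, 101100010), (4, 011100010, 110001100)]),
   (001001110,
     [(8, 001020100, 110100001), (-4, 001110010, 110100001), (4, 010101010, 200010001),
      (-4, 010110001, 110100001)]),
   (001010101,
     [(-2, 010110001, 200001010), (6, 100011010, 110100001)]),
   (001010200,
     [(2, 020100001, 100002010)])]"

definition I12 :: cube_poly where
  "I12 = (\<Sum>(b1, es)\<leftarrow>I12_data. \<Sum>(c, b2, b3)\<leftarrow>es.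
     of_int c * sym_orbit_sum (block_array b1 b2 b3))"

definition fundamental :: "3 \<Rightarrow> cube_poly" where
  "fundamental i = (if i = 1 then I6 else if i = 2 then I9 else I12)"

end

theory Submission
  imports Defs "HOL-Computational_Algebra.Polynomial" "HOL-Computational_Algebra.Fundamental_Theorem_Algebra"
    "HOL-Library.List_Lexorder"
begin

text \<open>
  The representation belongs to a \<open>3\<close>-grading of the Lie algebra \<open>E\<^sub>6\<close>, and the structure of its invariants follows the
  theory of such gradings: a Cartan subspace of dimension 3, whose points are \<open>cartan a b c\<close>, meets a dense set of orbits, and the
  stabiliser of this subspace acts on it through a finite complex reflection group of order 648 with basic invariants
  \<open>f6\<close>, \<open>f9\<close>, \<open>f12\<close> of degrees 6, 9, 12. So the restriction to the Cartan subspace embeds the ring of invariants into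
  \<open>\<complex>[f6, f9, f12]\<close>. All this is proved directly: density by a tangent space computation
  (\<open>invariant_eq_0_if_vanishing_on_cartan\<close>), and the invariants of the reflection group by an explicit
  set of generators \<open>1, e2, e2\<^sup>2, e2\<^sup>3\<close> over \<open>\<complex>[f6, f9, f12]\<close> of the invariants of a subgroup of index 4 (\<open>weyl_invariant_basic\<close>).

  As a consequence (\<open>free_generation\<close>), any nonzero homogeneous invariants of degrees 6, 9 and 12 are free generators,
  as long as the last one vanishes at \<open>cartan 1 0 0\<close>, which excludes multiples of the square of the first one. The vanishing is
  clear for \<open>I12\<close>: no exponent array in its list has an entry 4. What has to be shown about
  the given polynomials is that they are invariant.

  Weight zero means that diagonal matrices act through powers of their determinants, and elimination reduces the rest to elementary
  matrices. Because of the symmetry (up to sign) under the finite group, a single one-parameter group of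
  elementary matrices is enough, and for it the derivative has to vanish (\<open>family_sum_invariant\<close>). The derivative is a
  combination of orbits of arrays, and its vanishing is an identity between integers. It is checked by a program
  on arrays that is executed by rewriting and proved correct in \<open>verified_family\<close>. The same run determines the
  stabilisers, hence the orbit sizes and the numbers of terms, and shows that the orbits are distinct.
\<close>

section \<open>Evaluation of polynomials\<close>

definition monom_val :: "('v::finite \<Rightarrow> complex) \<Rightarrow> ('v \<Rightarrow> nat) \<Rightarrow> complex" where
  "monom_val x e = (\<Prod>v\<in>UNIV. x v ^ e v)"

definition peval :: "('v::finite \<Rightarrow> complex) \<Rightarrow> 'v cpoly \<Rightarrow> complex" where
  "peval x f = (\<Sum>m\<in>Poly_Mapping.keys f. Poly_Mapping.lookup f m * monom_val x (Poly_Mapping.lookup m))"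

lemma monom_val_lookup_add:
  "monom_val x (Poly_Mapping.lookup (m + n)) =
    monom_val x (Poly_Mapping.lookup m) * monom_val x (Poly_Mapping.lookup n)"
  by (simp add: monom_val_def lookup_add power_add prod.distrib)

lemma monom_val_0 [simp]: "monom_val x (\<lambda>v. 0) = 1"
  by (simp add: monom_val_def)

lemma peval_superset:
  assumes "finite S" "Poly_Mapping.keys f \<subseteq> S"
  shows "peval x f = (\<Sum>m\<in>S. Poly_Mapping.lookup f m * monom_val x (Poly_Mapping.lookup m))"
  unfolding peval_def using assms by (intro sum.mono_neutral_left) (auto simp: in_keys_iff)

lemma peval_0 [simp]: "peval x 0 = 0"
  by (simp add: peval_def)

lemma peval_add [simp]: "peval x (f + g) = peval x f + peval x g"
proof -
  let ?S = "Poly_Mapping.keys f \<union> Poly_Mapping.keys g"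
  have "finite ?S" by simp
  moreover have "Poly_Mapping.keys (f + g) \<subseteq> ?S" by (rule keys_add)
  ultimately show ?thesis
    by (simp add: peval_superset[of ?S] lookup_add sum.distrib distrib_right)
qed

lemma peval_uminus [simp]: "peval x (- f) = - peval x f"
proof -
  have "peval x (- f) + peval x f = 0"
    by (simp flip: peval_add)
  then show ?thesis by (simp add: eq_neg_iff_add_eq_0)
qed

lemma peval_diff [simp]: "peval x (f - g) = peval x f - peval x g"
  by (metis peval_add peval_uminus uminus_add_conv_diff add.commute)

lemma peval_sum: "peval x (sum f S) = (\<Sum>i\<in>S. peval x (f i))"
  by (induction S rule: infinite_finite_induct) auto

lemma peval_single: "peval x (Poly_Mapping.single m c) = c * monom_val x (Poly_Mapping.lookup m)"
  by (cases "c = 0") (auto simp: peval_def)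

lemma poly_mapping_as_sum:
  "f = (\<Sum>m\<in>Poly_Mapping.keys f. Poly_Mapping.single m (Poly_Mapping.lookup f m))"
proof (rule poly_mapping_eqI)
  fix k
  show "Poly_Mapping.lookup f k =
    Poly_Mapping.lookup (\<Sum>m\<in>Poly_Mapping.keys f. Poly_Mapping.single m (Poly_Mapping.lookup f m)) k"
    by (simp add: lookup_sum lookup_single when_def in_keys_iff)
qed

lemma peval_mult [simp]: "peval x (f * g) = peval x f * peval x g"
proof -
  have "f * g = (\<Sum>m\<in>Poly_Mapping.keys f. \<Sum>n\<in>Poly_Mapping.keys g.
      Poly_Mapping.single (m + n) (Poly_Mapping.lookup f m * Poly_Mapping.lookup g n))"
    by (subst poly_mapping_as_sum[of f], subst poly_mapping_as_sum[of g])
      (simp add: sum_product mult_single)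
  then have "peval x (f * g) = (\<Sum>m\<in>Poly_Mapping.keys f. \<Sum>n\<in>Poly_Mapping.keys g.
      Poly_Mapping.lookup f m * Poly_Mapping.lookup g n *
      (monom_val x (Poly_Mapping.lookup m) * monom_val x (Poly_Mapping.lookup n)))"
    by (simp add: peval_sum peval_single monom_val_lookup_add)
  also have "\<dots> = peval x f * peval x g"
    by (simp add: peval_def sum_product mult_ac)
  finally show ?thesis .
qed

lemma peval_pconst [simp]: "peval x (pconst c) = c"
  by (simp add: pconst_def peval_single monom_val_def)

lemma peval_1 [simp]: "peval x 1 = 1"
  using peval_pconst[of x 1] by (simp add: pconst_def)

lemma peval_power [simp]: "peval x (f ^ n) = peval x f ^ n"
  by (induction n) auto

lemma peval_prod: "peval x (prod f S) = (\<Prod>i\<in>S. peval x (f i))"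
  by (induction S rule: infinite_finite_induct) auto

lemma peval_of_int [simp]: "peval x (of_int n) = of_int n"
  using peval_pconst[of x "of_int n"] by (simp add: pconst_def)

lemma peval_pvar [simp]: "peval x (pvar v) = x v"
proof -
  have "(\<Prod>w\<in>UNIV. x w ^ (1 when v = w)) = (\<Prod>w\<in>UNIV. if v = w then x v else 1)"
    by (rule prod.cong) (auto simp: when_def)
  then show ?thesis by (simp add: pvar_def peval_single monom_val_def lookup_single)
qed

lemma peval_psubst [simp]: "peval x (psubst \<phi> f) = peval (\<lambda>v. peval x (\<phi> v)) f"
proof -
  have "(\<Prod>v\<in>Poly_Mapping.keys m. peval x (\<phi> v) ^ Poly_Mapping.lookup m v) =
      (\<Prod>v\<in>UNIV. peval x (\<phi> v) ^ Poly_Mapping.lookup m v)" for m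
    by (rule prod.mono_neutral_left) (auto simp: in_keys_iff)
  then show ?thesis
    by (simp add: psubst_def peval_sum peval_prod peval_def[of _ f] monom_val_def)
qed

text \<open>Uniqueness of base-\<open>N\<close> digits, for the substitution of \<open>t ^ N ^ k\<close> for the \<open>k\<close>-th variable of a
  polynomial: it separates monomials as soon as \<open>N\<close> exceeds all exponents, because these become
  the digits of the exponent of \<open>t\<close>. For \<open>t \<noteq> 0\<close> it yields points with nonzero coordinates.\<close>

lemma digits_unique:
  fixes d d' :: "nat \<Rightarrow> nat"
  assumes "\<And>k. k < n \<Longrightarrow> d k < N" "\<And>k. k < n \<Longrightarrow> d' k < N"
    and "(\<Sum>k<n. d k * N ^ k) = (\<Sum>k<n. d' k * N ^ k)" and "k < n"
  shows "d k = d' k"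
  using assms
proof (induction n arbitrary: d d' k)
  case (Suc n)
  have N: "0 < N" using Suc.prems(1)[of 0] by simp
  have split: "(\<Sum>k<Suc n. e k * N ^ k) = e 0 + N * (\<Sum>k<n. e (Suc k) * N ^ k)" for e :: "nat \<Rightarrow> nat"
    unfolding sum.lessThan_Suc_shift by (simp add: sum_distrib_left mult_ac)
  have eq: "d 0 + N * (\<Sum>k<n. d (Suc k) * N ^ k) = d' 0 + N * (\<Sum>k<n. d' (Suc k) * N ^ k)"
    using Suc.prems(3) by (simp only: split)
  have "d 0 < N" "d' 0 < N" using Suc.prems(1,2)[of 0] by auto
  then have 0: "d 0 = d' 0"
    using arg_cong[OF eq, of "\<lambda>a. a mod N"] by simp
  then have "(\<Sum>k<n. d (Suc k) * N ^ k) = (\<Sum>k<n. d' (Suc k) * N ^ k)"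
    using eq N by simp
  from Suc.IH[OF _ _ this] Suc.prems(1,2) have "d (Suc j) = d' (Suc j)" if "j < n" for j
    using that by auto
  then show ?case using 0 Suc.prems(4) by (cases k) auto
qed simp

lemma poly_eq_0_if_vanishing:
  fixes f :: "'v::finite cpoly"
  assumes "\<And>x. (\<And>v. x v \<noteq> 0) \<Longrightarrow> peval x f = 0"
  shows "f = 0"
proof -
  obtain h :: "'v \<Rightarrow> nat" where h: "bij_betw h UNIV {..<CARD('v)}"
    using ex_bij_betw_finite_nat[of "UNIV :: 'v set"] by (auto simp: atLeast0LessThan)
  define N where "N = Suc (\<Sum>m\<in>Poly_Mapping.keys f. \<Sum>v\<in>UNIV. Poly_Mapping.lookup m v)"
  have N: "Poly_Mapping.lookup m v < N" if "m \<in> Poly_Mapping.keys f" for m v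
  proof -
    have "Poly_Mapping.lookup m v \<le> (\<Sum>v\<in>UNIV. Poly_Mapping.lookup m v)"
      by (rule member_le_sum) auto
    also have "\<dots> \<le> (\<Sum>m\<in>Poly_Mapping.keys f. \<Sum>v\<in>UNIV. Poly_Mapping.lookup m v)"
      using that by (intro member_le_sum) auto
    finally show ?thesis by (simp add: N_def)
  qed
  define ex where "ex m = (\<Sum>v\<in>UNIV. Poly_Mapping.lookup m v * N ^ h v)" for m :: "'v \<Rightarrow>\<^sub>0 nat"
  have inj: "inj_on ex (Poly_Mapping.keys f)"
  proof (rule inj_onI)
    fix m m' assume m: "m \<in> Poly_Mapping.keys f" "m' \<in> Poly_Mapping.keys f" and eq: "ex m = ex m'"
    have h': "inv h (h v) = v" for v using h by (metis bij_betw_def inv_f_f)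
    have reidx: "ex m = (\<Sum>k<CARD('v). Poly_Mapping.lookup m (inv h k) * N ^ k)" for m
      unfolding ex_def by (subst sum.reindex_bij_betw[OF h, symmetric]) (simp add: h')
    have "Poly_Mapping.lookup m (inv h k) = Poly_Mapping.lookup m' (inv h k)" if "k < CARD('v)" for k
      using digits_unique[of "CARD('v)" "\<lambda>k. Poly_Mapping.lookup m (inv h k)" N
          "\<lambda>k. Poly_Mapping.lookup m' (inv h k)" k] N[OF m(1)] N[OF m(2)] eq that
      by (simp add: reidx)
    then have "Poly_Mapping.lookup m v = Poly_Mapping.lookup m' v" for v
      using h h' by (metis UNIV_I bij_betwE lessThan_iff)
    then show "m = m'" by (rule poly_mapping_eqI)
  qed
  define p where "p = (\<Sum>m\<in>Poly_Mapping.keys f. monom (Poly_Mapping.lookup f m) (ex m))"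
  have "poly p t = 0" if "t \<noteq> 0" for t
  proof -
    have "monom_val (\<lambda>v. t ^ (N ^ h v)) (Poly_Mapping.lookup m) = t ^ ex m" for m
      by (simp add: monom_val_def ex_def power_sum mult.commute flip: power_mult)
    then have "poly p t = peval (\<lambda>v. t ^ (N ^ h v)) f"
      by (simp add: p_def peval_def poly_sum poly_monom)
    then show ?thesis using assms[of "\<lambda>v. t ^ (N ^ h v)"] that by simp
  qed
  then have "UNIV - {0} \<subseteq> {t. poly p t = 0}" by auto
  then have "infinite {t. poly p t = 0}"
    by (metis finite_subset infinite_UNIV_char_0 infinite_remove)
  then have "p = 0" using poly_roots_finite by blast
  have "Poly_Mapping.lookup f m = 0" if m: "m \<in> Poly_Mapping.keys f" for m
  proof -
    have "coeff p (ex m) = (\<Sum>m'\<in>Poly_Mapping.keys f. if m' = m then Poly_Mapping.lookup f m' else 0)"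
      unfolding p_def coeff_sum using inj m by (intro sum.cong) (auto simp: inj_on_eq_iff)
    then show ?thesis using \<open>p = 0\<close> m by simp
  qed
  then show ?thesis by (intro poly_mapping_eqI) (auto simp: in_keys_iff)
qed

lemma poly_eqI_peval:
  fixes f g :: "'v::finite cpoly"
  assumes "\<And>x. peval x f = peval x g"
  shows "f = g"
  using poly_eq_0_if_vanishing[of "f - g"] assms by simp

text \<open>A polynomial function is determined by its values outside the zero set of a polynomial
  \<open>g \<noteq> 0\<close>: on the line through a given point and a point where \<open>g\<close> does not vanish, the
  functions in question are polynomials in one variable.\<close>

lemma peval_on_line:
  fixes f :: "'v::finite cpoly"
  shows "\<exists>p. \<forall>t. peval (\<lambda>v. a v + t * b v) f = poly p t"
proof -
  have "peval (\<lambda>v. a v + t * b v) f = poly (\<Sum>m\<in>Poly_Mapping.keys f.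
      [:Poly_Mapping.lookup f m:] * (\<Prod>v\<in>UNIV. [:a v, b v:] ^ Poly_Mapping.lookup m v)) t" for t
    by (simp add: peval_def monom_val_def poly_sum poly_prod)
  then show ?thesis by blast
qed

lemma peval_eq_0_dense:
  fixes f g :: "'v::finite cpoly"
  assumes g: "peval y g \<noteq> 0" and f: "\<And>x. peval x g \<noteq> 0 \<Longrightarrow> peval x f = 0"
  shows "peval x f = 0"
proof -
  obtain p where p: "\<And>t. peval (\<lambda>v. x v + t * (y v - x v)) f = poly p t"
    using peval_on_line[of x "\<lambda>v. y v - x v" f] by blast
  obtain q where q: "\<And>t. peval (\<lambda>v. x v + t * (y v - x v)) g = poly q t"
    using peval_on_line[of x "\<lambda>v. y v - x v" g] by blast
  have "poly q 1 \<noteq> 0" using g q[of 1] by simp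
  then have "q \<noteq> 0" by auto
  have "poly p t * poly q t = 0" for t
    using f[of "\<lambda>v. x v + t * (y v - x v)"] p[of t] q[of t] by auto
  then have "p * q = 0" by (metis poly_all_0_iff_0 poly_mult)
  then have "p = 0" using \<open>q \<noteq> 0\<close> by simp
  then show ?thesis using p[of 0] by simp
qed

text \<open>Homogeneous components for the weights \<open>w\<close>, as functions: the value along a ray is a polynomial in the
  scaling factor, and its coefficients are again polynomials in the direction.\<close>

lemma peval_scale:
  fixes f :: "'v::finite cpoly"
  shows "peval (\<lambda>v. t ^ w v * x v) f = (\<Sum>m\<in>Poly_Mapping.keys f.
    Poly_Mapping.lookup f m * monom_val x (Poly_Mapping.lookup m) *
      t ^ (\<Sum>v\<in>UNIV. w v * Poly_Mapping.lookup m v))"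
  by (simp add: peval_def monom_val_def power_mult_distrib prod.distrib power_sum mult_ac
      flip: power_mult)

definition degree_part :: "('v::finite \<Rightarrow> nat) \<Rightarrow> nat \<Rightarrow> 'v cpoly \<Rightarrow> 'v cpoly" where
  "degree_part w n f = (\<Sum>m | m \<in> Poly_Mapping.keys f \<and> (\<Sum>v\<in>UNIV. w v * Poly_Mapping.lookup m v) = n.
     Poly_Mapping.single m (Poly_Mapping.lookup f m))"

lemma peval_degree_part:
  "peval x (degree_part w n f) =
    (\<Sum>m | m \<in> Poly_Mapping.keys f \<and> (\<Sum>v\<in>UNIV. w v * Poly_Mapping.lookup m v) = n.
      Poly_Mapping.lookup f m * monom_val x (Poly_Mapping.lookup m))"
  by (simp add: degree_part_def peval_sum peval_single)

lemma lookup_degree_part: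
  "Poly_Mapping.lookup (degree_part w n f) m =
    (if (\<Sum>v\<in>UNIV. w v * Poly_Mapping.lookup m v) = n then Poly_Mapping.lookup f m else 0)"
  by (auto simp: degree_part_def lookup_sum lookup_single when_def in_keys_iff)

lemma peval_scale_coeff:
  assumes p: "\<And>t. peval (\<lambda>v. t ^ w v * x v) f = poly p t"
  shows "coeff p n = peval x (degree_part w n f)"
proof -
  let ?q = "\<Sum>m\<in>Poly_Mapping.keys f. monom (Poly_Mapping.lookup f m * monom_val x (Poly_Mapping.lookup m))
      (\<Sum>v\<in>UNIV. w v * Poly_Mapping.lookup m v)"
  have "poly p t = poly ?q t" for t
    by (simp add: peval_scale flip: p) (simp add: poly_sum poly_monom)
  then have "p = ?q" by (simp add: fun_eq_iff flip: poly_eq_poly_eq_iff)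
  then show ?thesis
    by (simp add: coeff_sum peval_degree_part) (simp add: sum.inter_filter)
qed

text \<open>Infinitesimal approximation: a polynomial vanishing along curves that leave \<open>y\<close> with every
  possible velocity is zero, because the lowest homogeneous part of its expansion at \<open>y\<close>
  vanishes in all directions.\<close>

lemma poly_eq_0_if_vanishing_on_curves:
  fixes f :: "'v::finite cpoly"
  assumes "\<And>z. \<exists>u. (\<forall>v. ((\<lambda>t. u t v) \<longlongrightarrow> z v) (at 0)) \<and>
      (\<forall>t::complex. peval (\<lambda>v. y v + t * u t v) f = 0)"
  shows "f = 0"
proof (rule ccontr)
  assume "f \<noteq> 0"
  define g where "g = psubst (\<lambda>v. pconst (y v) + pvar v) f"
  have g: "peval x g = peval (\<lambda>v. y v + x v) f" for x by (simp add: g_def)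
  have "g \<noteq> 0"
  proof
    assume "g = 0"
    then have "peval (\<lambda>v. y v + x v) f = 0" for x using g[of x] by simp
    from this[of "\<lambda>v. x v - y v" for x] have "peval x f = 0" for x by simp
    then show False using \<open>f \<noteq> 0\<close> poly_eq_0_if_vanishing by blast
  qed
  define deg where "deg m = (\<Sum>v\<in>UNIV. Poly_Mapping.lookup m v)" for m :: "'v \<Rightarrow>\<^sub>0 nat"
  obtain k where k: "k \<in> Poly_Mapping.keys g"
    using \<open>g \<noteq> 0\<close> poly_mapping_eqI[of g 0] by (force simp: in_keys_iff)
  obtain m0 where m0: "m0 \<in> Poly_Mapping.keys g" "\<And>m. m \<in> Poly_Mapping.keys g \<Longrightarrow> deg m0 \<le> deg m"
    using ex_has_least_nat[of "\<lambda>m. m \<in> Poly_Mapping.keys g" k deg] k by blast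
  define d where "d = deg m0"
  have "peval z (degree_part (\<lambda>_. 1) d g) = 0" for z
  proof -
    obtain u where u: "\<And>v. ((\<lambda>t. u t v) \<longlongrightarrow> z v) (at 0)"
      and 0: "\<And>t::complex. peval (\<lambda>v. y v + t * u t v) f = 0"
      using assms by metis
    let ?F = "\<lambda>t. \<Sum>m\<in>Poly_Mapping.keys g. Poly_Mapping.lookup g m * monom_val (u t) (Poly_Mapping.lookup m) * t ^ (deg m - d)"
    have "?F t = 0" if "t \<noteq> 0" for t
    proof -
      have pow: "t ^ deg m = t ^ d * t ^ (deg m - d)" if "m \<in> Poly_Mapping.keys g" for m
        using m0(2)[OF that] by (simp add: d_def flip: power_add)
      have "peval (\<lambda>v. t * u t v) g = t ^ d * ?F t"
        using peval_scale[of t "\<lambda>_. 1" "u t" g]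
        by (simp add: deg_def[symmetric] sum_distrib_left mult_ac pow cong: sum.cong)
      then show ?thesis using 0[of t] that by (simp add: g)
    qed
    then have "(?F \<longlongrightarrow> 0) (at 0)"
      by (intro tendsto_eventually) (auto simp: eventually_at_filter)
    moreover have "(?F \<longlongrightarrow> (\<Sum>m\<in>Poly_Mapping.keys g. Poly_Mapping.lookup g m * monom_val z (Poly_Mapping.lookup m) * 0 ^ (deg m - d))) (at 0)"
      unfolding monom_val_def by (intro tendsto_intros u)
    ultimately have "(\<Sum>m\<in>Poly_Mapping.keys g. Poly_Mapping.lookup g m * monom_val z (Poly_Mapping.lookup m) * 0 ^ (deg m - d)) = 0"
      by (rule LIM_unique[rotated])
    moreover have "(\<Sum>m\<in>Poly_Mapping.keys g. Poly_Mapping.lookup g m * monom_val z (Poly_Mapping.lookup m) * 0 ^ (deg m - d)) =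
        (\<Sum>m\<in>Poly_Mapping.keys g. if deg m = d then Poly_Mapping.lookup g m * monom_val z (Poly_Mapping.lookup m) else 0)"
      using m0(2) by (intro sum.cong) (force simp: d_def)+
    ultimately show ?thesis
      unfolding peval_degree_part by (simp add: sum.inter_filter deg_def)
  qed
  then have "degree_part (\<lambda>_. 1) d g = 0" using poly_eq_0_if_vanishing by blast
  then show False
    using m0(1) lookup_degree_part[of "\<lambda>_. 1" d g m0] by (simp add: d_def deg_def in_keys_iff)
qed

section \<open>Arrays, and density of the orbits of the Cartan subspace\<close>

definition garr :: "complex^3^3 \<Rightarrow> complex^3^3 \<Rightarrow> complex^3^3 \<Rightarrow> (idx \<Rightarrow> complex) \<Rightarrow> idx \<Rightarrow> complex" where
  "garr A B C x = (\<lambda>(i, j, k). \<Sum>p\<in>UNIV. \<Sum>q\<in>UNIV. \<Sum>r\<in>UNIV. A $ p $ i * B $ q $ j * C $ r $ k * x (p, q, r))"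

lemma peval_act: "peval x (act A B C f) = peval (garr A B C x) f"
proof -
  have "(\<lambda>v. peval x (case v of (i, j, k) \<Rightarrow>
      \<Sum>p\<in>UNIV. \<Sum>q\<in>UNIV. \<Sum>r\<in>UNIV. pconst (A $ p $ i * B $ q $ j * C $ r $ k) * pvar (p, q, r))) = garr A B C x"
    by (auto simp: garr_def fun_eq_iff peval_sum)
  then show ?thesis by (simp add: act_def)
qed

lemma invariants_iff:
  "f \<in> invariants \<longleftrightarrow> (\<forall>A B C x. det A = 1 \<and> det B = 1 \<and> det C = 1 \<longrightarrow> peval (garr A B C x) f = peval x f)"
  unfolding invariants_def by (auto simp flip: peval_act intro!: poly_eqI_peval)

text \<open>A Cartan subspace of the representation. Each of the three coordinates occupies three cells, no two of
  them in a common slice, and the nine cells form the Latin square \<open>latin\<close>.\<close>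

definition cartan :: "complex \<Rightarrow> complex \<Rightarrow> complex \<Rightarrow> idx \<Rightarrow> complex" where
  "cartan a b c t =
    (if t \<in> {(1, 1, 1), (2, 2, 2), (3, 3, 3)} then a
     else if t \<in> {(1, 2, 3), (2, 3, 1), (3, 1, 2)} then b
     else if t \<in> {(1, 3, 2), (2, 1, 3), (3, 2, 1)} then c else 0)"

definition latin :: "idx set" where
  "latin = {(1, 1, 1), (2, 2, 2), (3, 3, 3), (1, 2, 3), (2, 3, 1), (3, 1, 2), (1, 3, 2), (2, 1, 3), (3, 2, 1)}"

definition diagm :: "(3 \<Rightarrow> complex) \<Rightarrow> complex^3^3" where
  "diagm s = (\<chi> i j. if i = j then s i else 0)"

lemma det_diagm: "det (diagm s) = s 1 * s 2 * s 3"
  by (simp add: diagm_def det_3)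

lemma garr_diagm: "garr (diagm s) (diagm t) (diagm u) x (i, j, k) = s i * t j * u k * x (i, j, k)"
  using exhaust_3[of i] exhaust_3[of j] exhaust_3[of k]
  by (elim disjE) (simp_all add: garr_def diagm_def sum_3)

text \<open>The torus of diagonal matrices of determinant 1 has dimension 6 and the arrays supported on the Latin
  square have dimension 9, so 3 parameters remain. In logarithms the equations are linear: \<open>a\<close>, \<open>b\<close>, \<open>c\<close>
  are the geometric means over the three transversals, and \<open>s\<close>, \<open>t\<close>, \<open>u\<close> are the quotients of the
  geometric means over the slices by the one over all nine cells.\<close>

lemma torus_cartan:
  assumes nz: "\<And>t. t \<in> latin \<Longrightarrow> y t \<noteq> 0" and supp: "\<And>t. t \<notin> latin \<Longrightarrow> y t = 0"
  obtains A B C a b c where "det A = 1" "det B = 1" "det C = 1" "garr A B C (cartan a b c) = y"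
proof -
  define l where "l t = Ln (y t)" for t
  have l: "exp (l t) = y t" if "t \<in> latin" for t using nz[OF that] by (simp add: l_def)
  define m where "m = (\<Sum>t\<in>latin. l t) / 9"
  have m: "m = (l (1,1,1) + l (2,2,2) + l (3,3,3) + l (1,2,3) + l (2,3,1) + l (3,1,2) + l (1,3,2) + l (2,1,3) + l (3,2,1)) / 9"
    by (simp add: m_def latin_def add_ac)
  define s where "s i = exp ((if i = 1 then l (1,1,1) + l (1,2,3) + l (1,3,2)
     else if i = 2 then l (2,2,2) + l (2,3,1) + l (2,1,3) else l (3,3,3) + l (3,1,2) + l (3,2,1)) / 3 - m)" for i :: 3
  define t where "t i = exp ((if i = 1 then l (1,1,1) + l (3,1,2) + l (2,1,3)
     else if i = 2 then l (2,2,2) + l (1,2,3) + l (3,2,1) else l (3,3,3) + l (2,3,1) + l (1,3,2)) / 3 - m)" for i :: 3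
  define u where "u i = exp ((if i = 1 then l (1,1,1) + l (2,3,1) + l (3,2,1)
     else if i = 2 then l (2,2,2) + l (3,1,2) + l (1,3,2) else l (3,3,3) + l (1,2,3) + l (2,1,3)) / 3 - m)" for i :: 3
  define a where "a = exp ((l (1,1,1) + l (2,2,2) + l (3,3,3)) / 3)"
  define b where "b = exp ((l (1,2,3) + l (2,3,1) + l (3,1,2)) / 3)"
  define c where "c = exp ((l (1,3,2) + l (2,1,3) + l (3,2,1)) / 3)"
  have e: "exp p = exp q" if "p = q" for p q :: complex using that by simp
  have det: "det (diagm s) = 1" "det (diagm t) = 1" "det (diagm u) = 1"
    unfolding det_diagm s_def t_def u_def exp_add[symmetric] exp_zero[symmetric]
    by (rule e; simp add: m field_simps)+
  have val: "garr (diagm s) (diagm t) (diagm u) (cartan a b c) v = y v" if "v \<in> latin" for v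
  proof -
    have "garr (diagm s) (diagm t) (diagm u) (cartan a b c) v = exp (l v)"
      using that unfolding latin_def
      apply (elim insertE emptyE; simp only: garr_diagm)
              apply (simp_all add: cartan_def s_def t_def u_def a_def b_def c_def flip: exp_add)
              apply (rule e; simp add: m field_simps)+
      done
    then show ?thesis using l[OF that] by simp
  qed
  have "garr (diagm s) (diagm t) (diagm u) (cartan a b c) v = y v" for v
  proof (cases "v \<in> latin")
    case False
    then have "cartan a b c v = 0" by (auto simp: cartan_def latin_def)
    then show ?thesis using supp[OF False] by (cases v) (simp add: garr_diagm)
  qed (rule val)
  then show ?thesis using that det by blast
qed

text \<open>The off-diagonal part of a velocity at the unit matrix is realised inside the determinant 1 matrices
  by a product of a lower and an upper unitriangular matrix.\<close>

lemma unipotent_curve: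
  fixes \<alpha> :: "3 \<Rightarrow> 3 \<Rightarrow> complex"
  obtains M :: "complex \<Rightarrow> complex^3^3" where "\<And>t. det (M t) = 1"
    "\<And>p i. M 0 $ p $ i = (if p = i then 1 else 0)"
    "\<And>p i. ((\<lambda>t. M t $ p $ i) has_field_derivative (if p = i then 0 else \<alpha> p i)) (at 0)"
proof -
  define L :: "complex \<Rightarrow> complex^3^3" where
    "L t = vector [vector [1, 0, 0], vector [t * \<alpha> 2 1, 1, 0], vector [t * \<alpha> 3 1, t * \<alpha> 3 2, 1]]" for t
  define U :: "complex \<Rightarrow> complex^3^3" where
    "U t = vector [vector [1, t * \<alpha> 1 2, t * \<alpha> 1 3], vector [0, 1, t * \<alpha> 2 3], vector [0, 0, 1]]" for t
  have "det (L t) = 1" "det (U t) = 1" for t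
    by (simp_all add: det_3 L_def U_def)
  then have "det (L t ** U t) = 1" for t
    by (simp add: det_mul)
  moreover have "\<forall>p i. (L 0 ** U 0) $ p $ i = (if p = i then 1 else 0)"
    by (simp add: forall_3 matrix_matrix_mult_def sum_3 L_def U_def)
  moreover have "\<forall>p i. ((\<lambda>t. (L t ** U t) $ p $ i) has_field_derivative (if p = i then 0 else \<alpha> p i)) (at 0)"
    by (simp add: forall_3 matrix_matrix_mult_def sum_3 L_def U_def)
      (auto intro!: derivative_eq_intros)
  ultimately show ?thesis using that[of "\<lambda>t. L t ** U t"] by blast
qed

lemma garr_has_derivative:
  fixes A B C :: "complex \<Rightarrow> complex^3^3"
  assumes A: "\<And>p i. A 0 $ p $ i = (if p = i then 1 else 0)"
    and B: "\<And>p i. B 0 $ p $ i = (if p = i then 1 else 0)"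
    and C: "\<And>p i. C 0 $ p $ i = (if p = i then 1 else 0)"
    and dA: "\<And>p i. ((\<lambda>t. A t $ p $ i) has_field_derivative \<alpha> p i) (at 0)"
    and dB: "\<And>p i. ((\<lambda>t. B t $ p $ i) has_field_derivative \<beta> p i) (at 0)"
    and dC: "\<And>p i. ((\<lambda>t. C t $ p $ i) has_field_derivative \<gamma> p i) (at 0)"
    and dx: "\<And>v. ((\<lambda>t. x t v) has_field_derivative \<xi> v) (at 0)"
  shows "((\<lambda>t. garr (A t) (B t) (C t) (x t) (i, j, k)) has_field_derivative
    ((\<Sum>p\<in>UNIV. \<alpha> p i * x 0 (p, j, k)) + (\<Sum>q\<in>UNIV. \<beta> q j * x 0 (i, q, k))
      + (\<Sum>r\<in>UNIV. \<gamma> r k * x 0 (i, j, r)) + \<xi> (i, j, k))) (at 0)"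
proof -
  let ?d = "\<lambda>p i. if p = i then 1 else (0::complex)"
  have "((\<lambda>t. garr (A t) (B t) (C t) (x t) (i, j, k)) has_field_derivative
    (\<Sum>p\<in>UNIV. \<Sum>q\<in>UNIV. \<Sum>r\<in>UNIV.
      \<alpha> p i * ?d q j * ?d r k * x 0 (p, q, r) + ?d p i * \<beta> q j * ?d r k * x 0 (p, q, r) +
      ?d p i * ?d q j * \<gamma> r k * x 0 (p, q, r) + ?d p i * ?d q j * ?d r k * \<xi> (p, q, r))) (at 0)"
    unfolding garr_def prod.case
    apply (intro DERIV_sum)
    apply (rule derivative_eq_intros dA dB dC dx refl)+
    apply (simp only: A B C)
    apply (simp add: algebra_simps)
    done
  moreover have "(\<Sum>p\<in>UNIV. \<Sum>q\<in>UNIV. \<Sum>r\<in>UNIV.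
      \<alpha> p i * ?d q j * ?d r k * x 0 (p, q, r) + ?d p i * \<beta> q j * ?d r k * x 0 (p, q, r) +
      ?d p i * ?d q j * \<gamma> r k * x 0 (p, q, r) + ?d p i * ?d q j * ?d r k * \<xi> (p, q, r)) =
     (\<Sum>p\<in>UNIV. \<alpha> p i * x 0 (p, j, k)) + (\<Sum>q\<in>UNIV. \<beta> q j * x 0 (i, q, k))
      + (\<Sum>r\<in>UNIV. \<gamma> r k * x 0 (i, j, r)) + \<xi> (i, j, k)"
    using exhaust_3[of i] exhaust_3[of j] exhaust_3[of k]
    by (elim disjE) (simp_all add: sum_3)
  ultimately show ?thesis by simp
qed

text \<open>The orbits of the Cartan subspace are dense. The torus moves it onto all arrays supported on the Latin
  square with nonzero entries there. At \<open>y0 = cartan 1 0 0\<close> the off-diagonal directions of the three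
  Lie algebras produce exactly the array directions outside the Latin square: the entry \<open>z (i, p, p)\<close> comes from the first
  factor, \<open>z (p, i, p)\<close> from the second and \<open>z (p, p, i)\<close> from the third. Thus curves through \<open>y0\<close> on which
  \<open>f\<close> vanishes have all possible velocities.\<close>

lemma invariant_eq_0_if_vanishing_on_cartan:
  assumes f: "f \<in> invariants" and 0: "\<And>a b c. peval (cartan a b c) f = 0"
  shows "f = 0"
proof -
  have inv: "peval (garr A B C x) f = peval x f" if "det A = 1" "det B = 1" "det C = 1" for A B C x
    using f that by (simp add: invariants_iff)
  define res where "res = psubst (\<lambda>t. if t \<in> latin then pvar t else 0) f"
  define nz :: cube_poly where "nz = (\<Prod>t\<in>latin. pvar t)"
  have "finite latin" by (simp add: latin_def)
  have res: "peval y res = peval (\<lambda>t. if t \<in> latin then y t else 0) f" for y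
    unfolding res_def peval_psubst by (intro arg_cong2[of _ _ _ _ peval]) auto
  have "peval y res = 0" if "peval y nz \<noteq> 0" for y
  proof -
    have ynz: "y t \<noteq> 0" if "t \<in> latin" for t
      using \<open>peval y nz \<noteq> 0\<close> that \<open>finite latin\<close> by (auto simp: nz_def peval_prod)
    obtain A B C a b c where "det A = 1" "det B = 1" "det C = 1"
        "garr A B C (cartan a b c) = (\<lambda>t. if t \<in> latin then y t else 0)"
      by (rule torus_cartan[of "\<lambda>t. if t \<in> latin then y t else 0"]) (use ynz in auto)
    then show ?thesis using inv[of A B C "cartan a b c"] 0 by (simp add: res)
  qed
  moreover have "peval (\<lambda>_. 1) nz \<noteq> 0" by (simp add: nz_def peval_prod)
  ultimately have "peval y res = 0" for y by (metis peval_eq_0_dense)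
  then have latin0: "peval y f = 0" if "\<And>t. t \<notin> latin \<Longrightarrow> y t = 0" for y
  proof -
    have "(\<lambda>t. if t \<in> latin then y t else 0) = y" using that by auto
    then show ?thesis using \<open>\<And>y. peval y res = 0\<close>[of y] by (simp add: res)
  qed
  define y0 where "y0 = cartan 1 0 0"
  show ?thesis
  proof (rule poly_eq_0_if_vanishing_on_curves[of y0])
    fix z :: "idx \<Rightarrow> complex"
    obtain A where A: "\<And>t. det (A t) = 1" "\<And>p i. A 0 $ p $ i = (if p = i then 1 else 0)"
      "\<And>p i. ((\<lambda>t. A t $ p $ i) has_field_derivative (if p = i then 0 else z (i, p, p))) (at 0)"
      using unipotent_curve[of "\<lambda>p i. z (i, p, p)"] by metis
    obtain B where B: "\<And>t. det (B t) = 1" "\<And>p i. B 0 $ p $ i = (if p = i then 1 else 0)"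
      "\<And>p i. ((\<lambda>t. B t $ p $ i) has_field_derivative (if p = i then 0 else z (p, i, p))) (at 0)"
      using unipotent_curve[of "\<lambda>p i. z (p, i, p)"] by metis
    obtain C where C: "\<And>t. det (C t) = 1" "\<And>p i. C 0 $ p $ i = (if p = i then 1 else 0)"
      "\<And>p i. ((\<lambda>t. C t $ p $ i) has_field_derivative (if p = i then 0 else z (p, p, i))) (at 0)"
      using unipotent_curve[of "\<lambda>p i. z (p, p, i)"] by metis
    define x where "x t v = y0 v + t * (if v \<in> latin then z v else 0)" for t v
    define \<Phi> where "\<Phi> t = garr (A t) (B t) (C t) (x t)" for t
    have dx: "((\<lambda>t. x t v) has_field_derivative (if v \<in> latin then z v else 0)) (at 0)" for v
      unfolding x_def by (auto intro!: derivative_eq_intros)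
    have "x 0 = y0" by (simp add: x_def fun_eq_iff)
    have "((\<lambda>t. \<Phi> t (i, j, k)) has_field_derivative z (i, j, k)) (at 0)" for i j k
    proof -
      have "(\<Sum>p\<in>UNIV. (if p = i then 0 else z (i, p, p)) * y0 (p, j, k)) +
         (\<Sum>q\<in>UNIV. (if q = j then 0 else z (q, j, q)) * y0 (i, q, k)) +
         (\<Sum>r\<in>UNIV. (if r = k then 0 else z (r, r, k)) * y0 (i, j, r)) +
         (if (i, j, k) \<in> latin then z (i, j, k) else 0) = z (i, j, k)"
        using exhaust_3[of i] exhaust_3[of j] exhaust_3[of k]
        by (elim disjE) (simp_all add: sum_3 y0_def cartan_def latin_def)
      then show ?thesis
        using garr_has_derivative[where x = x and i = i and j = j and k = k, OF A(2) B(2) C(2) A(3) B(3) C(3) dx]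
        unfolding \<Phi>_def \<open>x 0 = y0\<close> by simp
    qed
    then have d\<Phi>: "((\<lambda>t. \<Phi> t v) has_field_derivative z v) (at 0)" for v by (cases v) auto
    have \<Phi>0: "\<Phi> 0 = y0"
    proof -
      have "A 0 = diagm (\<lambda>_. 1)" "B 0 = diagm (\<lambda>_. 1)" "C 0 = diagm (\<lambda>_. 1)"
        using A(2) B(2) C(2) by (simp_all add: diagm_def vec_eq_iff)
      then show ?thesis by (auto simp: \<Phi>_def garr_diagm fun_eq_iff \<open>x 0 = y0\<close>)
    qed
    let ?u = "\<lambda>t v. (\<Phi> t v - y0 v) / t"
    have "((\<lambda>t. ?u t v) \<longlongrightarrow> z v) (at 0)" for v
      using d\<Phi>[of v] by (simp add: has_field_derivative_iff \<Phi>0)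
    moreover have "peval (\<lambda>v. y0 v + t * ?u t v) f = 0" for t
    proof -
      have "(\<lambda>v. y0 v + t * ?u t v) = \<Phi> t" by (cases "t = 0") (simp_all add: \<Phi>0)
      moreover have "peval (\<Phi> t) f = peval (x t) f"
        using inv A(1) B(1) C(1) by (simp add: \<Phi>_def)
      moreover have "peval (x t) f = 0"
        by (rule latin0) (auto simp: x_def y0_def cartan_def latin_def)
      ultimately show ?thesis by simp
    qed
    ultimately show "\<exists>u. (\<forall>v. ((\<lambda>t. u t v) \<longlongrightarrow> z v) (at 0)) \<and> (\<forall>t. peval (\<lambda>v. y0 v + t * u t v) f = 0)"
      by (intro exI[of _ ?u]) blast
  qed
qed

section \<open>The little Weyl group\<close>

definition \<omega> :: complex where "\<omega> = exp (2 * of_real pi * \<i> / 3)"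

lemma \<omega>3: "\<omega> ^ 3 = 1"
  unfolding \<omega>_def exp_of_nat_mult[symmetric] by (simp add: exp_eq_1)

lemma \<omega>_neq_1: "\<omega> \<noteq> 1"
proof
  assume "\<omega> = 1"
  then obtain n :: int where "2 * pi / 3 = real_of_int (2 * n) * pi"
    by (auto simp: \<omega>_def exp_eq_1)
  then have "2 * pi = (6 * real_of_int n) * pi" by simp
  then have "2 = 6 * real_of_int n" using pi_neq_zero mult_right_cancel by metis
  then have "real_of_int 2 = real_of_int (6 * n)" by simp
  then have "2 = 6 * n" by (simp only: of_int_eq_iff)
  then show False by presburger
qed

lemma \<omega>_square: "\<omega> ^ 2 = - 1 - \<omega>"
proof -
  have "(\<omega> - 1) * (\<omega> ^ 2 + \<omega> + 1) = 0"
    using \<omega>3 by (simp add: algebra_simps power2_eq_square power3_eq_cube)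
  then have "\<omega> ^ 2 + \<omega> + 1 = 0" using \<omega>_neq_1 by simp
  then show ?thesis by (simp add: algebra_simps eq_neg_iff_add_eq_0)
qed

lemma \<omega>_mult: "\<omega> * \<omega> = - 1 - \<omega>" "\<omega> * (\<omega> * z) = - z - \<omega> * z"
proof -
  show *: "\<omega> * \<omega> = - 1 - \<omega>" using \<omega>_square by (simp only: power2_eq_square)
  have "\<omega> * (\<omega> * z) = (\<omega> * \<omega>) * z" by simp
  then show "\<omega> * (\<omega> * z) = - z - \<omega> * z" unfolding * by (simp add: left_diff_distrib)
qed

lemma complex_cube_root: obtains z :: complex where "z ^ 3 = w"
proof (cases "w = 0")
  case False
  have "exp (Ln w / 3) ^ 3 = w"
    unfolding exp_of_nat_mult[symmetric] using False by simp
  then show ?thesis by (rule that)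
qed (use that[of 0] in simp)

text \<open>The Fourier matrix of order 3 has determinant \<open>3 * (\<omega> ^ 2 - \<omega>)\<close> up to sign, and \<open>\<kappa> ^ 2 = - 1 / 3\<close>, so the multiple by \<open>\<kappa>\<close>
  has determinant 1 up to sign.\<close>

definition \<kappa> :: complex where "\<kappa> = 1 / (\<omega> ^ 2 - \<omega>)"

lemma \<kappa>_eq: "\<kappa> = (1 + 2 * \<omega>) / 3"
proof -
  have "(\<omega> ^ 2 - \<omega>) * (1 + 2 * \<omega>) = 3"
    by (simp add: \<omega>_square algebra_simps \<omega>_mult)
  moreover from this have "\<omega> ^ 2 - \<omega> \<noteq> 0" by auto
  ultimately have "1 / (\<omega> ^ 2 - \<omega>) = (1 + 2 * \<omega>) / 3"
    by (subst frac_eq_eq) (simp_all only: mult.commute[of "1 + 2 * \<omega>"], simp_all)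
  then show ?thesis by (simp only: \<kappa>_def)
qed

lemma \<kappa>_square: "\<kappa> ^ 2 = - 1 / 3"
proof -
  have "(1 + 2 * \<omega>) ^ 2 = - 3" by (simp add: power2_eq_square algebra_simps \<omega>_mult)
  then show ?thesis by (simp add: \<kappa>_eq power_divide)
qed

context
  fixes f :: cube_poly
  assumes f: "f \<in> invariants"
begin

lemma inv_garr: "det A = 1 \<Longrightarrow> det B = 1 \<Longrightarrow> det C = 1 \<Longrightarrow> peval (garr A B C x) f = peval x f"
  using f by (simp add: invariants_iff)

text \<open>The following elements of the three groups map the Cartan subspace to itself: diagonal matrices, cyclic
  permutations, a transposition (corrected by a sign to have determinant 1) and the Fourier matrix. They
  generate on it the complex reflection group of order 648 that belongs to the Hesse pencil.\<close>

lemma cartan_reflection: "peval (cartan (\<omega> * a) b c) f = peval (cartan a b c) f"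
proof -
  obtain z where z: "z ^ 3 = \<omega>" using complex_cube_root by blast
  define s where "s i = z * (if i = 1 then 1 else \<omega>)" for i :: 3
  have "det (diagm s) = z ^ 3 * \<omega> ^ 2" by (simp add: det_diagm s_def power2_eq_square power3_eq_cube)
  also have "\<dots> = \<omega> ^ 3" unfolding z by (simp add: power2_eq_square power3_eq_cube)
  also have "\<dots> = 1" by (rule \<omega>3)
  finally have det: "det (diagm s) = 1" .
  have sss: "s i * s j * s k = \<omega> * ((if i = 1 then 1 else \<omega>) * ((if j = 1 then 1 else \<omega>) * (if k = 1 then 1 else \<omega>)))" for i j k
  proof -
    have "z * p * (z * q) * (z * r) = z ^ 3 * (p * (q * r))" for p q r
      by (simp add: power3_eq_cube)
    then show ?thesis by (simp only: s_def z)
  qed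
  have \<omega>\<omega>\<omega>: "\<omega> * (\<omega> * \<omega>) = 1" using \<omega>3 by (simp add: power3_eq_cube mult.assoc)
  have "garr (diagm s) (diagm s) (diagm s) (cartan a b c) (i, j, k) = cartan (\<omega> * a) b c (i, j, k)" for i j k
    using exhaust_3[of i] exhaust_3[of j] exhaust_3[of k] unfolding garr_diagm sss
    by (elim disjE) (simp_all add: cartan_def \<omega>\<omega>\<omega>)
  then have "garr (diagm s) (diagm s) (diagm s) (cartan a b c) = cartan (\<omega> * a) b c" by auto
  then show ?thesis using inv_garr[OF det det det, of "cartan a b c"] by simp
qed

lemma cartan_cycle: "peval (cartan b c a) f = peval (cartan a b c) f"
proof -
  define P :: "complex^3^3" where "P = vector [vector [0, 0, 1], vector [1, 0, 0], vector [0, 1, 0]]"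
  define Q :: "complex^3^3" where "Q = vector [vector [0, 1, 0], vector [0, 0, 1], vector [1, 0, 0]]"
  define I :: "complex^3^3" where "I = diagm (\<lambda>_. 1)"
  have det: "det I = 1" "det P = 1" "det Q = 1"
    by (simp add: I_def det_diagm, simp_all add: P_def Q_def det_3)
  have P: "P $ 1 $ 1 = 0" "P $ 1 $ 2 = 0" "P $ 1 $ 3 = 1" "P $ 2 $ 1 = 1" "P $ 2 $ 2 = 0" "P $ 2 $ 3 = 0"
    "P $ 3 $ 1 = 0" "P $ 3 $ 2 = 1" "P $ 3 $ 3 = 0"
    by (simp_all add: P_def)
  have Q: "Q $ 1 $ 1 = 0" "Q $ 1 $ 2 = 1" "Q $ 1 $ 3 = 0" "Q $ 2 $ 1 = 0" "Q $ 2 $ 2 = 0" "Q $ 2 $ 3 = 1"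
    "Q $ 3 $ 1 = 1" "Q $ 3 $ 2 = 0" "Q $ 3 $ 3 = 0"
    by (simp_all add: Q_def)
  have I: "I $ 1 $ 1 = 1" "I $ 1 $ 2 = 0" "I $ 1 $ 3 = 0" "I $ 2 $ 1 = 0" "I $ 2 $ 2 = 1" "I $ 2 $ 3 = 0"
    "I $ 3 $ 1 = 0" "I $ 3 $ 2 = 0" "I $ 3 $ 3 = 1"
    by (simp_all add: I_def diagm_def)
  have "garr I P Q (cartan a b c) (i, j, k) = cartan b c a (i, j, k)" for i j k
    using exhaust_3[of i] exhaust_3[of j] exhaust_3[of k]
    apply (elim disjE)
    apply (simp_all only: garr_def sum_3 prod.case P Q I mult_1_left mult_zero_left mult_zero_right add_0_left add_0_right)
    apply (simp_all add: cartan_def)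
    done
  then have "garr I P Q (cartan a b c) = cartan b c a" by auto
  then show ?thesis using inv_garr[OF det, of "cartan a b c"] by simp
qed

lemma cartan_swap: "peval (cartan (- a) (- c) (- b)) f = peval (cartan a b c) f"
proof -
  define T :: "complex^3^3" where "T = vector [vector [-1, 0, 0], vector [0, 0, -1], vector [0, -1, 0]]"
  have det: "det T = 1" by (simp add: T_def det_3)
  have T: "T $ 1 $ 1 = -1" "T $ 1 $ 2 = 0" "T $ 1 $ 3 = 0" "T $ 2 $ 1 = 0" "T $ 2 $ 2 = 0" "T $ 2 $ 3 = -1"
    "T $ 3 $ 1 = 0" "T $ 3 $ 2 = -1" "T $ 3 $ 3 = 0"
    by (simp_all add: T_def)
  have "garr T T T (cartan a b c) (i, j, k) = cartan (- a) (- c) (- b) (i, j, k)" for i j k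
    using exhaust_3[of i] exhaust_3[of j] exhaust_3[of k]
    apply (elim disjE)
    apply (simp_all only: garr_def sum_3 prod.case T mult_1_left mult_zero_left mult_zero_right add_0_left add_0_right)
    apply (simp_all add: cartan_def)
    done
  then have "garr T T T (cartan a b c) = cartan (- a) (- c) (- b)" by auto
  then show ?thesis using inv_garr[OF det det det, of "cartan a b c"] by simp
qed

lemma cartan_fourier:
  "peval (cartan (\<kappa> * (a + b + c)) (\<kappa> * (a + \<omega> ^ 2 * b + \<omega> * c)) (\<kappa> * (a + \<omega> * b + \<omega> ^ 2 * c))) f =
    peval (cartan a b c) f"
proof -
  obtain z where z: "z ^ 3 = \<kappa> / 3" using complex_cube_root by blast
  define M :: "complex^3^3" where
    "M = vector [vector [1, 1, 1], vector [1, \<omega>, \<omega> ^ 2], vector [1, \<omega> ^ 2, \<omega>]]"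
  define F where "F = (\<chi> p i. z * M $ p $ i)"
  have "det F = z ^ 3 * det M"
    by (simp add: F_def det_3 power3_eq_cube algebra_simps)
  also have "det M = 3 * (\<omega> ^ 2 - \<omega>)"
    by (simp add: M_def det_3 \<omega>_square algebra_simps \<omega>_mult)
  also have "z ^ 3 * (3 * (\<omega> ^ 2 - \<omega>)) = 1"
  proof -
    have "\<omega> ^ 2 - \<omega> \<noteq> 0" using \<omega>_neq_1 \<omega>3 by (auto simp: power2_eq_square power3_eq_cube)
    then show ?thesis by (simp add: z \<kappa>_def)
  qed
  finally have det: "det F = 1" .
  have zzz: "z * (z * z) = \<kappa> / 3" "z * (z * (z * y)) = \<kappa> / 3 * y" for y
    using z by (simp_all add: power3_eq_cube mult.assoc)
  have "garr F F F (cartan a b c) t = z ^ 3 * garr M M M (cartan a b c) t" for t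
    unfolding garr_def sum_distrib_left case_prod_beta
    by (intro sum.cong refl) (simp add: F_def power3_eq_cube mult_ac)
  moreover have "garr M M M (cartan a b c) (i, j, k) =
      3 * cartan (a + b + c) (a + \<omega> ^ 2 * b + \<omega> * c) (a + \<omega> * b + \<omega> ^ 2 * c) (i, j, k)" for i j k
  proof -
    define v where "v = \<omega> ^ 2"
    have v: "\<omega> * \<omega> = v" "\<omega> * v = 1" "v * \<omega> = 1" "v * v = \<omega>"
      using \<omega>3 by (simp_all add: v_def power2_eq_square power3_eq_cube mult.assoc)
    have v': "v = - 1 - \<omega>" by (simp add: v_def \<omega>_square)
    have M: "M $ 1 $ 1 = 1" "M $ 1 $ 2 = 1" "M $ 1 $ 3 = 1" "M $ 2 $ 1 = 1" "M $ 2 $ 2 = \<omega>" "M $ 2 $ 3 = v"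
      "M $ 3 $ 1 = 1" "M $ 3 $ 2 = v" "M $ 3 $ 3 = \<omega>"
      by (simp_all add: M_def v_def)
    show ?thesis
      unfolding v_def[symmetric]
      using exhaust_3[of i] exhaust_3[of j] exhaust_3[of k]
      apply (elim disjE)
      apply (simp_all only: garr_def sum_3 prod.case M v mult_1_left mult_1_right)
      apply (simp_all add: cartan_def)
      apply (simp_all add: v' algebra_simps)
      done
  qed
  ultimately have "garr F F F (cartan a b c) =
     cartan (\<kappa> * (a + b + c)) (\<kappa> * (a + \<omega> ^ 2 * b + \<omega> * c)) (\<kappa> * (a + \<omega> * b + \<omega> ^ 2 * c))"
    by (auto simp: z cartan_def)
  then show ?thesis using inv_garr[OF det det det, of "cartan a b c"] by simp
qed

end

section \<open>Invariants of the little Weyl group\<close>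

type_synonym point = "complex \<times> complex \<times> complex"

definition tri :: "'a \<Rightarrow> 'a \<Rightarrow> 'a \<Rightarrow> 3 \<Rightarrow> 'a" where
  "tri a b c = (\<lambda>i. if i = 1 then a else if i = 2 then b else c)"

lemma tri_simps [simp]: "tri a b c 1 = a" "tri a b c 2 = b" "tri a b c 3 = c"
  by (simp_all add: tri_def)

text \<open>The diagonal reflections and the cyclic permutations leave the symmetric and the alternating polynomials in
  \<open>a ^ 3\<close>, \<open>b ^ 3\<close>, \<open>c ^ 3\<close>; the signed swap selects the symmetric ones of even and the alternating ones of
  odd degree in the cubes. Inside this ring the polynomials \<open>f6\<close>, \<open>f9\<close>, \<open>f12\<close> are the basic invariants of the
  reflection group of order 648 (degrees 6, 9, 12 with product 648).\<close>

definition e1 :: "point \<Rightarrow> complex" where "e1 = (\<lambda>(a, b, c). a ^ 3 + b ^ 3 + c ^ 3)"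
definition e2 :: "point \<Rightarrow> complex" where "e2 = (\<lambda>(a, b, c). a ^ 3 * b ^ 3 + b ^ 3 * c ^ 3 + c ^ 3 * a ^ 3)"
definition e3 :: "point \<Rightarrow> complex" where "e3 = (\<lambda>(a, b, c). a ^ 3 * b ^ 3 * c ^ 3)"

definition f6 :: "point \<Rightarrow> complex" where "f6 v = e1 v ^ 2 - 12 * e2 v"
definition f9 :: "point \<Rightarrow> complex" where "f9 = (\<lambda>(a, b, c). (a ^ 3 - b ^ 3) * (b ^ 3 - c ^ 3) * (c ^ 3 - a ^ 3))"
definition f12 :: "point \<Rightarrow> complex" where "f12 v = e1 v * (e1 v ^ 3 + 216 * e3 v)"

definition basic :: "(point \<Rightarrow> complex) set" where
  "basic = {h. \<exists>P. \<forall>v. h v = peval (tri (f6 v) (f9 v) (f12 v)) P}"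

lemma basic_const: "(\<lambda>v. k) \<in> basic"
  by (auto simp: basic_def intro!: exI[of _ "pconst k"])

lemma basic_add: "g \<in> basic \<Longrightarrow> h \<in> basic \<Longrightarrow> (\<lambda>v. g v + h v) \<in> basic"
  unfolding basic_def by clarify (metis peval_add)

lemma basic_mult: "g \<in> basic \<Longrightarrow> h \<in> basic \<Longrightarrow> (\<lambda>v. g v * h v) \<in> basic"
  unfolding basic_def by clarify (metis peval_mult)

lemma basic_diff: "g \<in> basic \<Longrightarrow> h \<in> basic \<Longrightarrow> (\<lambda>v. g v - h v) \<in> basic"
  unfolding basic_def by clarify (metis peval_diff)

lemma basic_power: "g \<in> basic \<Longrightarrow> (\<lambda>v. g v ^ n) \<in> basic"
  by (induction n) (auto intro: basic_const basic_mult)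

lemma basic_f: "f6 \<in> basic" "f9 \<in> basic" "f12 \<in> basic"
  unfolding basic_def by (force intro: exI[of _ "pvar 1"], force intro: exI[of _ "pvar 2"], force intro: exI[of _ "pvar 3"])

lemmas basic_intros = basic_const basic_add basic_mult basic_diff basic_power basic_f

lemma discriminant:
  "f9 v ^ 2 = e1 v ^ 2 * e2 v ^ 2 - 4 * e2 v ^ 3 - 4 * e1 v ^ 3 * e3 v + 18 * e1 v * e2 v * e3 v - 27 * e3 v ^ 2"
proof -
  have "((A - B) * (B - C) * (C - A)) ^ 2 =
    (A + B + C) ^ 2 * (A * B + B * C + C * A) ^ 2 - 4 * (A * B + B * C + C * A) ^ 3
    - 4 * (A + B + C) ^ 3 * (A * B * C) + 18 * (A + B + C) * (A * B + B * C + C * A) * (A * B * C)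
    - 27 * (A * B * C) ^ 2" for A B C :: complex
    by algebra
  from this[of "fst v ^ 3" "fst (snd v) ^ 3" "snd (snd v) ^ 3"] show ?thesis
    by (simp add: f9_def e1_def e2_def e3_def case_prod_beta)
qed

text \<open>By elimination of \<open>e1\<close> and \<open>e3\<close> from the definitions of \<open>f6\<close> and \<open>f12\<close> and the discriminant: \<open>e2\<close> is integral of
  degree 4 over the basic invariants. The degree is the index of the group generated by the
  reflection, the cycle and the swap in the full group, \<open>648 / 162\<close>.\<close>

lemma e2_quartic:
  "559872 * e2 v ^ 4 = - 186624 * f6 v * e2 v ^ 3 + (2592 * f12 v - 23328 * f6 v ^ 2) * e2 v ^ 2
     + (576 * f12 v * f6 v - 1344 * f6 v ^ 3 + 20736 * f9 v ^ 2) * e2 v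
     + (f12 v ^ 2 + 30 * f12 v * f6 v ^ 2 - 31 * f6 v ^ 4 + 1728 * f9 v ^ 2 * f6 v)"
proof -
  \<comment> \<open>With \<open>t = e1\<^sup>2\<close>, \<open>x = e2\<close>, \<open>y = e1 e3\<close>, \<open>z = e3\<^sup>2\<close> this is a consequence of \<open>y\<^sup>2 = t z\<close>.\<close>
  have "559872 * x ^ 4 - (- 186624 * (t - 12 * x) * x ^ 3 + (2592 * (t ^ 2 + 216 * y) - 23328 * (t - 12 * x) ^ 2) * x ^ 2
     + (576 * (t ^ 2 + 216 * y) * (t - 12 * x) - 1344 * (t - 12 * x) ^ 3
        + 20736 * (t * x ^ 2 - 4 * x ^ 3 - 4 * t * y + 18 * x * y - 27 * z)) * x
     + ((t ^ 2 + 216 * y) ^ 2 + 30 * (t ^ 2 + 216 * y) * (t - 12 * x) ^ 2 - 31 * (t - 12 * x) ^ 4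
        + 1728 * (t * x ^ 2 - 4 * x ^ 3 - 4 * t * y + 18 * x * y - 27 * z) * (t - 12 * x)))
     = 46656 * (t * z - y ^ 2)" for t x y z :: complex
    by algebra
  moreover have "f9 v ^ 2 = e1 v ^ 2 * e2 v ^ 2 - 4 * e2 v ^ 3 - 4 * e1 v ^ 2 * (e1 v * e3 v) + 18 * e2 v * (e1 v * e3 v) - 27 * e3 v ^ 2"
    unfolding discriminant by (simp add: power2_eq_square power3_eq_cube)
  moreover have "f12 v = (e1 v ^ 2) ^ 2 + 216 * (e1 v * e3 v)"
    by (simp add: f12_def algebra_simps power2_eq_square power3_eq_cube)
  ultimately have "559872 * e2 v ^ 4 - (- 186624 * f6 v * e2 v ^ 3 + (2592 * f12 v - 23328 * f6 v ^ 2) * e2 v ^ 2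
     + (576 * f12 v * f6 v - 1344 * f6 v ^ 3 + 20736 * f9 v ^ 2) * e2 v
     + (f12 v ^ 2 + 30 * f12 v * f6 v ^ 2 - 31 * f6 v ^ 4 + 1728 * f9 v ^ 2 * f6 v))
     = 46656 * (e1 v ^ 2 * e3 v ^ 2 - (e1 v * e3 v) ^ 2)"
    unfolding f6_def by (simp only:)
  then show ?thesis by (simp add: power_mult_distrib)
qed

text \<open>The module generated by \<open>1\<close>, \<open>e2\<close>, \<open>e2 ^ 2\<close>, \<open>e2 ^ 3\<close> over the basic invariants, which by the quartic equation is a
  ring.\<close>

definition cubics :: "(point \<Rightarrow> complex) set" where
  "cubics = {h. \<exists>p\<in>basic. \<exists>q\<in>basic. \<exists>r\<in>basic. \<exists>s\<in>basic.
     \<forall>v. h v = p v + q v * e2 v + r v * e2 v ^ 2 + s v * e2 v ^ 3}"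

lemma cubicsI:
  assumes "p \<in> basic" "q \<in> basic" "r \<in> basic" "s \<in> basic"
    "\<And>v. h v = p v + q v * e2 v + r v * e2 v ^ 2 + s v * e2 v ^ 3"
  shows "h \<in> cubics"
  unfolding cubics_def using assms by blast

lemma cubicsE:
  assumes "h \<in> cubics"
  obtains p q r s where "p \<in> basic" "q \<in> basic" "r \<in> basic" "s \<in> basic"
    "\<And>v. h v = p v + q v * e2 v + r v * e2 v ^ 2 + s v * e2 v ^ 3"
  using assms unfolding cubics_def by blast

lemma cubics_basic: "p \<in> basic \<Longrightarrow> p \<in> cubics"
  by (rule cubicsI[of p "\<lambda>v. 0" "\<lambda>v. 0" "\<lambda>v. 0"]) (auto intro: basic_const)

lemma cubics_e2: "e2 \<in> cubics"
  by (rule cubicsI[of "\<lambda>v. 0" "\<lambda>v. 1" "\<lambda>v. 0" "\<lambda>v. 0"]) (auto intro: basic_const)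

lemma cubics_add:
  assumes "g \<in> cubics" "h \<in> cubics"
  shows "(\<lambda>v. g v + h v) \<in> cubics"
proof -
  from assms(1) obtain p q r s where g: "p \<in> basic" "q \<in> basic" "r \<in> basic" "s \<in> basic"
    "\<And>v. g v = p v + q v * e2 v + r v * e2 v ^ 2 + s v * e2 v ^ 3" by (rule cubicsE) blast
  from assms(2) obtain p' q' r' s' where h: "p' \<in> basic" "q' \<in> basic" "r' \<in> basic" "s' \<in> basic"
    "\<And>v. h v = p' v + q' v * e2 v + r' v * e2 v ^ 2 + s' v * e2 v ^ 3" by (rule cubicsE) blast
  show ?thesis
    by (rule cubicsI[OF basic_add[OF g(1) h(1)] basic_add[OF g(2) h(2)] basic_add[OF g(3) h(3)] basic_add[OF g(4) h(4)]])
      (simp add: g(5) h(5) algebra_simps)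
qed

lemma cubics_basic_mult:
  assumes "k \<in> basic" "h \<in> cubics"
  shows "(\<lambda>v. k v * h v) \<in> cubics"
proof -
  from \<open>h \<in> cubics\<close> obtain p q r s where
    b: "p \<in> basic" "q \<in> basic" "r \<in> basic" "s \<in> basic"
    and eq: "\<And>v. h v = p v + q v * e2 v + r v * e2 v ^ 2 + s v * e2 v ^ 3"
    by (rule cubicsE) blast
  show ?thesis
    by (rule cubicsI[OF basic_mult[OF assms(1) b(1)] basic_mult[OF assms(1) b(2)]
          basic_mult[OF assms(1) b(3)] basic_mult[OF assms(1) b(4)]])
      (simp add: eq algebra_simps)
qed

lemma cubics_e2_mult:
  assumes "h \<in> cubics"
  shows "(\<lambda>v. e2 v * h v) \<in> cubics"
proof -
  from \<open>h \<in> cubics\<close> obtain p q r s where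
    b: "p \<in> basic" "q \<in> basic" "r \<in> basic" "s \<in> basic"
    and eq: "\<And>v. h v = p v + q v * e2 v + r v * e2 v ^ 2 + s v * e2 v ^ 3"
    by (rule cubicsE) blast
  define k0 where "k0 v = (1/559872) * (f12 v ^ 2 + 30 * f12 v * f6 v ^ 2 - 31 * f6 v ^ 4 + 1728 * f9 v ^ 2 * f6 v)" for v
  define k1 where "k1 v = (1/559872) * (576 * f12 v * f6 v - 1344 * f6 v ^ 3 + 20736 * f9 v ^ 2)" for v
  define k2 where "k2 v = (1/559872) * (2592 * f12 v - 23328 * f6 v ^ 2)" for v
  define k3 where "k3 v = (1/559872) * (- 186624 * f6 v)" for v
  have k: "k0 \<in> basic" "k1 \<in> basic" "k2 \<in> basic" "k3 \<in> basic"
    unfolding k0_def k1_def k2_def k3_def by (intro basic_intros)+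
  have quartic: "e2 v ^ 4 = k0 v + k1 v * e2 v + k2 v * e2 v ^ 2 + k3 v * e2 v ^ 3" for v
  proof -
    have "559872 * e2 v ^ 4 = 559872 * (k0 v + k1 v * e2 v + k2 v * e2 v ^ 2 + k3 v * e2 v ^ 3)"
      unfolding e2_quartic k0_def k1_def k2_def k3_def by (simp add: algebra_simps)
    then show ?thesis by (rule mult_left_cancel[THEN iffD1, rotated]) simp
  qed
  show ?thesis
  proof (rule cubicsI)
    show "(\<lambda>v. s v * k0 v) \<in> basic" "(\<lambda>v. p v + s v * k1 v) \<in> basic"
      "(\<lambda>v. q v + s v * k2 v) \<in> basic" "(\<lambda>v. r v + s v * k3 v) \<in> basic"
      by (intro basic_intros b k)+
    show "e2 v * h v = s v * k0 v + (p v + s v * k1 v) * e2 v + (q v + s v * k2 v) * e2 v ^ 2 + (r v + s v * k3 v) * e2 v ^ 3" for v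
    proof -
      have "e2 v * h v = p v * e2 v + q v * e2 v ^ 2 + r v * e2 v ^ 3 + s v * e2 v ^ 4"
        by (simp add: eq algebra_simps power2_eq_square power3_eq_cube power4_eq_xxxx)
      then show ?thesis unfolding quartic by (simp add: algebra_simps)
    qed
  qed
qed

lemma cubics_mult:
  assumes "g \<in> cubics" "h \<in> cubics"
  shows "(\<lambda>v. g v * h v) \<in> cubics"
proof -
  from \<open>g \<in> cubics\<close> obtain p q r s where
    b: "p \<in> basic" "q \<in> basic" "r \<in> basic" "s \<in> basic"
    and eq: "\<And>v. g v = p v + q v * e2 v + r v * e2 v ^ 2 + s v * e2 v ^ 3"
    by (rule cubicsE) blast
  note h = \<open>h \<in> cubics\<close>
  note h1 = cubics_e2_mult[OF h] and h2 = cubics_e2_mult[OF cubics_e2_mult[OF h]]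
    and h3 = cubics_e2_mult[OF cubics_e2_mult[OF cubics_e2_mult[OF h]]]
  have "(\<lambda>v. p v * h v + q v * (e2 v * h v) + r v * (e2 v * (e2 v * h v)) + s v * (e2 v * (e2 v * (e2 v * h v)))) \<in> cubics"
    by (intro cubics_add cubics_basic_mult b h h1 h2 h3)
  then show ?thesis by (simp add: eq algebra_simps power2_eq_square power3_eq_cube)
qed

lemma cubics_const: "(\<lambda>v. k) \<in> cubics"
  by (intro cubics_basic basic_const)

lemma cubics_diff: "g \<in> cubics \<Longrightarrow> h \<in> cubics \<Longrightarrow> (\<lambda>v. g v - h v) \<in> cubics"
  using cubics_add[of g "\<lambda>v. (- 1) * h v"] cubics_mult[of "\<lambda>v. - 1" h] cubics_const[of "-1"] by simp

lemma cubics_sum: "(\<And>i. i \<in> I \<Longrightarrow> g i \<in> cubics) \<Longrightarrow> (\<lambda>v. \<Sum>i\<in>I. g i v) \<in> cubics"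
  by (induction I rule: infinite_finite_induct) (auto intro: cubics_const cubics_add)

lemma cubics_power: "g \<in> cubics \<Longrightarrow> (\<lambda>v. g v ^ n) \<in> cubics"
  by (induction n) (auto intro: cubics_const cubics_mult)

lemma cubics_e1_e1: "(\<lambda>v. e1 v * e1 v) \<in> cubics"
proof -
  have "(\<lambda>v. f6 v + 12 * e2 v) \<in> cubics"
    by (intro cubics_add cubics_mult cubics_const cubics_basic[OF basic_f(1)] cubics_e2)
  then show ?thesis by (simp add: f6_def power2_eq_square)
qed

lemma cubics_e1_e3: "(\<lambda>v. e1 v * e3 v) \<in> cubics"
proof -
  have "(\<lambda>v. (1 / 216) * (f12 v - (e1 v * e1 v) * (e1 v * e1 v))) \<in> cubics"
    by (intro cubics_mult cubics_diff cubics_const cubics_basic[OF basic_f(3)] cubics_e1_e1)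
  moreover have "(1 / 216) * (f12 v - (e1 v * e1 v) * (e1 v * e1 v)) = e1 v * e3 v" for v
    by (simp add: f12_def field_simps power3_eq_cube)
  ultimately show ?thesis by simp
qed

lemma cubics_e3_e3: "(\<lambda>v. e3 v * e3 v) \<in> cubics"
proof -
  have "(\<lambda>v. (1 / 27) * ((e1 v * e1 v) * e2 v ^ 2 - 4 * e2 v ^ 3 - 4 * ((e1 v * e1 v) * (e1 v * e3 v))
      + 18 * (e2 v * (e1 v * e3 v)) - f9 v ^ 2)) \<in> cubics"
    by (intro cubics_mult cubics_add cubics_diff cubics_power cubics_const cubics_e1_e1 cubics_e1_e3
        cubics_e2 cubics_basic[OF basic_f(2)])
  moreover have "(1 / 27) * ((e1 v * e1 v) * e2 v ^ 2 - 4 * e2 v ^ 3 - 4 * ((e1 v * e1 v) * (e1 v * e3 v))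
      + 18 * (e2 v * (e1 v * e3 v)) - f9 v ^ 2) = e3 v * e3 v" for v
    unfolding discriminant by (simp add: field_simps power2_eq_square power3_eq_cube)
  ultimately show ?thesis by simp
qed

text \<open>For \<open>d = False\<close> functions fixed by the signed swap, for \<open>d = True\<close> functions that it multiplies by \<open>-1\<close>, such
  as \<open>e1\<close> and \<open>e3\<close>. Since \<open>e1 ^ 2\<close>, \<open>e1 * e3\<close> and \<open>e3 ^ 2\<close> lie in \<open>cubics\<close>, one factor \<open>e1\<close> or \<open>e3\<close> is enough.\<close>

definition graded :: "bool \<Rightarrow> (point \<Rightarrow> complex) set" where
  "graded d = (if d then {h. \<exists>p\<in>cubics. \<exists>q\<in>cubics. \<forall>v. h v = e1 v * p v + e3 v * q v} else cubics)"

lemma graded_oddI: "p \<in> cubics \<Longrightarrow> q \<in> cubics \<Longrightarrow> (\<And>v. h v = e1 v * p v + e3 v * q v) \<Longrightarrow> h \<in> graded True"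
  unfolding graded_def by auto

lemma graded_oddE:
  assumes "h \<in> graded True"
  obtains p q where "p \<in> cubics" "q \<in> cubics" "\<And>v. h v = e1 v * p v + e3 v * q v"
  using assms unfolding graded_def if_True by blast

lemma graded_add:
  assumes "g \<in> graded d" "h \<in> graded d"
  shows "(\<lambda>v. g v + h v) \<in> graded d"
proof (cases d)
  case True
  then have gh: "g \<in> graded True" "h \<in> graded True" using assms by simp_all
  obtain p q where g: "p \<in> cubics" "q \<in> cubics" "\<And>v. g v = e1 v * p v + e3 v * q v"
    by (rule graded_oddE[OF gh(1)]) blast
  obtain p' q' where h: "p' \<in> cubics" "q' \<in> cubics" "\<And>v. h v = e1 v * p' v + e3 v * q' v"
    by (rule graded_oddE[OF gh(2)]) blast
  have "(\<lambda>v. g v + h v) \<in> graded True"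
    by (rule graded_oddI[OF cubics_add[OF g(1) h(1)] cubics_add[OF g(2) h(2)]])
      (simp add: g(3) h(3) algebra_simps)
  then show ?thesis using True by simp
qed (use assms in \<open>simp add: graded_def cubics_add\<close>)

lemma graded_mult:
  assumes "g \<in> cubics" "h \<in> graded d"
  shows "(\<lambda>v. g v * h v) \<in> graded d"
proof (cases d)
  case True
  then have h': "h \<in> graded True" using assms by simp
  obtain p q where h: "p \<in> cubics" "q \<in> cubics" "\<And>v. h v = e1 v * p v + e3 v * q v"
    by (rule graded_oddE[OF h']) blast
  have "(\<lambda>v. g v * h v) \<in> graded True"
    by (rule graded_oddI[OF cubics_mult[OF assms(1) h(1)] cubics_mult[OF assms(1) h(2)]])
      (simp add: h(3) algebra_simps)
  then show ?thesis using True by simp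
qed (use assms in \<open>simp add: graded_def cubics_mult\<close>)

lemma graded_e13:
  assumes "h \<in> graded d"
  shows "(\<lambda>v. e1 v * h v) \<in> graded (\<not> d)" "(\<lambda>v. e3 v * h v) \<in> graded (\<not> d)"
proof -
  have "(\<lambda>v. e1 v * h v) \<in> graded (\<not> d) \<and> (\<lambda>v. e3 v * h v) \<in> graded (\<not> d)"
  proof (cases d)
    case True
    then have h': "h \<in> graded True" using assms by simp
    obtain p q where h: "p \<in> cubics" "q \<in> cubics" "\<And>v. h v = e1 v * p v + e3 v * q v"
      by (rule graded_oddE[OF h']) blast
    have "(\<lambda>v. (e1 v * e1 v) * p v + (e1 v * e3 v) * q v) \<in> cubics"
      "(\<lambda>v. (e1 v * e3 v) * p v + (e3 v * e3 v) * q v) \<in> cubics"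
      by (intro cubics_add cubics_mult cubics_e1_e1 cubics_e1_e3 cubics_e3_e3 h)+
    moreover have "e1 v * h v = (e1 v * e1 v) * p v + (e1 v * e3 v) * q v"
      "e3 v * h v = (e1 v * e3 v) * p v + (e3 v * e3 v) * q v" for v
      by (simp_all add: h(3) algebra_simps)
    ultimately show ?thesis using True by (simp add: graded_def)
  next
    case False
    then have h: "h \<in> cubics" using assms by (simp add: graded_def)
    show ?thesis
      using False graded_oddI[OF h cubics_const[of 0]] graded_oddI[OF cubics_const[of 0] h] by simp
  qed
  then show "(\<lambda>v. e1 v * h v) \<in> graded (\<not> d)" "(\<lambda>v. e3 v * h v) \<in> graded (\<not> d)" by auto
qed

text \<open>The symmetrised (\<open>\<epsilon> = 1\<close>) and the antisymmetrised (\<open>\<epsilon> = -1\<close>) monomial in the cubes.\<close>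

definition mono_sum :: "complex \<Rightarrow> nat \<Rightarrow> nat \<Rightarrow> nat \<Rightarrow> point \<Rightarrow> complex" where
  "mono_sum \<epsilon> i j k = (\<lambda>(a, b, c). let T = (\<lambda>x y z. (x ^ 3) ^ i * (y ^ 3) ^ j * (z ^ 3) ^ k) in
     T a b c + T b c a + T c a b + \<epsilon> * (T a c b + T c b a + T b a c))"

lemma mono_sum_cycle: "mono_sum \<epsilon> j k i = mono_sum \<epsilon> i j k"
  by (auto simp: mono_sum_def Let_def fun_eq_iff algebra_simps)

lemma mono_sum_swap:
  assumes "\<epsilon> * \<epsilon> = 1"
  shows "mono_sum \<epsilon> i k j v = \<epsilon> * mono_sum \<epsilon> i j k v"
proof -
  obtain a b c where v: "v = (a, b, c)" by (cases v)
  define T where "T x y z = (x ^ 3) ^ i * (y ^ 3) ^ j * (z ^ 3) ^ k" for x y z :: complex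
  define X where "X = T a b c + T b c a + T c a b"
  define Y where "Y = T a c b + T c b a + T b a c"
  have "mono_sum \<epsilon> i j k v = X + \<epsilon> * Y"
    by (simp add: mono_sum_def v T_def Let_def X_def Y_def)
  moreover have "mono_sum \<epsilon> i k j v = Y + \<epsilon> * X"
    by (simp add: mono_sum_def v T_def Let_def X_def Y_def algebra_simps)
  ultimately show ?thesis
    using assms by (simp add: distrib_left flip: mult.assoc)
qed

text \<open>Each of the three cubes is a root of \<open>X ^ 3 - e1 * X ^ 2 + e2 * X - e3\<close>.\<close>

lemma mono_sum_rec:
  "mono_sum \<epsilon> (i + 3) j k v = e1 v * mono_sum \<epsilon> (i + 2) j k v + (- e2 v) * mono_sum \<epsilon> (i + 1) j k v + e3 v * mono_sum \<epsilon> i j k v"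
proof -
  obtain a b c where v: "v = (a, b, c)" by (cases v)
  have rec: "x ^ (i + 3) = (A + B + C) * x ^ (i + 2) - (A * B + B * C + C * A) * x ^ (i + 1) + A * B * C * x ^ i"
    if "x = A \<or> x = B \<or> x = C" for x A B C :: complex
  proof -
    have "x ^ 3 = (A + B + C) * x ^ 2 - (A * B + B * C + C * A) * x + A * B * C"
      using that by (auto simp: algebra_simps power2_eq_square power3_eq_cube)
    then have "x ^ i * x ^ 3 = x ^ i * ((A + B + C) * x ^ 2 - (A * B + B * C + C * A) * x + A * B * C)" by simp
    moreover have "x ^ (i + 3) = x ^ i * x ^ 3" "x ^ (i + 2) = x ^ i * x ^ 2" "x ^ (i + 1) = x ^ i * x"
      by (simp_all only: power_add power_one_right)
    ultimately show ?thesis by (simp only:) (simp add: algebra_simps)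
  qed
  have "(a ^ 3) ^ (i + 3) = e1 v * (a ^ 3) ^ (i + 2) - e2 v * (a ^ 3) ^ (i + 1) + e3 v * (a ^ 3) ^ i"
    "(b ^ 3) ^ (i + 3) = e1 v * (b ^ 3) ^ (i + 2) - e2 v * (b ^ 3) ^ (i + 1) + e3 v * (b ^ 3) ^ i"
    "(c ^ 3) ^ (i + 3) = e1 v * (c ^ 3) ^ (i + 2) - e2 v * (c ^ 3) ^ (i + 1) + e3 v * (c ^ 3) ^ i"
    by (simp_all only: e1_def e2_def e3_def v prod.case, (rule rec; simp)+)
  then show ?thesis
    unfolding mono_sum_def v prod.case Let_def by (simp only:) (simp add: algebra_simps)
qed

lemma mono_sum_base:
  "mono_sum 1 0 0 0 v = 6" "mono_sum 1 0 0 1 v = 2 * e1 v" "mono_sum 1 0 0 2 v = 2 * (e1 v * e1 v) - 4 * e2 v"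
  "mono_sum 1 0 1 1 v = 2 * e2 v" "mono_sum 1 0 1 2 v = e1 v * e2 v - 3 * e3 v"
  "mono_sum 1 0 2 2 v = 2 * e2 v ^ 2 - 4 * (e1 v * e3 v)" "mono_sum 1 1 1 1 v = 6 * e3 v"
  "mono_sum 1 1 1 2 v = 2 * (e1 v * e3 v)" "mono_sum 1 1 2 2 v = 2 * (e3 v * e2 v)"
  "mono_sum 1 2 2 2 v = 6 * (e3 v * e3 v)"
proof -
  obtain a b c where v: "v = (a, b, c)" by (cases v)
  define A B C where "A = a ^ 3" and "B = b ^ 3" and "C = c ^ 3"
  show "mono_sum 1 0 0 0 v = 6" "mono_sum 1 0 0 1 v = 2 * e1 v" "mono_sum 1 0 0 2 v = 2 * (e1 v * e1 v) - 4 * e2 v"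
     "mono_sum 1 0 1 1 v = 2 * e2 v" "mono_sum 1 0 1 2 v = e1 v * e2 v - 3 * e3 v"
     "mono_sum 1 0 2 2 v = 2 * e2 v ^ 2 - 4 * (e1 v * e3 v)" "mono_sum 1 1 1 1 v = 6 * e3 v"
     "mono_sum 1 1 1 2 v = 2 * (e1 v * e3 v)" "mono_sum 1 1 2 2 v = 2 * (e3 v * e2 v)"
     "mono_sum 1 2 2 2 v = 6 * (e3 v * e3 v)"
    by (simp_all only: v mono_sum_def Let_def e1_def e2_def e3_def prod.case flip: A_def B_def C_def)
      (simp_all add: algebra_simps power2_eq_square)
qed

lemma mono_sum_alt_base:
  "mono_sum (-1) i j j v = 0" "mono_sum (-1) 0 1 2 v = f9 v"
proof -
  obtain a b c where v: "v = (a, b, c)" by (cases v)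
  define A B C where "A = a ^ 3" and "B = b ^ 3" and "C = c ^ 3"
  show "mono_sum (-1) i j j v = 0" "mono_sum (-1) 0 1 2 v = f9 v"
    by (simp_all only: v mono_sum_def Let_def f9_def prod.case flip: A_def B_def C_def)
      (simp_all add: algebra_simps power2_eq_square)
qed

definition sgraded :: "bool \<Rightarrow> bool \<Rightarrow> (point \<Rightarrow> complex) set" where
  "sgraded s d = {h. \<exists>g\<in>graded d. \<forall>v. h v = (if s then f9 v else 1) * g v}"

lemma sgradedI: "g \<in> graded d \<Longrightarrow> (\<And>v. h v = (if s then f9 v else 1) * g v) \<Longrightarrow> h \<in> sgraded s d"
  unfolding sgraded_def by blast

lemma sgraded_add:
  assumes "g \<in> sgraded s d" "h \<in> sgraded s d" shows "(\<lambda>v. g v + h v) \<in> sgraded s d"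
proof -
  from assms obtain g' h' where *: "g' \<in> graded d" "h' \<in> graded d"
    "\<And>v. g v = (if s then f9 v else 1) * g' v" "\<And>v. h v = (if s then f9 v else 1) * h' v"
    unfolding sgraded_def by blast
  show ?thesis by (rule sgradedI[OF graded_add[OF *(1,2)]]) (simp add: * distrib_left)
qed

lemma sgraded_mult:
  assumes "g \<in> cubics" "h \<in> sgraded s d" shows "(\<lambda>v. g v * h v) \<in> sgraded s d"
proof -
  from assms obtain h' where *: "h' \<in> graded d" "\<And>v. h v = (if s then f9 v else 1) * h' v"
    unfolding sgraded_def by blast
  show ?thesis by (rule sgradedI[OF graded_mult[OF assms(1) *(1)]]) (simp add: *)
qed

lemma sgraded_e13:
  assumes "h \<in> sgraded s d"
  shows "(\<lambda>v. e1 v * h v) \<in> sgraded s (\<not> d)" "(\<lambda>v. e3 v * h v) \<in> sgraded s (\<not> d)"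
proof -
  from assms obtain h' where *: "h' \<in> graded d" "\<And>v. h v = (if s then f9 v else 1) * h' v"
    unfolding sgraded_def by blast
  show "(\<lambda>v. e1 v * h v) \<in> sgraded s (\<not> d)" by (rule sgradedI[OF graded_e13(1)[OF *(1)]]) (simp add: *)
  show "(\<lambda>v. e3 v * h v) \<in> sgraded s (\<not> d)" by (rule sgradedI[OF graded_e13(2)[OF *(1)]]) (simp add: *)
qed

lemma sgraded_0: "(\<lambda>v. 0) \<in> sgraded s d"
proof (rule sgradedI[of "\<lambda>v. 0"])
  show "(\<lambda>v. 0) \<in> graded d"
    by (cases d) (use graded_oddI[OF cubics_const[of 0] cubics_const[of 0]] in \<open>auto simp: graded_def cubics_const\<close>)
qed simp

definition sum_ok :: "bool \<Rightarrow> nat \<Rightarrow> nat \<Rightarrow> nat \<Rightarrow> bool" where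
  "sum_ok s i j k \<longleftrightarrow> mono_sum (if s then - 1 else 1) i j k \<in> sgraded s (odd (i + j + k) \<noteq> s)"

lemma sum_ok_cycle: "sum_ok s j k i \<longleftrightarrow> sum_ok s i j k"
  by (simp add: sum_ok_def mono_sum_cycle add_ac)

lemma sum_ok_swap: "sum_ok s i j k \<Longrightarrow> sum_ok s i k j"
proof -
  let ?\<epsilon> = "if s then - 1 else 1 :: complex"
  assume "sum_ok s i j k"
  then have "(\<lambda>v. ?\<epsilon> * mono_sum ?\<epsilon> i j k v) \<in> sgraded s (odd (i + j + k) \<noteq> s)"
    unfolding sum_ok_def by (intro sgraded_mult cubics_const)
  moreover have "mono_sum ?\<epsilon> i k j = (\<lambda>v. ?\<epsilon> * mono_sum ?\<epsilon> i j k v)"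
    by (intro ext mono_sum_swap) auto
  moreover have "i + k + j = i + j + k" by simp
  ultimately show ?thesis unfolding sum_ok_def by (simp only:)
qed

lemma sum_ok_base_False:
  assumes "i \<le> j" "j \<le> k" "k < 3"
  shows "sum_ok False i j k"
proof -
  have ev: "sum_ok False i j k" if "even (i + j + k)" "h \<in> cubics" "\<And>v. mono_sum 1 i j k v = h v" for h i j k
  proof -
    have "mono_sum 1 i j k \<in> sgraded False False"
      by (rule sgradedI[of h]) (simp_all add: that graded_def)
    then show ?thesis using that(1) by (simp add: sum_ok_def)
  qed
  have od: "sum_ok False i j k" if "odd (i + j + k)" "p \<in> cubics" "q \<in> cubics" "\<And>v. mono_sum 1 i j k v = e1 v * p v + e3 v * q v" for p q i j k
  proof -
    have "mono_sum 1 i j k \<in> sgraded False True"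
      by (rule sgradedI[OF graded_oddI[OF that(2,3,4)]]) simp
    then show ?thesis using that(1) by (simp add: sum_ok_def)
  qed
  note ci = cubics_diff cubics_mult cubics_const cubics_e2 cubics_e1_e1 cubics_e1_e3 cubics_e3_e3 cubics_power
  have "(i, j, k) \<in> {(0,0,0),(0,0,1),(0,0,2),(0,1,1),(0,1,2),(0,2,2),(1,1,1),(1,1,2),(1,2,2),(2,2,2)}"
  proof -
    have "i = 0 \<or> i = 1 \<or> i = 2" "j = 0 \<or> j = 1 \<or> j = 2" "k = 0 \<or> k = 1 \<or> k = 2"
      using assms by linarith+
    then show ?thesis using assms(1,2) by (elim disjE) simp_all
  qed
  moreover have "sum_ok False 0 0 0" by (rule ev[OF _ _ mono_sum_base(1)]) (intro ci | simp)+
  moreover have "sum_ok False 0 0 1" by (rule od[of _ _ _ "\<lambda>v. 2" "\<lambda>v. 0"]) (intro ci | simp add: mono_sum_base[simplified])+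
  moreover have "sum_ok False 0 0 2" by (rule ev[OF _ _ mono_sum_base(3)]) (intro ci | simp)+
  moreover have "sum_ok False 0 1 1" by (rule ev[OF _ _ mono_sum_base(4)]) (intro ci | simp)+
  moreover have "sum_ok False 0 1 2" by (rule od[of _ _ _ "e2" "\<lambda>v. - 3"]) (intro ci | simp add: mono_sum_base[simplified])+
  moreover have "sum_ok False 0 2 2" by (rule ev[OF _ _ mono_sum_base(6)]) (intro ci | simp)+
  moreover have "sum_ok False 1 1 1" by (rule od[of _ _ _ "\<lambda>v. 0" "\<lambda>v. 6"]) (intro ci | simp add: mono_sum_base[simplified])+
  moreover have "sum_ok False 1 1 2" by (rule ev[OF _ _ mono_sum_base(8)]) (intro ci | simp)+
  moreover have "sum_ok False 1 2 2" by (rule od[of _ _ _ "\<lambda>v. 0" "\<lambda>v. 2 * e2 v"]) (intro ci | simp add: mono_sum_base[simplified])+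
  moreover have "sum_ok False 2 2 2" by (rule ev[OF _ _ mono_sum_base(10)]) (intro ci | simp)+
  ultimately show ?thesis by auto
qed

lemma sum_ok_base_True:
  assumes "i \<le> j" "j \<le> k" "k < 3"
  shows "sum_ok True i j k"
proof -
  have eq: "sum_ok True i j j" for i j
  proof -
    have "mono_sum (- 1) i j j = (\<lambda>v. 0)" by (simp add: mono_sum_alt_base fun_eq_iff)
    then show ?thesis unfolding sum_ok_def by (simp add: sgraded_0)
  qed
  have "i = j \<or> j = k \<or> (i, j, k) = (0, 1, 2)" using assms by auto
  moreover have "sum_ok True 0 1 2"
    unfolding sum_ok_def
    by (rule sgradedI[of "\<lambda>v. 1"])
      (simp add: graded_def cubics_const, simp only: mono_sum_alt_base if_True mult_1_right)
  moreover have "sum_ok True j j k" using eq[of k j] sum_ok_cycle[of True j j k] sum_ok_cycle[of True k j j] by blast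
  ultimately show ?thesis using eq by blast
qed

lemma sum_ok_small:
  assumes "i < 3" "j < 3" "k < 3"
  shows "sum_ok s i j k"
proof -
  have base: "sum_ok s i j k" if "i \<le> j" "j \<le> k" "k < 3" for i j k
    using that sum_ok_base_False sum_ok_base_True by (cases s) auto
  consider "i \<le> j" "j \<le> k" | "i \<le> k" "k \<le> j" | "j \<le> i" "i \<le> k" | "j \<le> k" "k \<le> i" | "k \<le> i" "i \<le> j" | "k \<le> j" "j \<le> i"
    by linarith
  then show ?thesis
    using assms base sum_ok_cycle sum_ok_swap by cases metis+
qed

lemma sum_ok_step:
  assumes "\<And>i. i < 3 \<Longrightarrow> sum_ok s i j k"
  shows "sum_ok s i j k"
proof (induction i rule: less_induct)
  case (less i)
  show ?case
  proof (cases "i < 3")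
    case False
    then obtain m where m: "i = m + 3" by (metis add.commute le_Suc_ex not_less)
    let ?\<epsilon> = "if s then - 1 else 1 :: complex"
    have IH: "mono_sum ?\<epsilon> m j k \<in> sgraded s (odd (m + j + k) \<noteq> s)"
      "mono_sum ?\<epsilon> (m + 1) j k \<in> sgraded s (odd (m + 1 + j + k) \<noteq> s)"
      "mono_sum ?\<epsilon> (m + 2) j k \<in> sgraded s (odd (m + 2 + j + k) \<noteq> s)"
      using less[of m] less[of "m + 1"] less[of "m + 2"] unfolding m sum_ok_def by auto
    have par: "(\<not> (odd (m + j + k) \<noteq> s)) = (odd (m + 3 + j + k) \<noteq> s)"
      "(odd (m + 1 + j + k) \<noteq> s) = (odd (m + 3 + j + k) \<noteq> s)"
      "(\<not> (odd (m + 2 + j + k) \<noteq> s)) = (odd (m + 3 + j + k) \<noteq> s)"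
      by auto
    have "(\<lambda>v. - 1 * e2 v) \<in> cubics" by (intro cubics_mult cubics_const cubics_e2)
    then have neg: "(\<lambda>v. - e2 v) \<in> cubics" by simp
    have A: "(\<lambda>v. e1 v * mono_sum ?\<epsilon> (m + 2) j k v) \<in> sgraded s (odd (m + 3 + j + k) \<noteq> s)"
      using sgraded_e13(1)[OF IH(3)] by (simp only: par)
    have B: "(\<lambda>v. (- e2 v) * mono_sum ?\<epsilon> (m + 1) j k v) \<in> sgraded s (odd (m + 3 + j + k) \<noteq> s)"
      using sgraded_mult[OF neg IH(2)] by (simp only: par)
    have C: "(\<lambda>v. e3 v * mono_sum ?\<epsilon> m j k v) \<in> sgraded s (odd (m + 3 + j + k) \<noteq> s)"
      using sgraded_e13(2)[OF IH(1)] by (simp only: par)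
    have "mono_sum ?\<epsilon> (m + 3) j k = (\<lambda>v. e1 v * mono_sum ?\<epsilon> (m + 2) j k v
        + (- e2 v) * mono_sum ?\<epsilon> (m + 1) j k v + e3 v * mono_sum ?\<epsilon> m j k v)"
      by (rule ext) (rule mono_sum_rec)
    then show ?thesis using sgraded_add[OF sgraded_add[OF A B] C] unfolding sum_ok_def m by (simp only:)
  qed (rule assms)
qed

text \<open>The recursion lowers one exponent below 3 at a time, and the cyclic symmetry makes all exponents accessible
  to it.\<close>

lemma sum_ok: "sum_ok s i j k"
proof -
  have 1: "sum_ok s i j k" if "j < 3" "k < 3" for i j k
    by (rule sum_ok_step) (rule sum_ok_small[OF _ that])
  have 2: "sum_ok s i j k" if "k < 3" for i j k
  proof -
    have "sum_ok s j k i" by (rule sum_ok_step) (metis 1 sum_ok_cycle that)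
    then show ?thesis by (metis sum_ok_cycle)
  qed
  have "sum_ok s k i j" by (rule sum_ok_step) (metis 2 sum_ok_cycle)
  then show ?thesis by (metis sum_ok_cycle)
qed

text \<open>An alternating sum is the Vandermonde product \<open>f9\<close>, of degree 3 in the cubes, times a symmetric
  factor; if its degree is odd, the degree of the factor is even.\<close>

lemma mono_sum_cubics: "mono_sum ((- 1) ^ (i + j + k)) i j k \<in> cubics"
proof (cases "even (i + j + k)")
  case True
  then obtain g where g: "g \<in> cubics" "\<And>v. mono_sum 1 i j k v = g v"
    using sum_ok[of False i j k] by (auto simp: sum_ok_def sgraded_def graded_def)
  then have "mono_sum 1 i j k = g" by (simp add: fun_eq_iff)
  then show ?thesis using g(1) True by simp
next
  case False
  then obtain g where g: "g \<in> cubics" "\<And>v. mono_sum (- 1) i j k v = f9 v * g v"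
    using sum_ok[of True i j k] by (auto simp: sum_ok_def sgraded_def graded_def)
  have "(\<lambda>v. f9 v * g v) \<in> cubics" by (intro cubics_mult g cubics_basic basic_f)
  moreover have "mono_sum (- 1) i j k = (\<lambda>v. f9 v * g v)" by (rule ext) (rule g(2))
  ultimately show ?thesis using False by simp
qed

lemma poly3_scaled_lookup:
  fixes R :: "3 cpoly"
  assumes "\<And>x. peval (\<lambda>v. z v * x v) R = peval x R"
  shows "Poly_Mapping.lookup R m * monom_val z (Poly_Mapping.lookup m) = Poly_Mapping.lookup R m"
proof -
  define S where "S = (\<Sum>m\<in>Poly_Mapping.keys R.
    Poly_Mapping.single m (Poly_Mapping.lookup R m * monom_val z (Poly_Mapping.lookup m)))"
  have "monom_val (\<lambda>v. z v * x v) e = monom_val z e * monom_val x e" for x e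
    by (simp add: monom_val_def power_mult_distrib prod.distrib)
  then have "peval x S = peval (\<lambda>v. z v * x v) R" for x
    by (simp add: S_def peval_sum peval_single peval_def[of _ R] mult.assoc)
  then have "S = R" using assms by (intro poly_eqI_peval) simp
  then have "Poly_Mapping.lookup R m = Poly_Mapping.lookup S m" by simp
  also have "\<dots> = Poly_Mapping.lookup R m * monom_val z (Poly_Mapping.lookup m)"
    by (simp add: S_def lookup_sum lookup_single when_def in_keys_iff)
  finally show ?thesis by simp
qed

lemma \<omega>_power_eq_1: "\<omega> ^ n = 1 \<longleftrightarrow> 3 dvd n"
proof -
  have "\<omega> ^ n = (\<omega> ^ 3) ^ (n div 3) * \<omega> ^ (n mod 3)"
    by (simp only: power_mult[symmetric] power_add[symmetric] mult_div_mod_eq)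
  then have *: "\<omega> ^ n = \<omega> ^ (n mod 3)" by (simp add: \<omega>3)
  have "\<omega> ^ 2 \<noteq> 1"
  proof
    assume "\<omega> ^ 2 = 1"
    then have "\<omega> = \<omega> ^ 3" by (simp add: power2_eq_square power3_eq_cube)
    then show False using \<omega>3 \<omega>_neq_1 by simp
  qed
  moreover have "n mod 3 = 0 \<or> n mod 3 = 1 \<or> n mod 3 = 2" by linarith
  ultimately show ?thesis using \<omega>_neq_1 by (auto simp: * dvd_eq_mod_eq_0)
qed

definition fourier :: "point \<Rightarrow> point" where
  "fourier = (\<lambda>(a, b, c). (\<kappa> * (a + b + c), \<kappa> * (a + \<omega> ^ 2 * b + \<omega> * c), \<kappa> * (a + \<omega> * b + \<omega> ^ 2 * c)))"

definition rot :: "point \<Rightarrow> point" where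
  "rot = (\<lambda>(a, b, c). (\<omega> * a, b, c))"

text \<open>With \<open>p = a ^ 3 + b ^ 3 + c ^ 3\<close> and \<open>m = a * b * c\<close>, the product \<open>(a + b + c) (a + \<omega> ^ 2 * b + \<omega> * c) (a + \<omega> * b + \<omega> ^ 2 * c)\<close>
  equals \<open>p - 3 * m\<close>.\<close>

lemma e_fourier:
  "e1 (fourier (a, b, c)) = - \<kappa> * (e1 (a, b, c) + 6 * (a * b * c))"
  "e3 (fourier (a, b, c)) = \<kappa> / 81 * (e1 (a, b, c) - 3 * (a * b * c)) ^ 3"
  "e2 (fourier (a, b, c)) = - (1 / 27) * (27 * (a ^ 2 - b * c) ^ 3
     - 27 * a * (a ^ 2 - b * c) * (e1 (a, b, c) - 3 * (a * b * c)) + 3 * (e1 (a, b, c) - 3 * (a * b * c)) ^ 2)"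
proof -
  define x y z where "x = a + b + c" and "y = a + \<omega> ^ 2 * b + \<omega> * c" and "z = a + \<omega> * b + \<omega> ^ 2 * c"
  define p q r where "p = x + y + z" and "q = x * y + y * z + z * x" and "r = x * y * z"
  have p: "p = 3 * a" unfolding p_def x_def y_def z_def \<omega>_square by algebra
  have q: "q = 3 * (a ^ 2 - b * c)"
    using \<omega>_square unfolding q_def x_def y_def z_def by algebra
  have r: "r = e1 (a, b, c) - 3 * (a * b * c)"
    using \<omega>_square unfolding r_def x_def y_def z_def e1_def prod.case by algebra
  have k3: "\<kappa> ^ 3 = - \<kappa> / 3"
    using \<kappa>_square by (simp add: power2_eq_square power3_eq_cube)
  have k6: "\<kappa> ^ 3 * \<kappa> ^ 3 = - 1 / 27"
    unfolding k3 using \<kappa>_square by (simp add: power2_eq_square)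
  have "e1 (fourier (a, b, c)) = \<kappa> ^ 3 * (x ^ 3 + y ^ 3 + z ^ 3)"
    unfolding fourier_def e1_def x_def y_def z_def prod.case power_mult_distrib
    by (simp only: distrib_left)
  also have "x ^ 3 + y ^ 3 + z ^ 3 = p ^ 3 - 3 * p * q + 3 * r"
    unfolding p_def q_def r_def by algebra
  also have "\<dots> = 3 * (e1 (a, b, c) + 6 * (a * b * c))"
    unfolding p q r by algebra
  finally show "e1 (fourier (a, b, c)) = - \<kappa> * (e1 (a, b, c) + 6 * (a * b * c))"
    unfolding k3 by simp
  have "e3 (fourier (a, b, c)) = (\<kappa> ^ 3 * \<kappa> ^ 3) * \<kappa> ^ 3 * r ^ 3"
    by (simp add: fourier_def e3_def x_def y_def z_def r_def power_mult_distrib mult_ac)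
  then show "e3 (fourier (a, b, c)) = \<kappa> / 81 * (e1 (a, b, c) - 3 * (a * b * c)) ^ 3"
    unfolding k6 unfolding k3 r by simp
  have "e2 (fourier (a, b, c)) = (\<kappa> ^ 3 * \<kappa> ^ 3) * ((x * y) ^ 3 + (y * z) ^ 3 + (z * x) ^ 3)"
    unfolding fourier_def e2_def x_def y_def z_def prod.case power_mult_distrib
    by (simp only: distrib_left mult_ac)
  also have "(x * y) ^ 3 + (y * z) ^ 3 + (z * x) ^ 3 = q ^ 3 - 3 * p * q * r + 3 * r ^ 2"
    unfolding p_def q_def r_def by algebra
  finally have fin: "e2 (fourier (a, b, c)) = (\<kappa> ^ 3 * \<kappa> ^ 3) * (q ^ 3 - 3 * p * q * r + 3 * r ^ 2)" .
  have "- 1 / 27 * ((3 * u) ^ 3 - 3 * (3 * t) * (3 * u) * w + 3 * w ^ 2) = - (1 / 27) * (27 * u ^ 3 - 27 * t * u * w + 3 * w ^ 2)"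
    for t u w :: complex
    by (simp add: power_mult_distrib)
  then show "e2 (fourier (a, b, c)) = - (1 / 27) * (27 * (a ^ 2 - b * c) ^ 3
     - 27 * a * (a ^ 2 - b * c) * (e1 (a, b, c) - 3 * (a * b * c)) + 3 * (e1 (a, b, c) - 3 * (a * b * c)) ^ 2)"
    by (simp only: fin k6 p q r)
qed

lemma f_rot: "f6 (rot v) = f6 v" "f9 (rot v) = f9 v" "f12 (rot v) = f12 v"
  by (cases v, simp add: rot_def f6_def f9_def f12_def e1_def e2_def e3_def power_mult_distrib \<omega>3)+

lemma f6_fourier: "f6 (fourier v) = f6 v"
proof -
  obtain a b c where v: "v = (a, b, c)" by (cases v)
  define e p where "e = e1 (a, b, c)" and "p = a * b * c"
  have "f6 (fourier v) = \<kappa> ^ 2 * (e + 6 * p) ^ 2 + 12 / 27 * (27 * (a ^ 2 - b * c) ^ 3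
     - 27 * a * (a ^ 2 - b * c) * (e - 3 * p) + 3 * (e - 3 * p) ^ 2)"
    unfolding f6_def v e_fourier e_def[symmetric] p_def[symmetric] by (simp add: power_mult_distrib)
  also have "\<dots> = e ^ 2 - 12 * e2 v"
    unfolding \<kappa>_square e_def p_def e1_def e2_def v prod.case by (simp add: field_simps) algebra
  finally show ?thesis by (simp add: f6_def e_def v)
qed

lemma f12_fourier: "f12 (fourier v) = f12 v"
proof -
  obtain a b c where v: "v = (a, b, c)" by (cases v)
  define e p where "e = e1 (a, b, c)" and "p = a * b * c"
  have k2: "\<kappa> * \<kappa> = - 1 / 3" using \<kappa>_square by (simp add: power2_eq_square)
  have "f12 (fourier v) = - \<kappa> * (e + 6 * p) * ((- \<kappa> * (e + 6 * p)) ^ 3 + 216 * (\<kappa> / 81 * (e - 3 * p) ^ 3))"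
    unfolding f12_def v e_fourier e_def p_def by simp
  also have "\<dots> = (\<kappa> * \<kappa>) * (e + 6 * p) * ((\<kappa> * \<kappa>) * (e + 6 * p) ^ 3 - 8 / 3 * (e - 3 * p) ^ 3)"
    by (simp add: field_simps power3_eq_cube)
  also have "\<dots> = e * (e ^ 3 + 216 * p ^ 3)"
    unfolding k2 by (simp add: field_simps) algebra
  finally show ?thesis by (simp add: f12_def e_def p_def v e3_def power_mult_distrib)
qed

lemma f9_fourier: "f9 (fourier v) = f9 v"
proof -
  obtain a b c where v: "v = (a, b, c)" by (cases v)
  have nz: "\<omega> ^ 2 - \<omega> \<noteq> 0" using \<omega>_neq_1 \<omega>3 by (auto simp: power2_eq_square power3_eq_cube)
  define K where "K = 3 * (\<omega> ^ 2 - \<omega>)"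
  have "\<kappa> * (\<omega> ^ 2 - \<omega>) = 1" using nz by (simp add: \<kappa>_def)
  moreover have "\<kappa> * K = 3 * (\<kappa> * (\<omega> ^ 2 - \<omega>))" unfolding K_def by (simp only: mult_ac)
  ultimately have K: "\<kappa> * K = 3" by simp
  have diff: "(a + b + c) ^ 3 - (a + \<omega> ^ 2 * b + \<omega> * c) ^ 3 = K * ((c - \<omega> ^ 2 * b) * (a - \<omega> ^ 2 * c) * (b - \<omega> ^ 2 * a))"
    for a b c using \<omega>_square unfolding K_def by algebra
  define x y z where "x = a + b + c" and "y = a + \<omega> ^ 2 * b + \<omega> * c" and "z = a + \<omega> * b + \<omega> ^ 2 * c"
  have \<omega>\<omega>: "\<omega> ^ 2 * (\<omega> ^ 2 * t) = \<omega> * t" "\<omega> * (\<omega> ^ 2 * t) = t" "\<omega> ^ 2 * (\<omega> * t) = t" "\<omega> * (\<omega> * t) = \<omega> ^ 2 * t" for t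
    using \<omega>3 by (algebra, algebra, algebra, simp add: power2_eq_square)
  have xy: "x ^ 3 - y ^ 3 = K * ((c - \<omega> ^ 2 * b) * (a - \<omega> ^ 2 * c) * (b - \<omega> ^ 2 * a))"
    unfolding x_def y_def by (rule diff)
  have yz: "y ^ 3 - z ^ 3 = K * ((\<omega> * c - \<omega> * b) * (a - c) * (\<omega> ^ 2 * b - \<omega> ^ 2 * a))"
    using diff[of a "\<omega> ^ 2 * b" "\<omega> * c"] unfolding y_def z_def \<omega>\<omega> .
  have zx: "z ^ 3 - x ^ 3 = K * ((\<omega> ^ 2 * c - b) * (a - \<omega> * c) * (\<omega> * b - \<omega> ^ 2 * a))"
    using diff[of a "\<omega> * b" "\<omega> ^ 2 * c"] unfolding x_def z_def \<omega>\<omega> .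
  have cube: "(s - \<omega> ^ 2 * t) * (\<omega> * s - \<omega> * t) * (\<omega> ^ 2 * s - t) = s ^ 3 - t ^ 3"
    "(s - \<omega> ^ 2 * t) * (s - t) * (s - \<omega> * t) = s ^ 3 - t ^ 3"
    "(s - \<omega> ^ 2 * t) * (\<omega> ^ 2 * s - \<omega> ^ 2 * t) * (\<omega> * s - \<omega> ^ 2 * t) = s ^ 3 - t ^ 3" for s t
    using \<omega>_square by algebra+
  have "f9 (fourier v) = \<kappa> ^ 9 * ((x ^ 3 - y ^ 3) * (y ^ 3 - z ^ 3) * (z ^ 3 - x ^ 3))"
    unfolding f9_def fourier_def v x_def y_def z_def prod.case power_mult_distrib by algebra
  also have "\<dots> = (\<kappa> * K) ^ 3 * (\<kappa> ^ 2) ^ 3 *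
     (((c - \<omega> ^ 2 * b) * (\<omega> * c - \<omega> * b) * (\<omega> ^ 2 * c - b)) * ((a - \<omega> ^ 2 * c) * (a - c) * (a - \<omega> * c)) *
      ((b - \<omega> ^ 2 * a) * (\<omega> ^ 2 * b - \<omega> ^ 2 * a) * (\<omega> * b - \<omega> ^ 2 * a)))"
    unfolding xy yz zx by algebra
  also have "\<dots> = - ((c ^ 3 - b ^ 3) * (a ^ 3 - c ^ 3) * (b ^ 3 - a ^ 3))"
    unfolding cube K \<kappa>_square by (simp add: power3_eq_cube)
  also have "\<dots> = f9 v" unfolding f9_def v prod.case by algebra
  finally show ?thesis .
qed


text \<open>Polynomial functions of the three coordinates of the Cartan subspace.\<close>

definition polyfun :: "(point \<Rightarrow> complex) \<Rightarrow> bool" where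
  "polyfun h \<longleftrightarrow> (\<exists>R. \<forall>v. h v = peval (tri (fst v) (fst (snd v)) (snd (snd v))) R)"

lemma polyfun_const: "polyfun (\<lambda>v. k)"
  unfolding polyfun_def by (rule exI[of _ "pconst k"]) simp

lemma polyfun_proj: "polyfun fst" "polyfun (\<lambda>v. fst (snd v))" "polyfun (\<lambda>v. snd (snd v))"
  unfolding polyfun_def
  by (rule exI[of _ "pvar 1"], simp, rule exI[of _ "pvar 2"], simp, rule exI[of _ "pvar 3"], simp)

lemma polyfun_add: "polyfun g \<Longrightarrow> polyfun h \<Longrightarrow> polyfun (\<lambda>v. g v + h v)"
  unfolding polyfun_def by (metis peval_add)

lemma polyfun_diff: "polyfun g \<Longrightarrow> polyfun h \<Longrightarrow> polyfun (\<lambda>v. g v - h v)"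
  unfolding polyfun_def by (metis peval_diff)

lemma polyfun_mult: "polyfun g \<Longrightarrow> polyfun h \<Longrightarrow> polyfun (\<lambda>v. g v * h v)"
  unfolding polyfun_def by (metis peval_mult)

lemma polyfun_power: "polyfun g \<Longrightarrow> polyfun (\<lambda>v. g v ^ n)"
  by (induction n) (auto intro: polyfun_const polyfun_mult)

lemma polyfun_sum: "(\<And>i. i \<in> I \<Longrightarrow> polyfun (g i)) \<Longrightarrow> polyfun (\<lambda>v. \<Sum>i\<in>I. g i v)"
  by (induction I rule: infinite_finite_induct) (auto intro: polyfun_const polyfun_add)

lemma polyfun_prod: "(\<And>i. i \<in> I \<Longrightarrow> polyfun (g i)) \<Longrightarrow> polyfun (\<lambda>v. \<Prod>i\<in>I. g i v)"
  by (induction I rule: infinite_finite_induct) (auto intro: polyfun_const polyfun_mult)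

lemmas polyfun_intros = polyfun_const polyfun_proj polyfun_add polyfun_diff polyfun_mult polyfun_power

lemma polyfun_e: "polyfun e1" "polyfun e2" "polyfun e3"
  unfolding e1_def e2_def e3_def case_prod_beta by (intro polyfun_intros)+

lemma polyfun_f: "polyfun f6" "polyfun f9" "polyfun f12"
  unfolding f6_def[abs_def] f9_def f12_def[abs_def] case_prod_beta by (intro polyfun_intros polyfun_e)+

lemma polyfun_basic: "h \<in> basic \<Longrightarrow> polyfun h"
proof -
  assume "h \<in> basic"
  then obtain P where P: "\<And>v. h v = peval (tri (f6 v) (f9 v) (f12 v)) P" unfolding basic_def by blast
  have t: "polyfun (\<lambda>v. tri (f6 v) (f9 v) (f12 v) i)" for i
    using exhaust_3[of i] polyfun_f by auto
  show ?thesis unfolding P[abs_def] peval_def monom_val_def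
    by (intro polyfun_sum polyfun_mult polyfun_const polyfun_prod polyfun_power t)
qed

lemma polyfun_eq_0_dense:
  assumes "polyfun g" "polyfun h" "h w \<noteq> 0" "\<And>v. h v \<noteq> 0 \<Longrightarrow> g v = 0"
  shows "g v = 0"
proof -
  obtain G H where G: "\<And>v. g v = peval (tri (fst v) (fst (snd v)) (snd (snd v))) G"
    and H: "\<And>v. h v = peval (tri (fst v) (fst (snd v)) (snd (snd v))) H"
    using assms(1,2) unfolding polyfun_def by blast
  have tri: "x = tri (x 1) (x 2) (x 3)" for x :: "3 \<Rightarrow> complex"
    by (rule ext) (metis exhaust_3 tri_simps)
  have "peval x G = 0" if "peval x H \<noteq> 0" for x
    using assms(4)[of "(x 1, x 2, x 3)"] that unfolding G H by (simp flip: tri)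
  then have "peval x G = 0" for x
    using assms(3) unfolding H by (metis peval_eq_0_dense)
  then show ?thesis unfolding G .
qed

lemma prod_3: "prod f (UNIV :: 3 set) = f 1 * f 2 * (f 3 :: 'a :: comm_monoid_mult)"
  unfolding UNIV_3 by (simp add: ac_simps)

text \<open>The reflection and its conjugates leave only exponents divisible by 3, and averaging over the cycle and the swap
  turns every monomial into a multiple of \<open>mono_sum\<close> with the sign given by the parity of the degree.\<close>

lemma weyl_invariant_cubics:
  assumes r: "polyfun r"
    and refl: "\<And>a b c. r (\<omega> * a, b, c) = r (a, b, c)"
    and cyc: "\<And>a b c. r (b, c, a) = r (a, b, c)"
    and swap: "\<And>a b c. r (- a, - c, - b) = r (a, b, c)"
  shows "r \<in> cubics"
proof -
  obtain R where R: "\<And>v. r v = peval (tri (fst v) (fst (snd v)) (snd (snd v))) R"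
    using r unfolding polyfun_def by blast
  define L where "L = Poly_Mapping.lookup R"
  have tri: "x = tri (x 1) (x 2) (x 3)" for x :: "3 \<Rightarrow> complex"
    by (rule ext) (metis exhaust_3 tri_simps)
  have peval: "peval x R = r (x 1, x 2, x 3)" for x
    unfolding R fst_conv snd_conv tri[symmetric] ..
  have dvd: "3 dvd Poly_Mapping.lookup m i" if "m \<in> Poly_Mapping.keys R" for m i
  proof -
    define z where "z v = (if v = i then \<omega> else 1)" for v
    have "r (b, \<omega> * c, a) = r (b, c, a)" "r (c, a, \<omega> * b) = r (c, a, b)" for a b c
      using refl cyc by metis+
    then have "peval (\<lambda>v. z v * x v) R = peval x R" for x
      using exhaust_3[of i] refl unfolding peval z_def by auto
    then have "Poly_Mapping.lookup R m * monom_val z (Poly_Mapping.lookup m) = Poly_Mapping.lookup R m"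
      by (rule poly3_scaled_lookup)
    then have "monom_val z (Poly_Mapping.lookup m) = 1" using that by (simp add: in_keys_iff)
    moreover have "monom_val z (Poly_Mapping.lookup m) = \<omega> ^ Poly_Mapping.lookup m i"
    proof -
      have "monom_val z (Poly_Mapping.lookup m) = (\<Prod>v\<in>UNIV. if v = i then \<omega> ^ Poly_Mapping.lookup m i else 1)"
        unfolding monom_val_def by (rule prod.cong) (auto simp: z_def)
      then show ?thesis by simp
    qed
    ultimately show ?thesis by (simp add: \<omega>_power_eq_1)
  qed
  define d where "d i m = Poly_Mapping.lookup m i div 3" for i :: 3 and m :: "3 \<Rightarrow>\<^sub>0 nat"
  define T where "T m a b c = (a ^ 3) ^ d 1 m * (b ^ 3) ^ d 2 m * (c ^ 3) ^ d 3 m" for m and a b c :: complex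
  have r_eq: "r (a, b, c) = (\<Sum>m\<in>Poly_Mapping.keys R. L m * T m a b c)" for a b c
  proof -
    have "monom_val (tri a b c) (Poly_Mapping.lookup m) = T m a b c" if "m \<in> Poly_Mapping.keys R" for m
    proof -
      have *: "Poly_Mapping.lookup m i = 3 * d i m" for i using dvd[OF that, of i] by (simp add: d_def)
      show ?thesis by (simp only: monom_val_def T_def prod_3 tri_simps * power_mult)
    qed
    then show ?thesis by (simp add: R peval_def L_def)
  qed
  define s where "s m = (- 1 :: complex) ^ (d 1 m + d 2 m + d 3 m)" for m
  have T_neg: "T m (- a) (- b) (- c) = s m * T m a b c" for m a b c
  proof -
    have n: "((- x) ^ 3) ^ k = (- 1) ^ k * (x ^ 3) ^ k" for x :: complex and k
      by (simp add: power_mult_distrib[symmetric])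
    show ?thesis unfolding T_def n s_def power_add by (simp add: mult_ac)
  qed
  have "6 * r (a, b, c) = r (a, b, c) + r (b, c, a) + r (c, a, b)
      + (r (- a, - c, - b) + r (- c, - b, - a) + r (- b, - a, - c))" for a b c
  proof -
    have "r (b, c, a) = r (a, b, c)" "r (c, a, b) = r (a, b, c)"
      using cyc[of a b c] cyc[of b c a] by simp_all
    moreover have "r (- a, - c, - b) = r (a, b, c)" "r (- c, - b, - a) = r (c, a, b)" "r (- b, - a, - c) = r (b, c, a)"
      by (rule swap)+
    ultimately show ?thesis by simp
  qed
  then have "6 * r (a, b, c) = (\<Sum>m\<in>Poly_Mapping.keys R. L m * mono_sum (s m) (d 1 m) (d 2 m) (d 3 m) (a, b, c))" for a b c
    unfolding r_eq T_neg by (simp add: mono_sum_def Let_def T_def sum.distrib[symmetric] distrib_left mult_ac)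
  then have "r v = (1 / 6) * (\<Sum>m\<in>Poly_Mapping.keys R. L m * mono_sum (s m) (d 1 m) (d 2 m) (d 3 m) v)" for v
    by (cases v) (simp add: field_simps)
  moreover have "(\<lambda>v. (1 / 6) * (\<Sum>m\<in>Poly_Mapping.keys R. L m * mono_sum (s m) (d 1 m) (d 2 m) (d 3 m) v)) \<in> cubics"
    unfolding s_def by (intro cubics_mult cubics_const cubics_sum mono_sum_cubics)
  ultimately show ?thesis by (subst ext[of r]) auto
qed

lemma cubic_four_roots:
  fixes p q r s :: complex
  assumes "\<And>t. t \<in> {t1, t2, t3, t4} \<Longrightarrow> p + q * t + r * t ^ 2 + s * t ^ 3 = 0" "distinct [t1, t2, t3, t4]"
  shows "p = 0"
proof -
  define P where "P = [:p, q, r, s:]"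
  have "poly P t = p + q * t + r * t ^ 2 + s * t ^ 3" for t
    by (simp add: P_def algebra_simps power2_eq_square power3_eq_cube)
  then have "{t1, t2, t3, t4} \<subseteq> {t. poly P t = 0}" using assms(1) by auto
  moreover have "card {t1, t2, t3, t4} = 4" using assms(2) by simp
  moreover have "degree P \<le> 3" by (simp add: P_def)
  ultimately have "P = 0"
    using card_mono[OF poly_roots_finite[of P], of "{t1, t2, t3, t4}"] card_poly_roots_bound[of P] by (cases "P = 0") auto
  then show ?thesis by (simp add: P_def)
qed

text \<open>Write \<open>r = p + q * e2 + s * e2 ^ 2 + t * e2 ^ 3\<close> with basic coefficients. The function \<open>r\<close> and the coefficients take the same
  values at \<open>v\<close> and at three images of \<open>v\<close> under the group, while \<open>e2\<close> takes four values there, distinct for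
  generic \<open>v\<close>. So the cubic \<open>p v - r v + q v * X + s v * X ^ 2 + t v * X ^ 3\<close> has four roots and \<open>r = p\<close>.\<close>

theorem weyl_invariant_basic:
  assumes r: "polyfun r"
    and refl: "\<And>a b c. r (\<omega> * a, b, c) = r (a, b, c)"
    and cyc: "\<And>a b c. r (b, c, a) = r (a, b, c)"
    and swap: "\<And>a b c. r (- a, - c, - b) = r (a, b, c)"
    and four: "\<And>v. r (fourier v) = r v"
  shows "r \<in> basic"
proof -
  obtain p q s t where b: "p \<in> basic" "q \<in> basic" "s \<in> basic" "t \<in> basic"
    and eq: "\<And>v. r v = p v + q v * e2 v + s v * e2 v ^ 2 + t v * e2 v ^ 3"
    using cubicsE[OF weyl_invariant_cubics[OF r refl cyc swap]] by blast
  have rot_inv: "r (rot v) = r v" for v using refl by (cases v) (simp add: rot_def)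
  have basic_inv: "h (fourier v) = h v" "h (rot v) = h v" if hb: "h \<in> basic" for h v
  proof -
    obtain P where h: "\<And>v. h v = peval (tri (f6 v) (f9 v) (f12 v)) P" using hb unfolding basic_def by blast
    show "h (fourier v) = h v" "h (rot v) = h v"
      by (simp_all only: h f_rot f6_fourier f9_fourier f12_fourier)
  qed
  define y1 y2 y3 where "y1 v = e2 (fourier v)" and "y2 v = e2 (fourier (rot v))" and "y3 v = e2 (fourier (rot (rot v)))" for v
  define D where "D v = (e2 v - y1 v) * (e2 v - y2 v) * (e2 v - y3 v) * (y1 v - y2 v) * (y1 v - y3 v) * (y2 v - y3 v)" for v
  have vals: "r v = p v + q v * y + s v * y ^ 2 + t v * y ^ 3" if "y \<in> {e2 v, y1 v, y2 v, y3 v}" for y v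
    using that eq[of v] eq[of "fourier v"] eq[of "fourier (rot v)"] eq[of "fourier (rot (rot v))"]
    by (auto simp: basic_inv b rot_inv four y1_def y2_def y3_def)
  have "r v - p v = 0" if "D v \<noteq> 0" for v
  proof -
    have "p v - r v = 0"
    proof (rule cubic_four_roots)
      show "distinct [e2 v, y1 v, y2 v, y3 v]" using that by (simp add: D_def)
      show "p v - r v + q v * y + s v * y ^ 2 + t v * y ^ 3 = 0" if "y \<in> {e2 v, y1 v, y2 v, y3 v}" for y
        unfolding vals[OF that] by simp
    qed
    then show ?thesis by simp
  qed
  moreover have "polyfun D"
    unfolding D_def[abs_def] y1_def y2_def y3_def fourier_def rot_def e2_def case_prod_beta fst_conv snd_conv
    by (intro polyfun_intros)
  moreover have "D (2, 1, 1) \<noteq> 0"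
  proof -
    have "e2 (2, 1, 1) = 17" by (simp add: e2_def)
    moreover have "y1 (2, 1, 1) = - 129 / 27"
      unfolding y1_def e_fourier by (simp add: e1_def)
    moreover have "y2 (2, 1, 1) = - (- 267 + 72 * \<omega>) / 27"
      unfolding y2_def rot_def prod.case e_fourier using \<omega>_square \<omega>3 by (simp add: e1_def) algebra
    moreover have "y3 (2, 1, 1) = - (- 339 - 72 * \<omega>) / 27"
      unfolding y3_def rot_def prod.case e_fourier using \<omega>_square \<omega>3 by (simp add: e1_def) algebra
    ultimately have d: "e2 (2, 1, 1) - y1 (2, 1, 1) = 588 / 27" "e2 (2, 1, 1) - y2 (2, 1, 1) = (192 + 72 * \<omega>) / 27"
      "e2 (2, 1, 1) - y3 (2, 1, 1) = (120 + (- 72) * \<omega>) / 27" "y1 (2, 1, 1) - y2 (2, 1, 1) = (- 396 + 72 * \<omega>) / 27"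
      "y1 (2, 1, 1) - y3 (2, 1, 1) = (- 468 + (- 72) * \<omega>) / 27" "y2 (2, 1, 1) - y3 (2, 1, 1) = (- 72 + (- 144) * \<omega>) / 27"
      by (simp_all only:) (simp_all add: field_simps)
    have lin: "x + y * \<omega> \<noteq> 0" if "x ^ 2 - x * y + y ^ 2 \<noteq> 0" for x y
    proof
      assume "x + y * \<omega> = 0"
      then have "x = - y * \<omega>" by (simp add: eq_neg_iff_add_eq_0)
      then have "x ^ 2 - x * y + y ^ 2 = 0" using \<omega>_square by algebra
      then show False using that by simp
    qed
    have "192 + 72 * \<omega> \<noteq> 0" "120 + (- 72) * \<omega> \<noteq> 0" "- 396 + 72 * \<omega> \<noteq> 0" "- 468 + (- 72) * \<omega> \<noteq> 0"
      "- 72 + (- 144) * \<omega> \<noteq> 0"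
      by (rule lin, simp add: power2_eq_square)+
    then show ?thesis unfolding D_def d mult_eq_0_iff divide_eq_0_iff by (simp only:) simp
  qed
  moreover have "polyfun (\<lambda>v. r v - p v)" by (intro polyfun_diff r polyfun_basic b)
  ultimately have "r v - p v = 0" for v
    using polyfun_eq_0_dense[of "\<lambda>v. r v - p v" D "(2, 1, 1)"] by blast
  then have "r = p" by (simp add: fun_eq_iff)
  then show ?thesis using b by simp
qed

section \<open>Free generation\<close>

lemma cubic_splits:
  fixes p q r :: complex
  obtains A B C where "A + B + C = p" "A * B + B * C + C * A = q" "A * B * C = r"
proof -
  have "\<not> constant (poly [:- r, q, - p, 1:])" by (simp add: constant_degree)
  then obtain A where A: "poly [:- r, q, - p, 1:] A = 0" using fundamental_theorem_of_algebra by blast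
  define u where "u = csqrt ((p - A) ^ 2 - 4 * (q - A * (p - A)))"
  have u: "u ^ 2 = (p - A) ^ 2 - 4 * (q - A * (p - A))" by (simp add: u_def)
  define B C where "B = ((p - A) + u) / 2" and "C = ((p - A) - u) / 2"
  have "A + B + C = p" by (simp add: B_def C_def field_simps)
  moreover have BC: "B * C = q - A * (p - A)"
  proof -
    have "4 * (B * C) = (p - A) ^ 2 - u ^ 2" by (simp add: B_def C_def field_simps power2_eq_square)
    then have "4 * (B * C) = 4 * (q - A * (p - A))" unfolding u by simp
    then show ?thesis by (rule mult_left_cancel[THEN iffD1, rotated]) simp
  qed
  moreover have "A * B + B * C + C * A = A * (B + C) + B * C" by (simp add: algebra_simps)
  moreover have "B + C = p - A" by (simp add: B_def C_def field_simps)
  moreover have "A * B * C = r"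
    using A unfolding mult.assoc BC by (simp add: algebra_simps power2_eq_square power3_eq_cube)
  ultimately show ?thesis using that[of A B C] by simp
qed

text \<open>The fibres are not empty: for given values of \<open>f6\<close>, \<open>f9\<close>, \<open>f12\<close> compatible values of
  \<open>e1\<close>, \<open>e2\<close>, \<open>e3\<close> are found by solving polynomial equations in one variable, and the roots of the cubic with these coefficients give the point. In particular the three
  functions are algebraically independent.\<close>

lemma invariants_surjective:
  obtains v where "f6 v = s" "f9 v = \<delta>" "f12 v = w"
proof -
  define d where "d = \<delta> ^ 2"
  let ?Q = "[: w ^ 2 + 30 * w * s ^ 2 - 31 * s ^ 4 + 1728 * d * s, 576 * w * s - 1344 * s ^ 3 + 20736 * d,
      2592 * w - 23328 * s ^ 2, - 186624 * s, - 559872 :]"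
  have "\<not> constant (poly ?Q)" by (simp add: constant_degree)
  then obtain x where x: "poly ?Q x = 0" using fundamental_theorem_of_algebra by blast
  define t y where "t = s + 12 * x" and "y = (w - t ^ 2) / 216"
  define z where "z = (t * x ^ 2 - 4 * x ^ 3 - 4 * t * y + 18 * x * y - d) / 27"
  have s: "s = t - 12 * x" by (simp add: t_def)
  have "y * 216 = w - t ^ 2" by (metis nonzero_eq_divide_eq zero_neq_numeral y_def)
  then have w: "w = t ^ 2 + 216 * y" by (simp add: algebra_simps)
  have d: "d = t * x ^ 2 - 4 * x ^ 3 - 4 * t * y + 18 * x * y - 27 * z"
  proof -
    have "z * 27 = t * x ^ 2 - 4 * x ^ 3 - 4 * t * y + 18 * x * y - d"
      by (metis nonzero_eq_divide_eq zero_neq_numeral z_def)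
    then show ?thesis by (simp add: algebra_simps)
  qed
  have "poly ?Q x = 46656 * (y ^ 2 - t * z)"
    by (simp only: poly_pCons poly_0, unfold s w d, algebra)
  then have yz: "y ^ 2 = t * z" using x by simp
  obtain p r where pr: "p ^ 2 = t" "p * r = y" "r ^ 2 = z"
  proof (cases "t = 0")
    case True
    then show ?thesis using that[of 0 "csqrt z"] yz by simp
  next
    case False
    then have "(y / csqrt t) ^ 2 = z" using yz by (simp add: power_divide)
    then show ?thesis using that[of "csqrt t" "y / csqrt t"] False by simp
  qed
  obtain A B C where ABC: "A + B + C = p" "A * B + B * C + C * A = x" "A * B * C = r" by (rule cubic_splits)
  obtain a b c where abc: "a ^ 3 = A" "b ^ 3 = B" "c ^ 3 = C" using complex_cube_root by metis
  have e: "e1 (a, b, c) = p" "e2 (a, b, c) = x" "e3 (a, b, c) = r"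
    by (simp_all add: e1_def e2_def e3_def abc ABC)
  have e': "e1 (a, c, b) = p" "e2 (a, c, b) = x" "e3 (a, c, b) = r"
    unfolding e[symmetric] by (simp_all add: e1_def e2_def e3_def)
  have pp: "p ^ 2 - 12 * x = s" "p * (p ^ 3 + 216 * r) = w"
  proof -
    show "p ^ 2 - 12 * x = s" by (simp add: s pr)
    have "p * (p ^ 3 + 216 * r) = (p ^ 2) ^ 2 + 216 * (p * r)"
      by (simp add: algebra_simps power2_eq_square power3_eq_cube)
    then show "p * (p ^ 3 + 216 * r) = w" by (simp add: w pr)
  qed
  have f: "f6 (a, b, c) = s" "f12 (a, b, c) = w" "f6 (a, c, b) = s" "f12 (a, c, b) = w"
    by (simp_all only: f6_def f12_def e e' pp)
  have "f9 (a, b, c) ^ 2 = p ^ 2 * x ^ 2 - 4 * x ^ 3 - 4 * p ^ 2 * (p * r) + 18 * x * (p * r) - 27 * r ^ 2"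
    unfolding discriminant e by (simp add: algebra_simps power2_eq_square power3_eq_cube)
  also have "\<dots> = \<delta> ^ 2" unfolding pr using d by (simp add: d_def)
  finally have "f9 (a, b, c) = \<delta> \<or> f9 (a, b, c) = - \<delta>" by (simp add: power2_eq_iff)
  moreover have "f9 (a, c, b) = - f9 (a, b, c)" by (simp add: f9_def) algebra
  ultimately show ?thesis using that[of "(a, b, c)"] that[of "(a, c, b)"] f by auto
qed

definition restrict :: "cube_poly \<Rightarrow> point \<Rightarrow> complex" where
  "restrict f = (\<lambda>(a, b, c). peval (cartan a b c) f)"

lemma polyfun_restrict: "polyfun (restrict f)"
proof -
  have c: "polyfun (\<lambda>v. cartan (fst v) (fst (snd v)) (snd (snd v)) t)" for t
    unfolding cartan_def
    by (cases "t \<in> {(1, 1, 1), (2, 2, 2), (3, 3, 3)}"; cases "t \<in> {(1, 2, 3), (2, 3, 1), (3, 1, 2)}";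
        cases "t \<in> {(1, 3, 2), (2, 1, 3), (3, 2, 1)}"; simp only: if_True if_False polyfun_proj polyfun_const)
  show ?thesis unfolding restrict_def case_prod_beta peval_def monom_val_def
    by (intro polyfun_sum polyfun_mult polyfun_const polyfun_prod polyfun_power c)
qed

text \<open>Chevalley restriction: it maps invariants to polynomials in \<open>f6\<close>, \<open>f9\<close>, \<open>f12\<close>, and by density it is injective.\<close>

lemma restrict_basic:
  assumes "f \<in> invariants"
  shows "restrict f \<in> basic"
proof (rule weyl_invariant_basic[OF polyfun_restrict])
  show "restrict f (fourier v) = restrict f v" for v
    using cartan_fourier[OF assms] by (cases v) (simp add: restrict_def fourier_def)
qed (use cartan_reflection[OF assms] cartan_cycle[OF assms] cartan_swap[OF assms] in \<open>simp_all add: restrict_def\<close>)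

lemma restrict_eq_0: "f \<in> invariants \<Longrightarrow> (\<And>v. restrict f v = 0) \<Longrightarrow> f = 0"
  by (rule invariant_eq_0_if_vanishing_on_cartan) (auto simp: restrict_def)

lemma homogeneous_scale:
  fixes f :: "'v::finite cpoly"
  assumes "homogeneous n f"
  shows "peval (\<lambda>v. t * x v) f = t ^ n * peval x f"
proof -
  have "(\<Sum>v\<in>UNIV. Poly_Mapping.lookup m v) = n" if "m \<in> Poly_Mapping.keys f" for m
  proof -
    have "(\<Sum>v\<in>UNIV. Poly_Mapping.lookup m v) = (\<Sum>v\<in>Poly_Mapping.keys m. Poly_Mapping.lookup m v)"
      by (rule sum.mono_neutral_right) (auto simp: in_keys_iff)
    then show ?thesis using assms that unfolding homogeneous_def by simp
  qed
  then have "(\<Sum>m\<in>Poly_Mapping.keys f. Poly_Mapping.lookup f m * monom_val x (Poly_Mapping.lookup m) *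
      t ^ (\<Sum>v\<in>UNIV. 1 * Poly_Mapping.lookup m v)) = t ^ n * peval x f"
    unfolding peval_def sum_distrib_left by (intro sum.cong) auto
  then show ?thesis using peval_scale[of t "\<lambda>_. 1" x f] by simp
qed

definition weighted_keys :: "nat \<Rightarrow> 3 cpoly \<Rightarrow> (3 \<Rightarrow>\<^sub>0 nat) set" where
  "weighted_keys n P = {m. m \<in> Poly_Mapping.keys P \<and>
     6 * Poly_Mapping.lookup m 1 + 9 * Poly_Mapping.lookup m 2 + 12 * Poly_Mapping.lookup m 3 = n}"

text \<open>Taking the part of degree \<open>n\<close> on both sides.\<close>

lemma restrict_homogeneous:
  assumes f: "f \<in> invariants" "homogeneous n f"
  obtains P where "\<And>v. restrict f v = (\<Sum>m\<in>weighted_keys n P.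
    Poly_Mapping.lookup P m * (f6 v ^ Poly_Mapping.lookup m 1 * f9 v ^ Poly_Mapping.lookup m 2 * f12 v ^ Poly_Mapping.lookup m 3))"
proof -
  obtain P where P: "\<And>v. restrict f v = peval (tri (f6 v) (f9 v) (f12 v)) P"
    using restrict_basic[OF f(1)] unfolding basic_def by blast
  have "restrict f v = peval (tri (f6 v) (f9 v) (f12 v)) (degree_part (tri 6 9 12) n P)" for v
  proof -
    obtain a b c where v: "v = (a, b, c)" by (cases v)
    have "peval (\<lambda>i. t ^ tri 6 9 12 i * tri (f6 v) (f9 v) (f12 v) i) P = poly (monom (restrict f v) n) t" for t
    proof -
      let ?v = "(t * a, t * b, t * c)"
      have sc: "e1 ?v = t ^ 3 * e1 v" "e2 ?v = t ^ 6 * e2 v" "e3 ?v = t ^ 9 * e3 v" "f9 ?v = t ^ 9 * f9 v"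
        unfolding v by (simp_all add: e1_def e2_def e3_def f9_def, algebra+)
      have "f6 ?v = t ^ 6 * f6 v" "f12 ?v = t ^ 12 * f12 v"
        unfolding f6_def f12_def sc by algebra+
      then have "(\<lambda>i. t ^ tri 6 9 12 i * tri (f6 v) (f9 v) (f12 v) i) = tri (f6 ?v) (f9 ?v) (f12 ?v)"
        using sc(4) by (intro ext) (auto simp: tri_def)
      then have "peval (\<lambda>i. t ^ tri 6 9 12 i * tri (f6 v) (f9 v) (f12 v) i) P = restrict f ?v" by (simp add: P)
      also have "\<dots> = peval (\<lambda>i. t * cartan a b c i) f"
        unfolding restrict_def prod.case by (intro arg_cong2[of _ _ _ _ peval]) (auto simp: cartan_def)
      also have "\<dots> = t ^ n * restrict f v" by (simp add: homogeneous_scale[OF f(2)] restrict_def v)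
      finally show ?thesis by (simp add: poly_monom mult.commute)
    qed
    from peval_scale_coeff[OF this, of n] show ?thesis by simp
  qed
  then show ?thesis
    by (intro that[of P]) (simp add: peval_degree_part sum_3 monom_val_def prod_3 weighted_keys_def)
qed

lemma restrict_6:
  assumes "f \<in> invariants" "homogeneous 6 f" "f \<noteq> 0"
  obtains k where "k \<noteq> 0" "\<And>v. restrict f v = k * f6 v"
proof -
  obtain P where P: "\<And>v. restrict f v = (\<Sum>m\<in>weighted_keys 6 P.
    Poly_Mapping.lookup P m * (f6 v ^ Poly_Mapping.lookup m 1 * f9 v ^ Poly_Mapping.lookup m 2 * f12 v ^ Poly_Mapping.lookup m 3))"
    using restrict_homogeneous[OF assms(1,2)] by blast
  have w: "Poly_Mapping.lookup m 1 = 1 \<and> Poly_Mapping.lookup m 2 = 0 \<and> Poly_Mapping.lookup m 3 = 0"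
    if "m \<in> weighted_keys 6 P" for m using that unfolding weighted_keys_def by clarify presburger
  have "restrict f v = (\<Sum>m\<in>weighted_keys 6 P. Poly_Mapping.lookup P m) * f6 v" for v
    unfolding P sum_distrib_right by (intro sum.cong) (simp_all add: w)
  then show ?thesis using that restrict_eq_0[OF assms(1)] assms(3) by (metis mult_zero_left)
qed

lemma restrict_9:
  assumes "f \<in> invariants" "homogeneous 9 f" "f \<noteq> 0"
  obtains k where "k \<noteq> 0" "\<And>v. restrict f v = k * f9 v"
proof -
  obtain P where P: "\<And>v. restrict f v = (\<Sum>m\<in>weighted_keys 9 P.
    Poly_Mapping.lookup P m * (f6 v ^ Poly_Mapping.lookup m 1 * f9 v ^ Poly_Mapping.lookup m 2 * f12 v ^ Poly_Mapping.lookup m 3))"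
    using restrict_homogeneous[OF assms(1,2)] by blast
  have w: "Poly_Mapping.lookup m 1 = 0 \<and> Poly_Mapping.lookup m 2 = 1 \<and> Poly_Mapping.lookup m 3 = 0"
    if "m \<in> weighted_keys 9 P" for m using that unfolding weighted_keys_def by clarify presburger
  have "restrict f v = (\<Sum>m\<in>weighted_keys 9 P. Poly_Mapping.lookup P m) * f9 v" for v
    unfolding P sum_distrib_right by (intro sum.cong) (simp_all add: w)
  then show ?thesis using that restrict_eq_0[OF assms(1)] assms(3) by (metis mult_zero_left)
qed

text \<open>At the point \<open>(1, 0, 0)\<close> both \<open>f6\<close> and \<open>f12\<close> have the value 1. If the restriction were a multiple of \<open>f6 ^ 2\<close>, it would vanish together
  with its value at this point.\<close>

lemma restrict_12:
  assumes "f \<in> invariants" "homogeneous 12 f" "f \<noteq> 0" "peval (cartan 1 0 0) f = 0"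
  obtains k l where "l \<noteq> 0" "\<And>v. restrict f v = k * f6 v ^ 2 + l * f12 v"
proof -
  obtain P where P: "\<And>v. restrict f v = (\<Sum>m\<in>weighted_keys 12 P.
    Poly_Mapping.lookup P m * (f6 v ^ Poly_Mapping.lookup m 1 * f9 v ^ Poly_Mapping.lookup m 2 * f12 v ^ Poly_Mapping.lookup m 3))"
    using restrict_homogeneous[OF assms(1,2)] by blast
  define k where "k = (\<Sum>m\<in>weighted_keys 12 P. if Poly_Mapping.lookup m 3 = 0 then Poly_Mapping.lookup P m else 0)"
  define l where "l = (\<Sum>m\<in>weighted_keys 12 P. if Poly_Mapping.lookup m 3 = 0 then 0 else Poly_Mapping.lookup P m)"
  have w: "Poly_Mapping.lookup m 1 = 2 \<and> Poly_Mapping.lookup m 2 = 0 \<and> Poly_Mapping.lookup m 3 = 0 \<or>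
      Poly_Mapping.lookup m 1 = 0 \<and> Poly_Mapping.lookup m 2 = 0 \<and> Poly_Mapping.lookup m 3 = 1"
    if "m \<in> weighted_keys 12 P" for m using that unfolding weighted_keys_def by clarify presburger
  have *: "restrict f v = k * f6 v ^ 2 + l * f12 v" for v
    unfolding P k_def l_def sum_distrib_right sum.distrib[symmetric]
  proof (intro sum.cong refl)
    fix m assume "m \<in> weighted_keys 12 P"
    from w[OF this] show "Poly_Mapping.lookup P m * (f6 v ^ Poly_Mapping.lookup m 1 * f9 v ^ Poly_Mapping.lookup m 2 * f12 v ^ Poly_Mapping.lookup m 3) =
      (if Poly_Mapping.lookup m 3 = 0 then Poly_Mapping.lookup P m else 0) * f6 v ^ 2 +
      (if Poly_Mapping.lookup m 3 = 0 then 0 else Poly_Mapping.lookup P m) * f12 v"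
      by (elim disjE) simp_all
  qed
  have "k + l = 0"
    using *[of "(1, 0, 0)"] assms(4) by (simp add: restrict_def f6_def f12_def e1_def e2_def e3_def)
  moreover have "l \<noteq> 0"
  proof
    assume "l = 0"
    with \<open>k + l = 0\<close> * have "restrict f v = 0" for v by simp
    then show False using restrict_eq_0[OF assms(1)] assms(3) by blast
  qed
  ultimately show ?thesis using that * by blast
qed

text \<open>On the Cartan subspace \<open>J6\<close> and \<open>J9\<close> are nonzero multiples of \<open>f6\<close> and \<open>f9\<close>, because there is nothing else in
  these degrees, and \<open>J12\<close> is \<open>k * f6 ^ 2 + l * f12\<close> with \<open>l \<noteq> 0\<close>. So they generate the same ring of functions as \<open>f6\<close>, \<open>f9\<close>, \<open>f12\<close>
  by a triangular substitution, and injectivity of the restriction lifts this to the invariants. The only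
  information about the three polynomials that enters is invariance, degree, being nonzero and one value.\<close>

theorem free_generation:
  assumes I: "J6 \<in> invariants" "J9 \<in> invariants" "J12 \<in> invariants"
    and H: "homogeneous 6 J6" "homogeneous 9 J9" "homogeneous 12 J12"
    and nz: "J6 \<noteq> 0" "J9 \<noteq> 0" "J12 \<noteq> 0"
    and J12: "peval (cartan 1 0 0) J12 = 0"
  shows "freely_generates (tri J6 J9 J12) invariants"
proof -
  obtain k6 where k6: "k6 \<noteq> 0" "\<And>v. restrict J6 v = k6 * f6 v" by (rule restrict_6[OF I(1) H(1) nz(1)]) blast
  obtain k9 where k9: "k9 \<noteq> 0" "\<And>v. restrict J9 v = k9 * f9 v" by (rule restrict_9[OF I(2) H(2) nz(2)]) blast
  obtain k l where l: "l \<noteq> 0" "\<And>v. restrict J12 v = k * f6 v ^ 2 + l * f12 v" by (rule restrict_12[OF I(3) H(3) nz(3) J12]) blast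
  let ?\<phi> = "tri J6 J9 J12"
  have ev: "(\<lambda>i. peval x (?\<phi> i)) = tri (peval x J6) (peval x J9) (peval x J12)" for x
    by (auto simp: tri_def)
  have res: "restrict (psubst ?\<phi> P) v = peval (tri (k6 * f6 v) (k9 * f9 v) (k * f6 v ^ 2 + l * f12 v)) P" for P v
    using k6(2)[of v] k9(2)[of v] l(2)[of v] by (cases v) (simp add: restrict_def ev)
  have inv: "psubst ?\<phi> P \<in> invariants" for P
    using I by (simp add: invariants_iff ev)
  have "inj (psubst ?\<phi>)"
  proof (rule injI)
    fix P Q assume eq: "psubst ?\<phi> P = psubst ?\<phi> Q"
    have "peval x P = peval x Q" for x
    proof -
      obtain v where "f6 v = x 1 / k6" "f9 v = x 2 / k9" "f12 v = (x 3 - k * (x 1 / k6) ^ 2) / l"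
        by (rule invariants_surjective)
      then have "k6 * f6 v = x 1" "k9 * f9 v = x 2" "k * f6 v ^ 2 + l * f12 v = x 3"
        using k6 k9 l by auto
      then have "tri (k6 * f6 v) (k9 * f9 v) (k * f6 v ^ 2 + l * f12 v) = x"
        by (intro ext) (metis exhaust_3 tri_simps)
      then show ?thesis using res[of P v] res[of Q v] eq by simp
    qed
    then show "P = Q" by (rule poly_eqI_peval)
  qed
  moreover have "f \<in> range (psubst ?\<phi>)" if f: "f \<in> invariants" for f
  proof -
    obtain P where P: "\<And>v. restrict f v = peval (tri (f6 v) (f9 v) (f12 v)) P"
      using restrict_basic[OF f] unfolding basic_def by blast
    define Q :: "3 cpoly" where "Q = psubst (tri (pconst (1 / k6) * pvar 1) (pconst (1 / k9) * pvar 2)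
        (pconst (1 / l) * (pvar 3 - pconst (k / k6 ^ 2) * pvar 1 ^ 2))) P"
    have "restrict (psubst ?\<phi> Q) v = restrict f v" for v
    proof -
      have "(\<lambda>i. peval (tri (k6 * f6 v) (k9 * f9 v) (k * f6 v ^ 2 + l * f12 v)) (tri (pconst (1 / k6) * pvar 1) (pconst (1 / k9) * pvar 2)
        (pconst (1 / l) * (pvar 3 - pconst (k / k6 ^ 2) * pvar 1 ^ 2)) i)) = tri (f6 v) (f9 v) (f12 v)"
        using k6 k9 l by (auto simp: tri_def fun_eq_iff power_mult_distrib)
      then show ?thesis unfolding res Q_def by (simp add: P)
    qed
    moreover have "restrict (g - h) v = restrict g v - restrict h v" for g h v
      by (cases v) (simp add: restrict_def)
    ultimately have "restrict (psubst ?\<phi> Q - f) v = 0" for v by simp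
    moreover have "psubst ?\<phi> Q - f \<in> invariants"
      using f inv[of Q] unfolding invariants_iff peval_diff by metis
    ultimately have "psubst ?\<phi> Q - f = 0" using restrict_eq_0 by blast
    then show ?thesis by (metis eq_iff_diff_eq_0 rangeI)
  qed
  ultimately show ?thesis using inv by (auto simp: freely_generates_def bij_betw_def)
qed

section \<open>The finite group and its orbit sums\<close>

lemma perms3_eq: "perms3 = {tri 1 2 3, tri 1 3 2, tri 2 1 3, tri 2 3 1, tri 3 1 2, tri 3 2 1}"
proof -
  have "\<sigma> \<in> {tri 1 2 3, tri 1 3 2, tri 2 1 3, tri 2 3 1, tri 3 1 2, tri 3 2 1}" if "\<sigma> permutes UNIV" for \<sigma> :: "3 \<Rightarrow> 3"
  proof -
    have "inj \<sigma>" using that by (rule permutes_inj)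
    then have ne: "\<sigma> 1 \<noteq> \<sigma> 2" "\<sigma> 1 \<noteq> \<sigma> 3" "\<sigma> 2 \<noteq> \<sigma> 3" by (simp_all add: inj_eq)
    have "\<sigma> = tri (\<sigma> 1) (\<sigma> 2) (\<sigma> 3)" by (rule ext) (metis exhaust_3 tri_simps)
    then show ?thesis
      using exhaust_3[of "\<sigma> 1"] exhaust_3[of "\<sigma> 2"] exhaust_3[of "\<sigma> 3"] ne
      by (elim disjE) auto
  qed
  moreover have "\<sigma> permutes UNIV" if "\<sigma> \<in> {tri 1 2 3, tri 1 3 2, tri 2 1 3, tri 2 3 1, tri 3 1 2, tri 3 2 1}" for \<sigma> :: "3 \<Rightarrow> 3"
  proof -
    have "inj \<sigma>" unfolding inj_def forall_3 using that by (elim insertE emptyE) simp_all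
    then have "bij \<sigma>" by (simp add: bij_def finite_UNIV_inj_surj)
    then show ?thesis by (rule bij_imp_permutes) simp
  qed
  ultimately show ?thesis by (auto simp: perms3_def)
qed

lemma tri_inject: "tri a b c = tri a' b' c' \<longleftrightarrow> a = a' \<and> b = b' \<and> c = c'"
  by (metis tri_simps)

lemma sum_perms3: "(\<Sum>\<sigma>\<in>perms3. F \<sigma>) = F (tri 1 2 3) + F (tri 1 3 2) + F (tri 2 1 3) + F (tri 2 3 1) + F (tri 3 1 2) + F (tri 3 2 1)"
  unfolding perms3_eq by (subst sum.insert; simp add: tri_inject add_ac)+

lemma sign_perms3:
  "sign (tri 1 2 3 :: 3 \<Rightarrow> 3) = 1" "sign (tri 1 3 2 :: 3 \<Rightarrow> 3) = - 1" "sign (tri 2 1 3 :: 3 \<Rightarrow> 3) = - 1"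
  "sign (tri 2 3 1 :: 3 \<Rightarrow> 3) = 1" "sign (tri 3 1 2 :: 3 \<Rightarrow> 3) = 1" "sign (tri 3 2 1 :: 3 \<Rightarrow> 3) = - 1"
proof -
  have *: "tri 1 2 3 = (id :: 3 \<Rightarrow> 3)" "tri 1 3 2 = Transposition.transpose (2 :: 3) 3" "tri 2 1 3 = Transposition.transpose (1 :: 3) 2"
    "tri 2 3 1 = Transposition.transpose (1 :: 3) 2 \<circ> Transposition.transpose 2 3"
    "tri 3 1 2 = Transposition.transpose (2 :: 3) 3 \<circ> Transposition.transpose 1 2"
    "tri 3 2 1 = Transposition.transpose (1 :: 3) 3"
    by (simp_all add: fun_eq_iff forall_3 Transposition.transpose_def)
  show "sign (tri 1 2 3 :: 3 \<Rightarrow> 3) = 1" "sign (tri 1 3 2 :: 3 \<Rightarrow> 3) = - 1" "sign (tri 2 1 3 :: 3 \<Rightarrow> 3) = - 1"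
    "sign (tri 2 3 1 :: 3 \<Rightarrow> 3) = 1" "sign (tri 3 1 2 :: 3 \<Rightarrow> 3) = 1" "sign (tri 3 2 1 :: 3 \<Rightarrow> 3) = - 1"
    unfolding * by (simp_all add: sign_swap_id sign_compose permutation_swap_id)
qed

lemma finite_perms3 [simp]: "finite perms3" by (simp add: perms3_eq)

lemma finite_G [simp]: "finite G" by (simp add: G_def)

lemma card_G: "card G = 1296"
proof -
  have "card perms3 = 6" unfolding perms3_eq by (simp add: tri_inject)
  then show ?thesis by (simp add: G_def card_cartesian_product)
qed

lemma coord_tri: "coord (a, b, c) = tri a b c"
  by (simp add: coord_def tri_def fun_eq_iff)

lemma coord_inject: "s = t \<longleftrightarrow> (\<forall>d. coord s d = coord t d)"
  by (cases s; cases t) (simp add: coord_tri forall_3)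

text \<open>The permutation of the 27 cells through which an element of the group acts on arrays.\<close>

definition index_map :: "grp \<Rightarrow> idx \<Rightarrow> idx" where
  "index_map = (\<lambda>(\<alpha>, \<beta>, \<gamma>, \<delta>) t. let s = (\<alpha> (coord t 1), \<beta> (coord t 2), \<gamma> (coord t 3))
     in (coord s (\<delta> 1), coord s (\<delta> 2), coord s (\<delta> 3)))"

lemma gact_index_map: "gact g E = E \<circ> index_map g"
  by (cases g) (auto simp: gact_def slice_act_def dir_act_def index_map_def Let_def coord_tri fun_eq_iff)

lemma coord_index_map: "coord (index_map (\<alpha>, \<beta>, \<gamma>, \<delta>) t) d = tri \<alpha> \<beta> \<gamma> (\<delta> d) (coord t (\<delta> d))"
proof -
  have "coord (index_map (\<alpha>, \<beta>, \<gamma>, \<delta>) t) d = tri (\<alpha> (coord t 1)) (\<beta> (coord t 2)) (\<gamma> (coord t 3)) (\<delta> d)"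
    using exhaust_3[of d] by (auto simp: index_map_def Let_def coord_tri)
  then show ?thesis using exhaust_3[of "\<delta> d"] by auto
qed

text \<open>The product of the semidirect product, chosen so that \<open>gact\<close> is an action.\<close>

definition gmul :: "grp \<Rightarrow> grp \<Rightarrow> grp" where
  "gmul = (\<lambda>(\<alpha>, \<beta>, \<gamma>, \<delta>) (\<alpha>', \<beta>', \<gamma>', \<delta>').
     (tri \<alpha>' \<beta>' \<gamma>' (inv \<delta> 1) \<circ> \<alpha>, tri \<alpha>' \<beta>' \<gamma>' (inv \<delta> 2) \<circ> \<beta>, tri \<alpha>' \<beta>' \<gamma>' (inv \<delta> 3) \<circ> \<gamma>, \<delta> \<circ> \<delta>'))"

lemma tri_in: "a \<in> S \<Longrightarrow> b \<in> S \<Longrightarrow> c \<in> S \<Longrightarrow> tri a b c i \<in> S"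
  by (auto simp: tri_def)

lemma gmul_in_G: "g \<in> G \<Longrightarrow> h \<in> G \<Longrightarrow> gmul g h \<in> G"
proof -
  have o: "\<sigma> \<circ> \<tau> \<in> perms3" if "\<sigma> \<in> perms3" "\<tau> \<in> perms3" for \<sigma> \<tau>
    using that by (simp add: perms3_def permutes_compose)
  show "g \<in> G \<Longrightarrow> h \<in> G \<Longrightarrow> gmul g h \<in> G"
    by (cases g; cases h) (auto simp: gmul_def G_def intro!: o tri_in)
qed

lemma gact_gmul:
  assumes "g \<in> G"
  shows "gact (gmul g h) E = gact g (gact h E)"
proof -
  obtain \<alpha> \<beta> \<gamma> \<delta> \<alpha>' \<beta>' \<gamma>' \<delta>' where g: "g = (\<alpha>, \<beta>, \<gamma>, \<delta>)" and h: "h = (\<alpha>', \<beta>', \<gamma>', \<delta>')"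
    by (cases g; cases h)
  have "bij \<delta>" using assms by (auto simp: g G_def perms3_def permutes_bij)
  then have inv: "inv \<delta> (\<delta> d) = d" for d by (simp add: bij_is_inj)
  have "coord (index_map (gmul g h) t) d = coord (index_map h (index_map g t)) d" for t d
  proof -
    have "tri (tri \<alpha>' \<beta>' \<gamma>' (inv \<delta> 1) \<circ> \<alpha>) (tri \<alpha>' \<beta>' \<gamma>' (inv \<delta> 2) \<circ> \<beta>) (tri \<alpha>' \<beta>' \<gamma>' (inv \<delta> 3) \<circ> \<gamma>) e =
        tri \<alpha>' \<beta>' \<gamma>' (inv \<delta> e) \<circ> tri \<alpha> \<beta> \<gamma> e" for e
      using exhaust_3[of e] by auto
    then show ?thesis by (simp add: gmul_def g h coord_index_map inv)
  qed
  then have "index_map (gmul g h) = index_map h \<circ> index_map g" by (simp add: fun_eq_iff coord_inject)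
  then show ?thesis by (simp add: gact_index_map comp_assoc)
qed

lemma inj_gmul:
  assumes "g \<in> G"
  shows "inj (gmul g)"
proof (rule injI)
  fix h h' assume eq: "gmul g h = gmul g h'"
  obtain \<alpha> \<beta> \<gamma> \<delta> where g: "g = (\<alpha>, \<beta>, \<gamma>, \<delta>)" by (cases g)
  obtain \<alpha>1 \<beta>1 \<gamma>1 \<delta>1 where h: "h = (\<alpha>1, \<beta>1, \<gamma>1, \<delta>1)" by (cases h)
  obtain \<alpha>2 \<beta>2 \<gamma>2 \<delta>2 where h': "h' = (\<alpha>2, \<beta>2, \<gamma>2, \<delta>2)" by (cases h')
  have bij: "bij \<alpha>" "bij \<beta>" "bij \<gamma>" "bij \<delta>" using assms by (auto simp: g G_def perms3_def permutes_bij)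
  have cancel: "\<sigma> = \<tau>" if "\<sigma> \<circ> \<rho> = \<tau> \<circ> \<rho>" "bij \<rho>" for \<sigma> \<tau> \<rho> :: "3 \<Rightarrow> 3"
    using that by (metis bij_is_surj comp_assoc comp_id surj_iff)
  have "tri \<alpha>1 \<beta>1 \<gamma>1 (inv \<delta> e) = tri \<alpha>2 \<beta>2 \<gamma>2 (inv \<delta> e)" for e
    using eq exhaust_3[of e] bij cancel by (auto simp: gmul_def g h h')
  then have "tri \<alpha>1 \<beta>1 \<gamma>1 d = tri \<alpha>2 \<beta>2 \<gamma>2 d" for d
    using bij(4) by (metis bij_inv_eq_iff)
  then have "\<alpha>1 = \<alpha>2 \<and> \<beta>1 = \<beta>2 \<and> \<gamma>1 = \<gamma>2" by (metis tri_simps)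
  moreover have "\<delta>1 = \<delta>2"
    using eq bij(4) by (auto simp: gmul_def g h h' fun_eq_iff bij_is_inj inj_eq)
  ultimately show "h = h'" by (simp add: h h')
qed

lemma bij_gmul: "g \<in> G \<Longrightarrow> bij_betw (gmul g) G G"
  by (intro bij_betw_imageI inj_on_subset[OF inj_gmul] endo_inj_surj) (auto simp: gmul_in_G intro: inj_on_subset[OF inj_gmul])

lemma gsign_gmul: "g \<in> G \<Longrightarrow> h \<in> G \<Longrightarrow> gsign (gmul g h) = gsign g * gsign h"
proof -
  assume G: "g \<in> G" "h \<in> G"
  obtain \<alpha> \<beta> \<gamma> \<delta> \<alpha>' \<beta>' \<gamma>' \<delta>' where g: "g = (\<alpha>, \<beta>, \<gamma>, \<delta>)" and h: "h = (\<alpha>', \<beta>', \<gamma>', \<delta>')"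
    by (cases g; cases h)
  have p: "\<alpha> \<in> perms3" "\<beta> \<in> perms3" "\<gamma> \<in> perms3" "\<delta> \<in> perms3" "\<alpha>' \<in> perms3" "\<beta>' \<in> perms3" "\<gamma>' \<in> perms3" "\<delta>' \<in> perms3"
    using G by (auto simp: g h G_def)
  have mult: "sign (\<sigma> \<circ> \<tau>) = sign \<sigma> * sign \<tau>" if "\<sigma> \<in> perms3" "\<tau> \<in> perms3" for \<sigma> \<tau>
    using that by (intro sign_compose) (auto simp: perms3_def permutation_permutes)
  have "bij (inv \<delta>)" using p(4) by (auto simp: perms3_def permutes_bij bij_imp_bij_inv)
  then have "(\<Prod>e\<in>UNIV. sign (tri \<alpha>' \<beta>' \<gamma>' (inv \<delta> e))) = (\<Prod>d\<in>UNIV. sign (tri \<alpha>' \<beta>' \<gamma>' d))"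
    by (rule prod.reindex_bij_betw)
  then have "sign (tri \<alpha>' \<beta>' \<gamma>' (inv \<delta> 1)) * sign (tri \<alpha>' \<beta>' \<gamma>' (inv \<delta> 2)) * sign (tri \<alpha>' \<beta>' \<gamma>' (inv \<delta> 3)) = sign \<alpha>' * sign \<beta>' * sign \<gamma>'"
    by (simp add: prod_3)
  then show "gsign (gmul g h) = gsign g * gsign h"
    using p by (simp add: gsign_def gmul_def g h mult tri_in)
qed

text \<open>The flag \<open>s\<close> distinguishes the alternating (\<open>True\<close>) from the symmetric case (\<open>False\<close>), so that both are treated at once.\<close>

definition gsgn :: "bool \<Rightarrow> grp \<Rightarrow> int" where
  "gsgn s g = (if s then gsign g else 1)"

lemma gsgn_gmul: "g \<in> G \<Longrightarrow> h \<in> G \<Longrightarrow> gsgn s (gmul g h) = gsgn s g * gsgn s h"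
  by (simp add: gsgn_def gsign_gmul)

lemma gsgn_square: "gsgn s g * gsgn s g = 1"
proof -
  have "gsign g = 1 \<or> gsign g = - 1" by (cases g) (auto simp: gsign_def sign_def)
  then show ?thesis by (auto simp: gsgn_def)
qed

lemma bij_index_map:
  assumes "g \<in> G"
  shows "bij (index_map g)"
proof -
  obtain \<alpha> \<beta> \<gamma> \<delta> where g: "g = (\<alpha>, \<beta>, \<gamma>, \<delta>)" by (cases g)
  have bij: "bij \<alpha>" "bij \<beta>" "bij \<gamma>" "bij \<delta>" using assms by (auto simp: g G_def perms3_def permutes_bij)
  have "inj (index_map g)"
  proof (rule injI)
    fix s t assume "index_map g s = index_map g t"
    then have "tri \<alpha> \<beta> \<gamma> (\<delta> d) (coord s (\<delta> d)) = tri \<alpha> \<beta> \<gamma> (\<delta> d) (coord t (\<delta> d))" for d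
      by (simp flip: coord_index_map add: g)
    then have "tri \<alpha> \<beta> \<gamma> e (coord s e) = tri \<alpha> \<beta> \<gamma> e (coord t e)" for e
      using bij(4) by (metis bij_pointE)
    moreover have "inj (tri \<alpha> \<beta> \<gamma> e)" for e
      using exhaust_3[of e] bij by (auto simp: bij_is_inj)
    ultimately show "s = t" by (simp add: coord_inject inj_eq)
  qed
  then show ?thesis by (simp add: bij_def finite_UNIV_inj_surj)
qed

lemma gact_inject: "g \<in> G \<Longrightarrow> (gact g E = gact g E') = (E = E')"
proof
  assume "g \<in> G" and eq: "gact g E = gact g E'"
  have "E t = E' t" for t
  proof -
    obtain u where "t = index_map g u" using bij_index_map[OF \<open>g \<in> G\<close>] by (metis bij_pointE)
    then show ?thesis using fun_cong[OF eq, of u] by (simp add: gact_index_map)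
  qed
  then show "E = E'" by (rule ext)
qed simp

definition orb :: "arr \<Rightarrow> arr set" where
  "orb E = (\<lambda>g. gact g E) ` G"

definition stab :: "arr \<Rightarrow> grp set" where
  "stab E = {g \<in> G. gact g E = E}"

lemma fibre_gact:
  assumes "g \<in> G"
  shows "{h \<in> G. gact h E = gact g E} = gmul g ` stab E"
proof
  show "{h \<in> G. gact h E = gact g E} \<subseteq> gmul g ` stab E"
  proof
    fix h assume h: "h \<in> {h \<in> G. gact h E = gact g E}"
    moreover have "gmul g ` G = G" using bij_gmul[OF assms] by (simp add: bij_betw_def)
    ultimately obtain h' where "h' \<in> G" "h = gmul g h'" by blast
    then show "h \<in> gmul g ` stab E" using h assms by (auto simp: stab_def gact_gmul gact_inject)
  qed
qed (use assms in \<open>auto simp: stab_def gact_gmul gmul_in_G\<close>)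

lemma sum_gsgn_fibre:
  assumes "g \<in> G"
  shows "(\<Sum>h | h \<in> G \<and> gact h E = gact g E. gsgn s h) = gsgn s g * (\<Sum>h\<in>stab E. gsgn s h)"
proof -
  have "(\<Sum>h | h \<in> G \<and> gact h E = gact g E. gsgn s h) = (\<Sum>h\<in>stab E. gsgn s (gmul g h))"
    unfolding fibre_gact[OF assms] by (subst sum.reindex) (auto intro: inj_on_subset[OF inj_gmul[OF assms]])
  also have "\<dots> = (\<Sum>h\<in>stab E. gsgn s g * gsgn s h)"
    by (rule sum.cong) (auto simp: stab_def gsgn_gmul assms)
  finally show ?thesis by (simp add: sum_distrib_left)
qed

lemma card_orb: "card (orb E) * card (stab E) = 1296"
proof -
  have "card {h \<in> G. gact h E = E'} = card (stab E)" if "E' \<in> orb E" for E'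
  proof -
    from that obtain g where "g \<in> G" "E' = gact g E" by (auto simp: orb_def)
    then show ?thesis
      by (simp add: fibre_gact card_image inj_on_subset[OF inj_gmul])
  qed
  moreover have "(\<Sum>g\<in>G. 1 :: nat) = (\<Sum>E'\<in>orb E. \<Sum>g | g \<in> G \<and> gact g E = E'. 1)"
    unfolding orb_def by (rule sum.image_gen) simp
  ultimately show ?thesis by (simp add: card_G)
qed

lemma ex_inverse:
  assumes "g \<in> G"
  obtains h where "h \<in> G" "\<And>E. gact h (gact g E) = E"
proof -
  have "(id, id, id, id) \<in> G" by (simp add: G_def perms3_def permutes_id)
  moreover have "gmul g ` G = G" using bij_gmul[OF assms] by (simp add: bij_betw_def)
  ultimately have "(id, id, id, id) \<in> gmul g ` G" by (simp only:)
  then obtain h where h: "h \<in> G" "gmul g h = (id, id, id, id)" by (elim imageE) simp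
  have "gact (id, id, id, id) E = E" for E
    by (auto simp: gact_def slice_act_def dir_act_def coord_def)
  then have "gact g (gact h E) = E" for E using gact_gmul[OF assms, of h E] h by simp
  then have "gact h (gact g E) = E" for E using gact_inject[OF assms] by metis
  then show ?thesis using that h by blast
qed

lemma orb_gact: "g \<in> G \<Longrightarrow> orb (gact g E) = orb E"
proof -
  have sub: "orb (gact g E) \<subseteq> orb E" if "g \<in> G" for g E
    unfolding orb_def using that by (auto simp: gmul_in_G simp flip: gact_gmul)
  assume "g \<in> G"
  then obtain h where h: "h \<in> G" "\<And>E. gact h (gact g E) = E" using ex_inverse by blast
  show ?thesis using sub[OF \<open>g \<in> G\<close>, of E] sub[OF h(1), of "gact g E"] by (simp add: h(2))
qed

lemma orb_self: "E \<in> orb E"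
proof -
  have "(id, id, id, id) \<in> G" by (simp add: G_def perms3_def permutes_id)
  moreover have "gact (id, id, id, id) E = E"
    by (auto simp: gact_def slice_act_def dir_act_def coord_def)
  ultimately show ?thesis unfolding orb_def by (metis imageI)
qed

lemma orb_disjoint: "orb E \<noteq> orb E' \<Longrightarrow> orb E \<inter> orb E' = {}"
proof (rule ccontr)
  assume ne: "orb E \<noteq> orb E'" and "orb E \<inter> orb E' \<noteq> {}"
  then obtain F where "F \<in> orb E" "F \<in> orb E'" by blast
  then obtain g h where "g \<in> G" "F = gact g E" "h \<in> G" "F = gact h E'" by (force simp: orb_def)
  then have "orb F = orb E" "orb F = orb E'" by (simp add: orb_gact, metis orb_gact)
  then show False using ne by simp
qed

lemma finite_orb [simp]: "finite (orb E)" by (simp add: orb_def)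

text \<open>All arrays have finite support, so \<open>expo\<close> is a bijection between arrays and monomials.\<close>

definition expo :: "arr \<Rightarrow> (idx \<Rightarrow>\<^sub>0 nat)" where
  "expo E = Abs_poly_mapping E"

lemma lookup_expo [simp]: "Poly_Mapping.lookup (expo E) = E"
  by (simp add: expo_def)

lemma inj_expo: "inj expo"
  by (metis injI lookup_expo)

lemma expo_surj: "\<exists>E. m = expo E"
  by (metis lookup_expo poly_mapping_eqI)

lemma peval_mon [simp]: "peval x (mon E) = monom_val x E"
  by (simp add: mon_def peval_prod monom_val_def)

lemma mon_single: "mon E = Poly_Mapping.single (expo E) 1"
  by (rule poly_eqI_peval) (simp add: peval_single)

lemma mon_inject [simp]: "mon E = mon E' \<longleftrightarrow> E = E'"
  by (metis mon_single inj_expo injD keys_single one_neq_zero singleton_inject)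

lemma orbit_eq: "orbit E = mon ` orb E"
  by (auto simp: orbit_def orb_def)

lemma card_orbit: "card (orbit E) = card (orb E)"
  unfolding orbit_eq by (rule card_image) (simp add: inj_on_def)

lemma orbit_inject: "orbit E = orbit E' \<longleftrightarrow> orb E = orb E'"
  unfolding orbit_eq by (rule inj_image_eq_iff) (simp add: inj_def)

lemma lookup_pconst_mult:
  fixes p :: "'v::finite cpoly"
  shows "Poly_Mapping.lookup (pconst k * p) m = k * Poly_Mapping.lookup p m"
proof -
  have "pconst k * p = (\<Sum>m\<in>Poly_Mapping.keys p. Poly_Mapping.single m (k * Poly_Mapping.lookup p m))"
    by (rule poly_eqI_peval) (simp add: peval_sum peval_single peval_def[of _ p] sum_distrib_left mult.assoc)
  then show ?thesis by (simp add: lookup_sum lookup_single when_def in_keys_iff)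
qed

lemma of_int_pconst: "of_int c = pconst (of_int c)"
  by (simp add: pconst_def)

definition osum :: "bool \<Rightarrow> arr \<Rightarrow> cube_poly" where
  "osum s E = (if s then alt_orbit_sum E else sym_orbit_sum E)"

lemma osum_eq: "osum s E = pconst (of_nat (card (orb E)) / 1296) * (\<Sum>g\<in>G. of_int (gsgn s g) * mon (gact g E))"
  by (simp add: osum_def alt_orbit_sum_def sym_orbit_sum_def card_orbit card_G gsgn_def)

text \<open>Exactly the condition under which the alternating orbit sum does not cancel to zero.\<close>

definition even_stab :: "bool \<Rightarrow> arr \<Rightarrow> bool" where
  "even_stab s E \<longleftrightarrow> (\<forall>g\<in>stab E. gsgn s g = 1)"

lemma lookup_osum:
  "Poly_Mapping.lookup (osum s E) (expo E') =
    of_nat (card (orb E)) / 1296 * of_int (\<Sum>g | g \<in> G \<and> gact g E = E'. gsgn s g)"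
proof -
  have "Poly_Mapping.lookup (of_int c * mon F) (expo E') = (if F = E' then of_int c else 0)" for c F
    unfolding of_int_pconst lookup_pconst_mult mon_single lookup_single when_def
    using injD[OF inj_expo] by auto
  then show ?thesis
    by (simp add: osum_eq lookup_pconst_mult lookup_sum sum.inter_filter if_distrib[of complex_of_int] cong: if_cong)
qed

text \<open>The factor \<open>card (orb E) / 1296\<close> is the inverse of the order of the stabiliser, which is the number of group elements that
  contribute to one monomial.\<close>

lemma lookup_osum_orb:
  assumes "even_stab s E" "g \<in> G"
  shows "Poly_Mapping.lookup (osum s E) (expo (gact g E)) = of_int (gsgn s g)"
proof -
  have "(\<Sum>h\<in>stab E. gsgn s h) = int (card (stab E))" using assms(1) by (simp add: even_stab_def)
  moreover have "of_nat (card (orb E)) * of_nat (card (stab E)) = (1296 :: complex)"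
    unfolding of_nat_mult[symmetric] card_orb by simp
  ultimately show ?thesis
    by (simp add: lookup_osum sum_gsgn_fibre[OF assms(2)])
qed

lemma lookup_osum_not_orb: "E' \<notin> orb E \<Longrightarrow> Poly_Mapping.lookup (osum s E) (expo E') = 0"
proof -
  assume "E' \<notin> orb E"
  then have "{g. g \<in> G \<and> gact g E = E'} = {}" by (auto simp: orb_def)
  then show ?thesis unfolding lookup_osum by (simp only: sum.empty) simp
qed

lemma keys_osum:
  assumes "even_stab s E"
  shows "Poly_Mapping.keys (osum s E) = expo ` orb E"
proof
  show "expo ` orb E \<subseteq> Poly_Mapping.keys (osum s E)"
  proof
    fix m assume "m \<in> expo ` orb E"
    then obtain g where "g \<in> G" "m = expo (gact g E)" by (auto simp: orb_def)
    moreover have "gsgn s g \<noteq> 0" using gsgn_square[of s g] by auto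
    ultimately show "m \<in> Poly_Mapping.keys (osum s E)"
      using lookup_osum_orb[OF assms] by (simp add: in_keys_iff)
  qed
  show "Poly_Mapping.keys (osum s E) \<subseteq> expo ` orb E"
    using lookup_osum_not_orb expo_surj by (metis image_eqI in_keys_iff subsetI)
qed

definition family_sum :: "bool \<Rightarrow> (int \<times> arr) list \<Rightarrow> cube_poly" where
  "family_sum s L = (\<Sum>(c, E)\<leftarrow>L. of_int c * osum s E)"

definition good_family :: "bool \<Rightarrow> (int \<times> arr) list \<Rightarrow> bool" where
  "good_family s L \<longleftrightarrow> distinct (map (orb \<circ> snd) L) \<and> (\<forall>(c, E)\<in>set L. c \<noteq> 0 \<and> even_stab s E)"

lemma keys_add_disjoint:
  assumes "Poly_Mapping.keys p \<inter> Poly_Mapping.keys q = {}"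
  shows "Poly_Mapping.keys (p + q) = Poly_Mapping.keys p \<union> Poly_Mapping.keys q"
  using assms by (auto simp: in_keys_iff lookup_add) (metis add.left_neutral add.right_neutral disjoint_iff in_keys_iff)+

text \<open>Distinct orbits are disjoint, so no cancellation occurs between the summands and the terms can be counted
  orbit by orbit.\<close>

lemma keys_family_sum:
  assumes "good_family s L"
  shows "Poly_Mapping.keys (family_sum s L) = expo ` (\<Union>(c, E)\<in>set L. orb E)"
    and "num_terms (family_sum s L) = (\<Sum>(c, E)\<leftarrow>L. card (orb E))"
proof -
  have "Poly_Mapping.keys (family_sum s L) = expo ` (\<Union>(c, E)\<in>set L. orb E) \<and>
    num_terms (family_sum s L) = (\<Sum>(c, E)\<leftarrow>L. card (orb E))"
    using assms
  proof (induction L)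
    case (Cons a L)
    obtain c E where a: "a = (c, E)" by (cases a)
    have IH: "Poly_Mapping.keys (family_sum s L) = expo ` (\<Union>(c, E)\<in>set L. orb E)"
      "num_terms (family_sum s L) = (\<Sum>(c, E)\<leftarrow>L. card (orb E))"
      using Cons by (auto simp: good_family_def)
    have c: "c \<noteq> 0" and ev: "even_stab s E" using Cons.prems by (auto simp: good_family_def a)
    have "Poly_Mapping.keys (of_int c * osum s E) = expo ` orb E"
      unfolding keys_osum[OF ev, symmetric] of_int_pconst using c by (auto simp: in_keys_iff lookup_pconst_mult)
    moreover have "expo ` orb E \<inter> expo ` (\<Union>(c, E)\<in>set L. orb E) = {}"
    proof -
      have "orb E \<inter> orb E' = {}" if "(c', E') \<in> set L" for c' E'
      proof (rule orb_disjoint)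
        have "orb E \<notin> set (map (orb \<circ> snd) L)" using Cons.prems by (simp add: good_family_def a)
        moreover have "orb E' \<in> set (map (orb \<circ> snd) L)"
          unfolding set_map using imageI[OF that, of "orb \<circ> snd"] by simp
        ultimately show "orb E \<noteq> orb E'" by metis
      qed
      then have "orb E \<inter> (\<Union>(c, E)\<in>set L. orb E) = {}" by fast
      then show ?thesis using inj_expo by (metis image_Int image_empty)
    qed
    ultimately have k: "Poly_Mapping.keys (family_sum s (a # L)) = expo ` orb E \<union> expo ` (\<Union>(c, E)\<in>set L. orb E)"
      and dis: "expo ` orb E \<inter> Poly_Mapping.keys (family_sum s L) = {}"
      using keys_add_disjoint[of "of_int c * osum s E" "family_sum s L"] IH(1) by (simp_all add: family_sum_def a)
    have "num_terms (family_sum s (a # L)) = card (expo ` orb E) + num_terms (family_sum s L)"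
      unfolding num_terms_def k IH(1)[symmetric] by (intro card_Un_disjoint dis) auto
    also have "card (expo ` orb E) = card (orb E)"
      by (intro card_image inj_on_subset[OF inj_expo]) simp
    finally show ?case using IH(2) k by (auto simp: a)
  qed (simp_all add: family_sum_def num_terms_def)
  then show "Poly_Mapping.keys (family_sum s L) = expo ` (\<Union>(c, E)\<in>set L. orb E)"
    "num_terms (family_sum s L) = (\<Sum>(c, E)\<leftarrow>L. card (orb E))" by auto
qed

lemma family_sum_representatives:
  assumes "good_family s L"
  obtains R c where "R = snd ` set L" "card R = length L" "inj_on orbit R" "\<And>E. E \<in> R \<Longrightarrow> c E \<noteq> 0"
    "family_sum s L = (\<Sum>E\<in>R. pconst (of_int (c E)) * osum s E)" "\<And>a E. (a, E) \<in> set L \<Longrightarrow> c E = a"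
proof -
  have d: "distinct (map (orb \<circ> snd) L)" using assms by (simp add: good_family_def)
  then have dL: "distinct (map snd L)" "inj_on orb (snd ` set L)"
    by (auto simp: distinct_map inj_on_def)
  define c where "c E = the (map_of (map prod.swap L) E)" for E
  have c: "c E = a" if "(a, E) \<in> set L" for a E
  proof -
    have "map_of (map prod.swap L) E = Some a"
      using that dL(1) by (intro map_of_is_SomeI) (auto simp: comp_def)
    then show ?thesis by (simp add: c_def)
  qed
  have "family_sum s L = (\<Sum>E\<leftarrow>map snd L. pconst (of_int (c E)) * osum s E)"
    unfolding family_sum_def map_map by (intro arg_cong[where f = sum_list] map_cong) (auto simp: c of_int_pconst)
  also have "\<dots> = (\<Sum>E\<in>snd ` set L. pconst (of_int (c E)) * osum s E)"
    by (simp only: sum_list_distinct_conv_sum_set[OF dL(1)] set_map)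
  finally have "family_sum s L = (\<Sum>E\<in>snd ` set L. pconst (of_int (c E)) * osum s E)" .
  moreover have "card (snd ` set L) = length L" using distinct_card[OF dL(1)] by simp
  moreover have "inj_on orbit (snd ` set L)" using dL(2) by (auto simp: inj_on_def orbit_inject)
  moreover have "c E \<noteq> 0" if "E \<in> snd ` set L" for E using that c assms by (auto simp: good_family_def)
  ultimately show ?thesis using c that by blast
qed

definition slice_sum :: "arr \<Rightarrow> 3 \<Rightarrow> 3 \<Rightarrow> nat" where
  "slice_sum E d v = (\<Sum>t | coord t d = v. E t)"

definition margins :: "nat \<Rightarrow> arr \<Rightarrow> bool" where
  "margins n E \<longleftrightarrow> (\<forall>d v. slice_sum E d v = n)"

lemma sum_idx: "(\<Sum>t\<in>UNIV. F t) = (\<Sum>i\<in>UNIV. \<Sum>j\<in>UNIV. \<Sum>k\<in>UNIV. F (i, j, k :: 3))"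
  by (simp add: sum.cartesian_product)

lemma slice_sum_eqs:
  "slice_sum E 1 i = (\<Sum>j\<in>UNIV. \<Sum>k\<in>UNIV. E (i, j, k))"
  "slice_sum E 2 j = (\<Sum>i\<in>UNIV. \<Sum>k\<in>UNIV. E (i, j, k))"
  "slice_sum E 3 k = (\<Sum>i\<in>UNIV. \<Sum>j\<in>UNIV. E (i, j, k))"
proof -
  have "slice_sum E d v = (\<Sum>t\<in>UNIV. if coord t d = v then E t else 0)" for d v
    by (simp add: slice_sum_def sum.inter_filter flip: sum.inter_filter)
  then show "slice_sum E 1 i = (\<Sum>j\<in>UNIV. \<Sum>k\<in>UNIV. E (i, j, k))"
    "slice_sum E 2 j = (\<Sum>i\<in>UNIV. \<Sum>k\<in>UNIV. E (i, j, k))"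
    "slice_sum E 3 k = (\<Sum>i\<in>UNIV. \<Sum>j\<in>UNIV. E (i, j, k))"
    using exhaust_3[of i] exhaust_3[of j] exhaust_3[of k]
    by (auto simp: sum_idx coord_tri sum_3)
qed

lemma margins_gact:
  assumes "g \<in> G" "margins n E"
  shows "margins n (gact g E)"
  unfolding margins_def
proof (intro allI)
  fix e v
  obtain \<alpha> \<beta> \<gamma> \<delta> where g: "g = (\<alpha>, \<beta>, \<gamma>, \<delta>)" by (cases g)
  have bij: "bij \<alpha>" "bij \<beta>" "bij \<gamma>" "bij \<delta>" using assms by (auto simp: g G_def perms3_def permutes_bij)
  obtain d where d: "\<delta> d = e" using bij(4) by (metis bij_pointE)
  have inj: "inj (tri \<alpha> \<beta> \<gamma> e)" using exhaust_3[of e] bij by (auto simp: bij_is_inj)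
  have co: "coord (index_map g t) d = tri \<alpha> \<beta> \<gamma> e (coord t e)" for t by (simp add: g coord_index_map d)
  have bi: "bij (index_map g)" using assms(1) by (rule bij_index_map)
  have "bij_betw (index_map g) {t. coord t e = v} {s. coord s d = tri \<alpha> \<beta> \<gamma> e v}"
    unfolding bij_betw_def
  proof
    show "inj_on (index_map g) {t. coord t e = v}" using bi by (meson bij_is_inj inj_on_subset subset_UNIV)
    show "index_map g ` {t. coord t e = v} = {s. coord s d = tri \<alpha> \<beta> \<gamma> e v}"
    proof (intro equalityI subsetI)
      fix s assume "s \<in> {s. coord s d = tri \<alpha> \<beta> \<gamma> e v}"
      moreover obtain t where "s = index_map g t" using bi by (metis bij_pointE)
      ultimately show "s \<in> index_map g ` {t. coord t e = v}" using co inj by (auto simp: inj_eq)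
    qed (auto simp: co)
  qed
  then have "slice_sum (gact g E) e v = slice_sum E d (tri \<alpha> \<beta> \<gamma> e v)"
    unfolding slice_sum_def gact_index_map comp_def by (rule sum.reindex_bij_betw)
  then show "slice_sum (gact g E) e v = n" using assms(2) by (simp add: margins_def)
qed

lemma weight_zero_margins: "weight_zero E \<and> degree_arr E = 3 * n \<longleftrightarrow> margins n E"
proof -
  have deg: "degree_arr E = (\<Sum>v\<in>UNIV. slice_sum E d v)" for d
    using exhaust_3[of d] by (auto simp: degree_arr_def sum_idx slice_sum_eqs sum_3)
  have w: "weight_zero E \<longleftrightarrow> (\<forall>d v v'. slice_sum E d v = slice_sum E d v')"
    unfolding weight_zero_def by (subst forall_3) (simp only: slice_sum_eqs)
  show ?thesis
  proof
    assume *: "weight_zero E \<and> degree_arr E = 3 * n"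
    show "margins n E" unfolding margins_def
    proof (intro allI)
      fix d v
      have "slice_sum E d 1 = slice_sum E d v" "slice_sum E d 2 = slice_sum E d v" "slice_sum E d 3 = slice_sum E d v"
        using * w by blast+
      moreover have "3 * n = slice_sum E d 1 + slice_sum E d 2 + slice_sum E d 3"
        using * deg[of d] by (simp add: sum_3)
      ultimately show "slice_sum E d v = n" by linarith
    qed
  next
    assume "margins n E"
    then show "weight_zero E \<and> degree_arr E = 3 * n" using w deg[of 1] by (simp add: margins_def sum_3)
  qed
qed

lemma homogeneous_family_sum:
  assumes "good_family s L" "\<And>c E. (c, E) \<in> set L \<Longrightarrow> margins n E"
  shows "homogeneous (3 * n) (family_sum s L)"
  unfolding homogeneous_def keys_family_sum(1)[OF assms(1)]
proof
  fix m assume "m \<in> expo ` (\<Union>(c, E)\<in>set L. orb E)"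
  then obtain c E g where *: "(c, E) \<in> set L" "g \<in> G" "m = expo (gact g E)" by (auto simp: orb_def)
  then have "margins n (gact g E)" using assms(2) margins_gact by blast
  then have "degree_arr (gact g E) = 3 * n" using weight_zero_margins by blast
  moreover have "degree_arr (gact g E) = (\<Sum>v\<in>Poly_Mapping.keys m. Poly_Mapping.lookup m v)"
    unfolding degree_arr_def * by (rule sum.mono_neutral_cong_right) (auto simp: in_keys_iff)
  ultimately show "(\<Sum>v\<in>Poly_Mapping.keys m. Poly_Mapping.lookup m v) = 3 * n" by simp
qed

section \<open>Invariance\<close>

text \<open>Permuting the cells of the point is the same as permuting the arrays, by the inverse group element, which only
  affects the sign.\<close>

lemma peval_permuted:
  assumes g: "g \<in> G"
  shows "peval (x \<circ> index_map g) (family_sum s L) = of_int (gsgn s g) * peval x (family_sum s L)"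
proof -
  have mv: "monom_val (x \<circ> index_map g) (gact g E) = monom_val x E" for E
    unfolding monom_val_def gact_index_map comp_def
    by (rule prod.reindex_bij_betw[OF bij_index_map[OF g], of "\<lambda>t. x t ^ E t"])
  have "peval (x \<circ> index_map g) (osum s E) = of_int (gsgn s g) * peval x (osum s E)" for E
  proof -
    have "(\<Sum>h\<in>G. of_int (gsgn s h) * monom_val (x \<circ> index_map g) (gact h E)) =
        (\<Sum>h\<in>G. of_int (gsgn s (gmul g h)) * monom_val (x \<circ> index_map g) (gact (gmul g h) E) :: complex)"
      by (rule sum.reindex_bij_betw[OF bij_gmul[OF g], symmetric])
    also have "\<dots> = of_int (gsgn s g) * (\<Sum>h\<in>G. of_int (gsgn s h) * monom_val x (gact h E))"
      unfolding sum_distrib_left by (rule sum.cong) (simp_all add: gsgn_gmul g gact_gmul mv)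
    finally show ?thesis by (simp add: osum_eq peval_sum mult_ac)
  qed
  then show ?thesis
    by (induction L) (auto simp: family_sum_def distrib_left mult_ac)
qed

text \<open>Adding \<open>t\<close> times one slice in the first direction to another one: the action of an elementary matrix.\<close>

definition shear :: "complex \<Rightarrow> 3 \<Rightarrow> 3 \<Rightarrow> (idx \<Rightarrow> complex) \<Rightarrow> idx \<Rightarrow> complex" where
  "shear t p q x = (\<lambda>(i, j, k). x (i, j, k) + (if i = q then t * x (p, j, k) else 0))"

definition move :: "3 \<Rightarrow> 3 \<Rightarrow> arr \<Rightarrow> arr" where
  "move j k E = E((2, j, k) := E (2, j, k) - 1, (1, j, k) := E (1, j, k) + 1)"

text \<open>The derivative of the substitution \<open>shear t 1 2\<close> with respect to \<open>t\<close>, which is the action of a root vector of the Lie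
  algebra, in terms of exponent arrays: one factor \<open>x (2, j, k)\<close> is replaced by \<open>x (1, j, k)\<close>.\<close>

definition moves :: "(arr \<Rightarrow> complex) \<Rightarrow> arr \<Rightarrow> complex" where
  "moves \<phi> E = (\<Sum>j\<in>UNIV. \<Sum>k\<in>UNIV. of_nat (E (2, j, k)) * \<phi> (move j k E))"

lemma monom_val_shear:
  "\<exists>P. \<forall>t. monom_val (shear t 1 2 x) E = poly P t \<and> poly (pderiv P) t = moves (monom_val (shear t 1 2 x)) E"
proof -
  define b where "b v = (case v of (i, j, k) \<Rightarrow> if i = 2 then x (1, j, k) else 0)" for v :: idx
  define P where "P = (\<Prod>v\<in>UNIV. [:x v, b v:] ^ E v)"
  have y: "shear t 1 2 x v = poly [:x v, b v:] t" for t v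
    by (cases v) (simp add: shear_def b_def mult.commute)
  have 1: "monom_val (shear t 1 2 x) E = poly P t" for t
    unfolding P_def monom_val_def poly_prod poly_power y ..
  have 2: "poly (pderiv P) t = moves (monom_val (shear t 1 2 x)) E" for t
  proof -
    let ?y = "shear t 1 2 x"
    let ?term = "\<lambda>v. (\<Prod>w\<in>UNIV - {v}. ?y w ^ E w) * (of_nat (E v) * ?y v ^ (E v - 1) * b v)"
    have pd: "poly (pderiv ([:x v, b v:] ^ E v)) t = of_nat (E v) * ?y v ^ (E v - 1) * b v" for v
      unfolding pderiv_power y by (simp add: pderiv_pCons)
    have "poly (pderiv P) t = (\<Sum>v\<in>UNIV. ?term v)"
      unfolding P_def pderiv_prod poly_sum
      by (rule sum.cong[OF refl]) (simp only: poly_mult poly_prod poly_power pd y)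
    also have "\<dots> = (\<Sum>i\<in>UNIV. \<Sum>j\<in>UNIV. \<Sum>k\<in>UNIV. ?term (i, j, k))" by (rule sum_idx)
    also have "\<dots> = (\<Sum>j\<in>UNIV. \<Sum>k\<in>UNIV. ?term (2, j, k))"
      by (subst sum_3) (simp add: b_def)
    also have "\<dots> = moves (monom_val ?y) E"
      unfolding moves_def
    proof (intro sum.cong refl)
      fix j k
      let ?v = "(2, j, k) :: idx" and ?u = "(1, j, k) :: idx"
      have rest: "(\<Prod>w\<in>UNIV - {?v} - {?u}. ?y w ^ move j k E w) = (\<Prod>w\<in>UNIV - {?v} - {?u}. ?y w ^ E w)"
        by (rule prod.cong) (auto simp: move_def)
      have "monom_val ?y (move j k E) = ?y ?v ^ (E ?v - 1) * (?y ?u ^ (E ?u + 1) * (\<Prod>w\<in>UNIV - {?v} - {?u}. ?y w ^ E w))"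
        unfolding monom_val_def
        by (subst prod.remove[of _ ?v], simp, simp, subst prod.remove[of _ ?u], simp, simp)
          (simp only: rest, simp add: move_def)
      moreover have "(\<Prod>w\<in>UNIV - {?v}. ?y w ^ E w) = ?y ?u ^ E ?u * (\<Prod>w\<in>UNIV - {?v} - {?u}. ?y w ^ E w)"
        by (rule prod.remove) auto
      moreover have "b ?v = ?y ?u" by (simp add: b_def shear_def)
      ultimately show "?term ?v = of_nat (E ?v) * monom_val ?y (move j k E)"
        by (simp add: mult_ac)
    qed
    finally show ?thesis .
  qed
  show ?thesis using 1 2 by blast
qed

text \<open>The family sum is annihilated by the root vector, stated for an arbitrary function \<open>\<phi>\<close> on arrays instead of the
  monomials, so that it becomes a statement about finitely many integers.\<close>

definition annihilated :: "bool \<Rightarrow> (int \<times> arr) list \<Rightarrow> bool" where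
  "annihilated s L \<longleftrightarrow> (\<forall>\<phi>. (\<Sum>(c, E)\<leftarrow>L. of_int c * of_nat (card (orb E)) *
     (\<Sum>g\<in>G. of_int (gsgn s g) * moves \<phi> (gact g E))) = 0)"

lemma pderiv_setsum: "pderiv (\<Sum>i\<in>I. p i) = (\<Sum>i\<in>I. pderiv (p i))"
  by (induction I rule: infinite_finite_induct) (auto simp: pderiv_add)

text \<open>Along the one-parameter group the value is a polynomial in \<open>t\<close> whose derivative vanishes.\<close>

lemma shear_12_invariant:
  assumes "annihilated s L"
  shows "peval (shear t 1 2 x) (family_sum s L) = peval x (family_sum s L)"
proof -
  obtain P where P: "\<And>E t. monom_val (shear t 1 2 x) E = poly (P E) t"
    "\<And>E t. poly (pderiv (P E)) t = moves (monom_val (shear t 1 2 x)) E"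
    using monom_val_shear[of x] by metis
  define Q where "Q = (\<Sum>(c, E)\<leftarrow>L. smult (of_int c * of_nat (card (orb E)) / 1296) (\<Sum>g\<in>G. smult (of_int (gsgn s g)) (P (gact g E))))"
  have Q: "peval (shear t 1 2 x) (family_sum s L) = poly Q t" for t
    unfolding Q_def family_sum_def
    by (induction L) (auto simp: osum_eq peval_sum P(1) poly_sum)
  have "poly (pderiv Q) t = 0" for t
  proof -
    have "poly (pderiv Q) t = (1 / 1296) * (\<Sum>(c, E)\<leftarrow>L. of_int c * of_nat (card (orb E)) *
       (\<Sum>g\<in>G. of_int (gsgn s g) * moves (monom_val (shear t 1 2 x)) (gact g E)))"
      unfolding Q_def
      by (induction L) (auto simp: pderiv_add pderiv_smult pderiv_setsum poly_sum P(2) distrib_left)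
    then show ?thesis using assms by (simp add: annihilated_def)
  qed
  then have "pderiv Q = 0" using poly_all_0_iff_0 by blast
  then have "degree Q = 0" by (simp add: pderiv_eq_0_iff)
  then obtain k where "Q = [:k:]" by (rule degree_eq_zeroE)
  moreover have "shear 0 1 2 x = x" by (auto simp: shear_def)
  ultimately show ?thesis using Q[of t] Q[of 0] by simp
qed

text \<open>The symmetry under permutations of slices carries one elementary matrix to all the others; a sign change of
  the polynomial cancels.\<close>

lemma shear_invariant:
  assumes "annihilated s L" "p \<noteq> q"
  shows "peval (shear t p q x) (family_sum s L) = peval x (family_sum s L)"
proof -
  obtain \<alpha> where \<alpha>: "\<alpha> \<in> perms3" "\<alpha> 1 = p" "\<alpha> 2 = q"
  proof -
    have "\<exists>\<alpha>\<in>perms3. \<alpha> 1 = p \<and> \<alpha> 2 = q"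
      unfolding perms3_eq using exhaust_3[of p] exhaust_3[of q] assms(2) by auto
    then show ?thesis using that by blast
  qed
  then have inj: "\<alpha> i = \<alpha> i' \<longleftrightarrow> i = i'" for i i'
    by (auto simp: perms3_def dest: permutes_inj injD)
  define g :: grp where "g = (\<alpha>, id, id, id)"
  have g: "g \<in> G" using \<alpha> by (simp add: g_def G_def) (simp add: perms3_def permutes_id)
  have im: "index_map g (i, j, k) = (\<alpha> i, j, k)" for i j k
    by (simp add: g_def index_map_def coord_tri)
  have "shear t 1 2 (x \<circ> index_map g) = shear t p q x \<circ> index_map g"
    using \<alpha> inj[of _ 2] by (auto simp: shear_def fun_eq_iff im)
  then have "of_int (gsgn s g) * peval (shear t p q x) (family_sum s L) = of_int (gsgn s g) * peval x (family_sum s L)"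
    using shear_12_invariant[OF assms(1), of t "x \<circ> index_map g"] by (simp add: peval_permuted[OF g])
  moreover have "gsgn s g \<noteq> 0" using gsgn_square[of s g] by auto
  ultimately show ?thesis by simp
qed

definition unitm :: "complex^3^3" where "unitm = diagm (\<lambda>_. 1)"

lemma garr_1: "garr A unitm unitm x (i, j, k) = (\<Sum>p\<in>UNIV. A $ p $ i * x (p, j, k))"
  using exhaust_3[of j] exhaust_3[of k] by (elim disjE) (simp_all add: garr_def unitm_def diagm_def sum_3)

lemma garr_2: "garr unitm A unitm x (i, j, k) = (\<Sum>q\<in>UNIV. A $ q $ j * x (i, q, k))"
  using exhaust_3[of i] exhaust_3[of k] by (elim disjE) (simp_all add: garr_def unitm_def diagm_def sum_3)

lemma garr_3: "garr unitm unitm A x (i, j, k) = (\<Sum>r\<in>UNIV. A $ r $ k * x (i, j, r))"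
  using exhaust_3[of i] exhaust_3[of j] by (elim disjE) (simp_all add: garr_def unitm_def diagm_def sum_3)

lemma garr_split: "garr A B C x = garr A unitm unitm (garr unitm B unitm (garr unitm unitm C x))"
  by (auto simp: garr_def[of A B C] garr_1 garr_2 garr_3 fun_eq_iff sum_distrib_left mult_ac)

lemma garr_mult: "garr A unitm unitm (garr B unitm unitm x) = garr (B ** A) unitm unitm x"
  by (auto simp: garr_1 fun_eq_iff matrix_matrix_mult_def sum_distrib_left sum_distrib_right mult_ac intro: sum.swap)

definition transvection :: "complex \<Rightarrow> 3 \<Rightarrow> 3 \<Rightarrow> complex^3^3" where
  "transvection t p q = (\<chi> i j. (if i = j then 1 else 0) + (if i = p \<and> j = q then t else 0))"

lemma garr_transvection: "p \<noteq> q \<Longrightarrow> garr (transvection t p q) unitm unitm x = shear t p q x"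
  by (auto simp: fun_eq_iff garr_1 shear_def transvection_def distrib_right sum.distrib if_distrib[of "\<lambda>a. a * _"] cong: if_cong)

text \<open>Gaussian elimination without pivoting.\<close>

lemma LDU:
  fixes A :: "complex^3^3"
  assumes a: "A $ 1 $ 1 \<noteq> 0" and m: "A $ 1 $ 1 * A $ 2 $ 2 - A $ 1 $ 2 * A $ 2 $ 1 \<noteq> 0"
  obtains l1 l2 l3 s u1 u2 u3 where
    "A = transvection l1 2 1 ** (transvection l2 3 1 ** (transvection l3 3 2 **
       (diagm s ** (transvection u1 2 3 ** (transvection u2 1 3 ** transvection u3 1 2)))))"
proof -
  define a11 a12 a13 a21 a22 a23 a31 a32 a33 where "a11 = A $ 1 $ 1" and "a12 = A $ 1 $ 2" and "a13 = A $ 1 $ 3"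
    and "a21 = A $ 2 $ 1" and "a22 = A $ 2 $ 2" and "a23 = A $ 2 $ 3" and "a31 = A $ 3 $ 1" and "a32 = A $ 3 $ 2" and "a33 = A $ 3 $ 3"
  note defs = this
  define mm where "mm = a11 * a22 - a12 * a21"
  have nz: "a11 \<noteq> 0" "mm \<noteq> 0" using a m by (simp_all add: mm_def defs)
  define l1 l2 l3 u1 u2 u3 where "l1 = a21 / a11" and "l2 = a31 / a11" and "l3 = (a11 * a32 - a31 * a12) / mm"
    and "u1 = (a11 * a23 - a21 * a13) / mm" and "u2 = a13 / a11" and "u3 = a12 / a11"
  note lu = this
  define d3 where "d3 = a33 - l2 * a11 * u2 - l3 * (mm / a11) * u1"
  have e: "a11 * u3 = a12" "a11 * u2 = a13" "l1 * a11 = a21" "l2 * a11 = a31"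
    "a22 = a12 * l1 + mm / a11" "a23 = a13 * l1 + mm * u1 / a11"
    "a32 = a12 * l2 + l3 * mm / a11" "a33 = d3 + (a13 * l2 + l3 * (mm * u1) / a11)"
    using nz by (simp_all add: lu d3_def field_simps) (simp_all add: mm_def algebra_simps)
  have "A = transvection l1 2 1 ** (transvection l2 3 1 ** (transvection l3 3 2 **
       (diagm (tri a11 (mm / a11) d3) ** (transvection u1 2 3 ** (transvection u2 1 3 ** transvection u3 1 2)))))"
    unfolding vec_eq_iff forall_3 matrix_matrix_mult_def
    by (simp add: sum_3 transvection_def diagm_def) (simp add: e(1-4) flip: defs, simp add: e algebra_simps)
  then show ?thesis by (rule that)
qed


lemma det_transvection: "p \<noteq> q \<Longrightarrow> det (transvection t p q) = 1"
  using exhaust_3[of p] exhaust_3[of q] by (elim disjE) (simp_all add: det_3 transvection_def)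

text \<open>Elementary matrices act trivially and diagonal matrices through the power of the determinant given by the slice
  sums. The matrices with nonzero leading minors are dense, so the formula holds for all matrices.\<close>

lemma semi_invariant_1:
  assumes shear: "\<And>t p q x. p \<noteq> q \<Longrightarrow> peval (shear t p q x) f = peval x f"
    and margins: "\<And>m. m \<in> Poly_Mapping.keys f \<Longrightarrow> margins n (Poly_Mapping.lookup m)"
  shows "peval (garr A unitm unitm x) f = det A ^ n * peval x f"
proof -
  define P where "P A \<longleftrightarrow> (\<forall>x. peval (garr A unitm unitm x) f = det A ^ n * peval x f)" for A :: "complex^3^3"
  have mult: "P (A ** B)" if "P A" "P B" for A B
    using that unfolding P_def by (simp flip: garr_mult add: det_mul power_mult_distrib)
  have transv: "P (transvection t p q)" if "p \<noteq> q" for t p q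
    unfolding P_def using that by (simp add: garr_transvection shear det_transvection)
  have diag: "P (diagm s)" for s
    unfolding P_def
  proof
    fix x
    have "monom_val (garr (diagm s) unitm unitm x) (Poly_Mapping.lookup m) = det (diagm s) ^ n * monom_val x (Poly_Mapping.lookup m)"
      if "m \<in> Poly_Mapping.keys f" for m
    proof -
      let ?E = "Poly_Mapping.lookup m"
      have "garr (diagm s) unitm unitm x t = s (coord t 1) * x t" for t
        by (cases t) (simp add: garr_diagm unitm_def coord_tri)
      then have "monom_val (garr (diagm s) unitm unitm x) ?E = (\<Prod>t\<in>UNIV. s (coord t 1) ^ ?E t) * monom_val x ?E"
        by (simp add: monom_val_def power_mult_distrib prod.distrib)
      also have "(\<Prod>t\<in>UNIV. s (coord t 1) ^ ?E t) = (\<Prod>i\<in>UNIV. \<Prod>t | t \<in> UNIV \<and> coord t 1 = i. s (coord t 1) ^ ?E t)"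
        by (rule prod.group[symmetric]) auto
      also have "\<dots> = (\<Prod>i\<in>UNIV. s i ^ slice_sum ?E 1 i)"
        by (rule prod.cong) (auto simp: slice_sum_def power_sum)
      also have "\<dots> = det (diagm s) ^ n"
        using margins[OF that] by (simp add: margins_def det_diagm prod_3 power_mult_distrib)
      finally show ?thesis .
    qed
    then show "peval (garr (diagm s) unitm unitm x) f = det (diagm s) ^ n * peval x f"
      by (simp add: peval_def sum_distrib_left mult_ac)
  qed
  have gen: "P A" if nz: "A $ 1 $ 1 \<noteq> 0" "A $ 1 $ 1 * A $ 2 $ 2 - A $ 1 $ 2 * A $ 2 $ 1 \<noteq> 0" for A
  proof -
    obtain l1 l2 l3 s u1 u2 u3 where
      "A = transvection l1 2 1 ** (transvection l2 3 1 ** (transvection l3 3 2 **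
         (diagm s ** (transvection u1 2 3 ** (transvection u2 1 3 ** transvection u3 1 2)))))"
      by (rule LDU[OF nz])
    then show ?thesis by (simp only:) (intro mult transv diag; simp)
  qed
  define At where "At t = (\<chi> i j. A $ i $ j + (if i = j then t else 0))" for t :: complex
  obtain p where p: "\<And>t. peval (\<lambda>v. garr A unitm unitm x v + t * x v) f = poly p t"
    using peval_on_line[of "garr A unitm unitm x" x f] by blast
  define q where "q = [:A$1$1, 1:] * [:A$2$2, 1:] * [:A$3$3, 1:] + [:A$1$2 * A$2$3 * A$3$1:] + [:A$1$3 * A$2$1 * A$3$2:]
     - [:A$1$1, 1:] * [:A$2$3 * A$3$2:] - [:A$1$2 * A$2$1:] * [:A$3$3, 1:] - [:A$1$3 * A$3$1:] * [:A$2$2, 1:]"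
  have q: "det (At t) = poly q t" for t
    by (simp add: q_def det_3 At_def algebra_simps)
  define r where "r = [:A$1$1, 1:] * ([:A$1$1, 1:] * [:A$2$2, 1:] - [:A$1$2 * A$2$1:])"
  have r: "poly r t = At t $ 1 $ 1 * (At t $ 1 $ 1 * At t $ 2 $ 2 - At t $ 1 $ 2 * At t $ 2 $ 1)" for t
    by (simp add: r_def At_def algebra_simps)
  have "coeff r 3 = 1" by (simp add: r_def numeral_3_eq_3)
  then have "r \<noteq> 0" by auto
  have "poly (p - smult (peval x f) (q ^ n)) t * poly r t = 0" for t
  proof (cases "poly r t = 0")
    case False
    then have "P (At t)" by (intro gen) (auto simp: r)
    then have "peval (garr (At t) unitm unitm x) f = det (At t) ^ n * peval x f" by (simp add: P_def)
    moreover have "garr (At t) unitm unitm x = (\<lambda>v. garr A unitm unitm x v + t * x v)"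
      by (auto simp: fun_eq_iff garr_1 At_def distrib_right sum.distrib if_distrib[of "\<lambda>a. a * _"] cong: if_cong)
    ultimately have "poly p t = poly q t ^ n * peval x f" by (simp only: p q)
    then show ?thesis by simp
  qed simp
  then have "(p - smult (peval x f) (q ^ n)) * r = 0" by (metis poly_all_0_iff_0 poly_mult)
  then have "p = smult (peval x f) (q ^ n)" using \<open>r \<noteq> 0\<close> by simp
  moreover have "At 0 = A" by (simp add: At_def vec_eq_iff)
  ultimately show ?thesis using p[of 0] q[of 0] by simp
qed

text \<open>The symmetry under permutations of the three directions carries the result for the first factor to the
  other two.\<close>

theorem family_sum_invariant:
  assumes ann: "annihilated s L" and good: "good_family s L" and marg: "\<And>c E. (c, E) \<in> set L \<Longrightarrow> margins n E"
  shows "family_sum s L \<in> invariants"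
proof -
  let ?f = "family_sum s L"
  have m: "margins n (Poly_Mapping.lookup m)" if "m \<in> Poly_Mapping.keys ?f" for m
    using that marg margins_gact unfolding keys_family_sum(1)[OF good] orb_def by auto
  have 1: "peval (garr A unitm unitm x) ?f = det A ^ n * peval x ?f" for A x
    by (rule semi_invariant_1[OF shear_invariant[OF ann] m])
  have dir: "peval (h x) ?f = det A ^ n * peval x ?f"
    if g: "g \<in> G" and h: "h x \<circ> index_map g = garr A unitm unitm (x \<circ> index_map g)" for g h x and A :: "complex^3^3"
  proof -
    have "of_int (gsgn s g) * peval (h x) ?f = of_int (gsgn s g) * (det A ^ n * peval x ?f)"
      using 1[of A "x \<circ> index_map g"] unfolding h[symmetric] peval_permuted[OF g] by simp
    moreover have "gsgn s g \<noteq> 0" using gsgn_square[of s g] by auto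
    ultimately show ?thesis by simp
  qed
  have id: "id \<in> perms3" by (simp add: perms3_def permutes_id)
  have 2: "peval (garr unitm A unitm x) ?f = det A ^ n * peval x ?f" for A x
  proof (rule dir)
    have "tri 2 1 3 \<in> perms3" by (simp add: perms3_eq)
    then show "(id, id, id, tri 2 1 3) \<in> G" using id by (simp add: G_def)
    show "garr unitm A unitm x \<circ> index_map (id, id, id, tri 2 1 3) = garr A unitm unitm (x \<circ> index_map (id, id, id, tri 2 1 3))"
      by (auto simp: fun_eq_iff index_map_def coord_tri garr_1 garr_2)
  qed
  have 3: "peval (garr unitm unitm A x) ?f = det A ^ n * peval x ?f" for A x
  proof (rule dir)
    have "tri 3 2 1 \<in> perms3" by (simp add: perms3_eq)
    then show "(id, id, id, tri 3 2 1) \<in> G" using id by (simp add: G_def)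
    show "garr unitm unitm A x \<circ> index_map (id, id, id, tri 3 2 1) = garr A unitm unitm (x \<circ> index_map (id, id, id, tri 3 2 1))"
      by (auto simp: fun_eq_iff index_map_def coord_tri garr_1 garr_3)
  qed
  show ?thesis unfolding invariants_iff
  proof (intro allI impI)
    fix A B C :: "complex^3^3" and x assume "det A = 1 \<and> det B = 1 \<and> det C = 1"
    then show "peval (garr A B C x) ?f = peval x ?f"
      by (subst garr_split) (simp add: 1 2 3)
  qed
qed

section \<open>Arrays as data, and the verified computation\<close>

text \<open>To decide invariance, the arrays have to be computed with. All functions below are
  given by rewriting rules whose arguments are evaluated before the rule applies (no conditionals, no
  let), with digits in the form \<open>Suc (Suc 0)\<close>, so that the simplifier evaluates them by innermost rewriting. A
  \<open>cube\<close> lists the 27 entries of an array.\<close>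

datatype m9 = M nat nat nat nat nat nat nat nat nat

datatype cube = Cube m9 m9 m9

datatype perm3 = P123 | P132 | P213 | P231 | P312 | P321

primrec entry :: "m9 \<Rightarrow> 3 \<Rightarrow> 3 \<Rightarrow> nat" where
  "entry (M a b c d e f g h i) = (\<lambda>j k. tri (tri a b c k) (tri d e f k) (tri g h i k) j)"

definition mat_of :: "(3 \<Rightarrow> 3 \<Rightarrow> nat) \<Rightarrow> m9" where
  "mat_of f = M (f 1 1) (f 1 2) (f 1 3) (f 2 1) (f 2 2) (f 2 3) (f 3 1) (f 3 2) (f 3 3)"

primrec arr_of :: "cube \<Rightarrow> arr" where
  "arr_of (Cube X Y Z) = (\<lambda>(i, j, k). entry (tri X Y Z i) j k)"

definition cube_of :: "arr \<Rightarrow> cube" where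
  "cube_of E = Cube (mat_of (\<lambda>j k. E (1, j, k))) (mat_of (\<lambda>j k. E (2, j, k))) (mat_of (\<lambda>j k. E (3, j, k)))"

lemma entry_mat_of [simp]: "entry (mat_of f) = f"
  by (simp add: fun_eq_iff forall_3 mat_of_def)

lemma mat_of_entry [simp]: "mat_of (entry m) = m"
  by (cases m) (simp add: mat_of_def)

lemma arr_of_cube_of [simp]: "arr_of (cube_of E) = E"
  by (simp add: fun_eq_iff cube_of_def forall_3)

lemma cube_of_arr_of [simp]: "cube_of (arr_of q) = q"
  by (cases q) (simp add: cube_of_def eta_contract_eq)

primrec perm_fun :: "perm3 \<Rightarrow> 3 \<Rightarrow> 3" where
  "perm_fun P123 = tri 1 2 3" | "perm_fun P132 = tri 1 3 2" | "perm_fun P213 = tri 2 1 3"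
| "perm_fun P231 = tri 2 3 1" | "perm_fun P312 = tri 3 1 2" | "perm_fun P321 = tri 3 2 1"

primrec odd_perm :: "perm3 \<Rightarrow> bool" where
  "odd_perm P123 = False" | "odd_perm P132 = True" | "odd_perm P213 = True"
| "odd_perm P231 = False" | "odd_perm P312 = False" | "odd_perm P321 = True"

definition all_perms :: "perm3 list" where
  "all_perms = [P123, P132, P213, P231, P312, P321]"

lemma sum_perms3_list: "(\<Sum>\<sigma>\<in>perms3. F \<sigma>) = (\<Sum>p\<leftarrow>all_perms. F (perm_fun p))"
  by (simp add: sum_perms3 all_perms_def add.assoc)

lemma perm_fun_in [simp]: "perm_fun p \<in> perms3"
  by (cases p) (simp_all add: perms3_eq)

definition sval :: "bool \<Rightarrow> int" where "sval x = (if x then - 1 else 1)"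

lemma sign_perm_fun: "sign (perm_fun p) = sval (odd_perm p)"
  by (cases p) (simp_all add: sign_perms3 sval_def)

definition flip :: "bool \<Rightarrow> perm3 \<Rightarrow> bool \<Rightarrow> bool" where
  "flip s p x \<longleftrightarrow> x \<noteq> (s \<and> odd_perm p)"

lemma flip_code:
  "flip False p x = x" "flip True P123 x = x" "flip True P132 x = (\<not> x)" "flip True P213 x = (\<not> x)"
  "flip True P231 x = x" "flip True P312 x = x" "flip True P321 x = (\<not> x)"
  by (simp_all add: flip_def)

definition psgn :: "bool \<Rightarrow> (3 \<Rightarrow> 3) \<Rightarrow> int" where
  "psgn s \<sigma> = (if s then sign \<sigma> else 1)"

lemma sval_flip: "sval (flip s p x) = psgn s (perm_fun p) * sval x"
  by (auto simp: flip_def psgn_def sign_perm_fun sval_def)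

lemma sval_square: "sval x * sval x = 1" by (simp add: sval_def)

lemma gsgn_eq: "gsgn s (\<alpha>, \<beta>, \<gamma>, \<delta>) = psgn s \<alpha> * psgn s \<beta> * psgn s \<gamma> * psgn s \<delta>"
  by (simp add: gsgn_def gsign_def psgn_def)

definition rowm :: "perm3 \<Rightarrow> m9 \<Rightarrow> m9" where "rowm p m = mat_of (\<lambda>j k. entry m (perm_fun p j) k)"
definition colm :: "perm3 \<Rightarrow> m9 \<Rightarrow> m9" where "colm p m = mat_of (\<lambda>j k. entry m j (perm_fun p k))"

definition rowp :: "perm3 \<Rightarrow> cube \<Rightarrow> cube" where "rowp p q = cube_of (slice_act id (perm_fun p) id (arr_of q))"
definition colp :: "perm3 \<Rightarrow> cube \<Rightarrow> cube" where "colp p q = cube_of (slice_act id id (perm_fun p) (arr_of q))"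
definition slicep :: "perm3 \<Rightarrow> cube \<Rightarrow> cube" where "slicep p q = cube_of (slice_act (perm_fun p) id id (arr_of q))"
definition dirp :: "perm3 \<Rightarrow> cube \<Rightarrow> cube" where "dirp p q = cube_of (dir_act (perm_fun p) (arr_of q))"

lemma rowp_code: "rowp p (Cube X Y Z) = Cube (rowm p X) (rowm p Y) (rowm p Z)"
  by (simp add: rowp_def cube_of_def slice_act_def rowm_def)

lemma colp_code: "colp p (Cube X Y Z) = Cube (colm p X) (colm p Y) (colm p Z)"
  by (simp add: colp_def cube_of_def slice_act_def colm_def)

lemma rowm_code:
  "rowm P123 (M a b c d e f g h i) = M a b c d e f g h i"
  "rowm P132 (M a b c d e f g h i) = M a b c g h i d e f"
  "rowm P213 (M a b c d e f g h i) = M d e f a b c g h i"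
  "rowm P231 (M a b c d e f g h i) = M d e f g h i a b c"
  "rowm P312 (M a b c d e f g h i) = M g h i a b c d e f"
  "rowm P321 (M a b c d e f g h i) = M g h i d e f a b c"
  by (simp_all add: rowm_def mat_of_def)

lemma colm_code:
  "colm P123 (M a b c d e f g h i) = M a b c d e f g h i"
  "colm P132 (M a b c d e f g h i) = M a c b d f e g i h"
  "colm P213 (M a b c d e f g h i) = M b a c e d f h g i"
  "colm P231 (M a b c d e f g h i) = M b c a e f d h i g"
  "colm P312 (M a b c d e f g h i) = M c a b f d e i g h"
  "colm P321 (M a b c d e f g h i) = M c b a f e d i h g"
  by (simp_all add: colm_def mat_of_def)

lemma slicep_code:
  "slicep P123 (Cube X Y Z) = Cube X Y Z"
  "slicep P132 (Cube X Y Z) = Cube X Z Y"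
  "slicep P213 (Cube X Y Z) = Cube Y X Z"
  "slicep P231 (Cube X Y Z) = Cube Y Z X"
  "slicep P312 (Cube X Y Z) = Cube Z X Y"
  "slicep P321 (Cube X Y Z) = Cube Z Y X"
  by (simp_all add: slicep_def cube_of_def slice_act_def)

lemma dirp_code:
  "dirp P123 (Cube (M x0 x1 x2 x3 x4 x5 x6 x7 x8) (M y0 y1 y2 y3 y4 y5 y6 y7 y8) (M z0 z1 z2 z3 z4 z5 z6 z7 z8)) =
    Cube (M x0 x1 x2 x3 x4 x5 x6 x7 x8) (M y0 y1 y2 y3 y4 y5 y6 y7 y8) (M z0 z1 z2 z3 z4 z5 z6 z7 z8)"
  "dirp P132 (Cube (M x0 x1 x2 x3 x4 x5 x6 x7 x8) (M y0 y1 y2 y3 y4 y5 y6 y7 y8) (M z0 z1 z2 z3 z4 z5 z6 z7 z8)) =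
    Cube (M x0 x3 x6 x1 x4 x7 x2 x5 x8) (M y0 y3 y6 y1 y4 y7 y2 y5 y8) (M z0 z3 z6 z1 z4 z7 z2 z5 z8)"
  "dirp P213 (Cube (M x0 x1 x2 x3 x4 x5 x6 x7 x8) (M y0 y1 y2 y3 y4 y5 y6 y7 y8) (M z0 z1 z2 z3 z4 z5 z6 z7 z8)) =
    Cube (M x0 x1 x2 y0 y1 y2 z0 z1 z2) (M x3 x4 x5 y3 y4 y5 z3 z4 z5) (M x6 x7 x8 y6 y7 y8 z6 z7 z8)"
  "dirp P231 (Cube (M x0 x1 x2 x3 x4 x5 x6 x7 x8) (M y0 y1 y2 y3 y4 y5 y6 y7 y8) (M z0 z1 z2 z3 z4 z5 z6 z7 z8)) =
    Cube (M x0 x3 x6 y0 y3 y6 z0 z3 z6) (M x1 x4 x7 y1 y4 y7 z1 z4 z7) (M x2 x5 x8 y2 y5 y8 z2 z5 z8)"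
  "dirp P312 (Cube (M x0 x1 x2 x3 x4 x5 x6 x7 x8) (M y0 y1 y2 y3 y4 y5 y6 y7 y8) (M z0 z1 z2 z3 z4 z5 z6 z7 z8)) =
    Cube (M x0 y0 z0 x1 y1 z1 x2 y2 z2) (M x3 y3 z3 x4 y4 z4 x5 y5 z5) (M x6 y6 z6 x7 y7 z7 x8 y8 z8)"
  "dirp P321 (Cube (M x0 x1 x2 x3 x4 x5 x6 x7 x8) (M y0 y1 y2 y3 y4 y5 y6 y7 y8) (M z0 z1 z2 z3 z4 z5 z6 z7 z8)) =
    Cube (M x0 y0 z0 x3 y3 z3 x6 y6 z6) (M x1 y1 z1 x4 y4 z4 x7 y7 z7) (M x2 y2 z2 x5 y5 z5 x8 y8 z8)"
  by (simp_all add: dirp_def cube_of_def mat_of_def dir_act_def coord_tri)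

text \<open>Keys: the entries in a fixed order. The second slice comes first, because the entries of the first
  two slices are the ones that change under \<open>move\<close>.\<close>

primrec flat :: "cube \<Rightarrow> nat list" where
  "flat (Cube X Y Z) = (case X of M x0 x1 x2 x3 x4 x5 x6 x7 x8 \<Rightarrow> case Y of M y0 y1 y2 y3 y4 y5 y6 y7 y8 \<Rightarrow>
     case Z of M z0 z1 z2 z3 z4 z5 z6 z7 z8 \<Rightarrow>
     [y0, y1, y2, y3, y4, y5, y6, y7, y8, x0, x1, x2, x3, x4, x5, x6, x7, x8, z0, z1, z2, z3, z4, z5, z6, z7, z8])"

lemma flat_code:
  "flat (Cube (M x0 x1 x2 x3 x4 x5 x6 x7 x8) (M y0 y1 y2 y3 y4 y5 y6 y7 y8) (M z0 z1 z2 z3 z4 z5 z6 z7 z8)) =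
     [y0, y1, y2, y3, y4, y5, y6, y7, y8, x0, x1, x2, x3, x4, x5, x6, x7, x8, z0, z1, z2, z3, z4, z5, z6, z7, z8]"
  by simp

lemma flat_inject: "flat q = flat q' \<longleftrightarrow> q = q'"
  by (cases q; cases q') (auto split: m9.splits)

declare flat.simps [simp del]

primrec cols_list :: "bool \<Rightarrow> bool \<Rightarrow> perm3 list \<Rightarrow> cube \<Rightarrow> (bool \<times> nat list) list \<Rightarrow> (bool \<times> nat list) list" where
  "cols_list s x [] q rest = rest"
| "cols_list s x (p # ps) q rest = (flip s p x, flat (colp p q)) # cols_list s x ps q rest"

primrec rows_list :: "bool \<Rightarrow> bool \<Rightarrow> perm3 list \<Rightarrow> perm3 list \<Rightarrow> cube \<Rightarrow> (bool \<times> nat list) list \<Rightarrow> (bool \<times> nat list) list" where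
  "rows_list s x [] cs q rest = rest"
| "rows_list s x (p # ps) cs q rest = cols_list s (flip s p x) cs (rowp p q) (rows_list s x ps cs q rest)"

primrec slices_list :: "bool \<Rightarrow> bool \<Rightarrow> perm3 list \<Rightarrow> cube \<Rightarrow> (bool \<times> cube) list \<Rightarrow> (bool \<times> cube) list" where
  "slices_list s x [] q rest = rest"
| "slices_list s x (p # ps) q rest = (flip s p x, slicep p q) # slices_list s x ps q rest"

primrec dirs_list :: "bool \<Rightarrow> perm3 list \<Rightarrow> cube \<Rightarrow> (bool \<times> cube) list" where
  "dirs_list s [] q = []"
| "dirs_list s (p # ps) q = slices_list s (flip s p False) all_perms (dirp p q) (dirs_list s ps q)"

text \<open>The images under slice permutations in the first direction and permutations of directions, with signs. The
  permutations of rows and columns are split off since they commute with \<open>moves\<close>.\<close>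

definition views :: "bool \<Rightarrow> cube \<Rightarrow> (bool \<times> cube) list" where
  "views s q = dirs_list s all_perms q"

primrec images_list :: "bool \<Rightarrow> (bool \<times> cube) list \<Rightarrow> (bool \<times> nat list) list" where
  "images_list s [] = []"
| "images_list s (v # vs) = rows_list s (fst v) all_perms all_perms (snd v) (images_list s vs)"

lemma cols_list: "(\<Sum>(x, k)\<leftarrow>cols_list s x ps q rest. F x k) =
    (\<Sum>p\<leftarrow>ps. F (flip s p x) (flat (colp p q))) + (\<Sum>(x, k)\<leftarrow>rest. F x k :: complex)"
  by (induction ps) auto

lemma rows_list: "(\<Sum>(x, k)\<leftarrow>rows_list s x ps cs q rest. F x k) =
    (\<Sum>p\<leftarrow>ps. \<Sum>p'\<leftarrow>cs. F (flip s p' (flip s p x)) (flat (colp p' (rowp p q)))) + (\<Sum>(x, k)\<leftarrow>rest. F x k :: complex)"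
  by (induction ps) (auto simp: cols_list)

lemma slices_list: "(\<Sum>(x, k)\<leftarrow>slices_list s x ps q rest. F x k) =
    (\<Sum>p\<leftarrow>ps. F (flip s p x) (slicep p q)) + (\<Sum>(x, k)\<leftarrow>rest. F x k :: complex)"
  by (induction ps) auto

lemma dirs_list: "(\<Sum>(x, k)\<leftarrow>dirs_list s ps q. F x k) =
    (\<Sum>p\<leftarrow>ps. \<Sum>p'\<leftarrow>all_perms. F (flip s p' (flip s p False)) (slicep p' (dirp p q)) :: complex)"
  by (induction ps) (auto simp: slices_list)

lemma images_list: "(\<Sum>(x, k)\<leftarrow>images_list s vs. F x k) =
    (\<Sum>(x, q)\<leftarrow>vs. \<Sum>p\<leftarrow>all_perms. \<Sum>p'\<leftarrow>all_perms. F (flip s p' (flip s p x)) (flat (colp p' (rowp p q))) :: complex)"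
  by (induction vs) (auto simp: rows_list)

definition unflat :: "nat list \<Rightarrow> cube" where "unflat = inv flat"

lemma unflat_flat [simp]: "unflat (flat q) = q"
  unfolding unflat_def by (rule inv_f_f) (simp add: inj_def flat_inject)

lemma sum_G:
  fixes F :: "grp \<Rightarrow> complex"
  shows "(\<Sum>g\<in>G. F g) = (\<Sum>\<delta>\<in>perms3. \<Sum>\<alpha>\<in>perms3. \<Sum>\<beta>\<in>perms3. \<Sum>\<gamma>\<in>perms3. F (\<alpha>, \<beta>, \<gamma>, \<delta>))"
proof -
  have "(\<Sum>g\<in>G. F g) = (\<Sum>\<alpha>\<in>perms3. \<Sum>\<beta>\<in>perms3. \<Sum>\<gamma>\<in>perms3. \<Sum>\<delta>\<in>perms3. F (\<alpha>, \<beta>, \<gamma>, \<delta>))"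
    by (simp add: G_def sum.cartesian_product)
  also have "\<dots> = (\<Sum>\<alpha>\<in>perms3. \<Sum>\<beta>\<in>perms3. \<Sum>\<delta>\<in>perms3. \<Sum>\<gamma>\<in>perms3. F (\<alpha>, \<beta>, \<gamma>, \<delta>))"
    by (subst (3) sum.swap) (rule refl)
  also have "\<dots> = (\<Sum>\<alpha>\<in>perms3. \<Sum>\<delta>\<in>perms3. \<Sum>\<beta>\<in>perms3. \<Sum>\<gamma>\<in>perms3. F (\<alpha>, \<beta>, \<gamma>, \<delta>))"
    by (subst (2) sum.swap) (rule refl)
  also have "\<dots> = (\<Sum>\<delta>\<in>perms3. \<Sum>\<alpha>\<in>perms3. \<Sum>\<beta>\<in>perms3. \<Sum>\<gamma>\<in>perms3. F (\<alpha>, \<beta>, \<gamma>, \<delta>))"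
    by (rule sum.swap)
  finally show ?thesis .
qed

lemma sum_views:
  "(\<Sum>\<delta>\<in>perms3. \<Sum>\<alpha>\<in>perms3. F (psgn s \<alpha> * psgn s \<delta>) (slice_act \<alpha> id id (dir_act \<delta> (arr_of q)))) =
    (\<Sum>(x, q')\<leftarrow>views s q. F (sval x) (arr_of q') :: complex)"
  unfolding views_def dirs_list sum_perms3_list sval_flip
  by (simp add: slicep_def dirp_def sval_def)

lemma sum_images:
  "(\<Sum>g\<in>G. F (gsgn s g) (gact g (arr_of q))) = (\<Sum>(x, k)\<leftarrow>images_list s (views s q). F (sval x) (arr_of (unflat k)) :: complex)"
proof -
  have "gact (\<alpha>, \<beta>, \<gamma>, \<delta>) E = slice_act id id \<gamma> (slice_act id \<beta> id (slice_act \<alpha> id id (dir_act \<delta> E)))" for \<alpha> \<beta> \<gamma> \<delta> E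
    by (auto simp: gact_def slice_act_def)
  then have "(\<Sum>g\<in>G. F (gsgn s g) (gact g (arr_of q))) = (\<Sum>\<delta>\<in>perms3. \<Sum>\<alpha>\<in>perms3. (\<lambda>x E. \<Sum>\<beta>\<in>perms3. \<Sum>\<gamma>\<in>perms3.
      F (psgn s \<gamma> * (psgn s \<beta> * x)) (slice_act id id \<gamma> (slice_act id \<beta> id E))) (psgn s \<alpha> * psgn s \<delta>) (slice_act \<alpha> id id (dir_act \<delta> (arr_of q))))"
    unfolding sum_G gsgn_eq by (simp add: mult_ac)
  also have "\<dots> = (\<Sum>(x, q')\<leftarrow>views s q. \<Sum>\<beta>\<in>perms3. \<Sum>\<gamma>\<in>perms3.
      F (psgn s \<gamma> * (psgn s \<beta> * sval x)) (slice_act id id \<gamma> (slice_act id \<beta> id (arr_of q'))))"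
    by (rule sum_views)
  also have "\<dots> = (\<Sum>(x, k)\<leftarrow>images_list s (views s q). F (sval x) (arr_of (unflat k)))"
    unfolding images_list sum_perms3_list
    by (intro arg_cong[where f = sum_list] map_cong refl) (auto simp: sval_flip colp_def rowp_def)
  finally show ?thesis .
qed

subsection \<open>Maximal keys\<close>

datatype order = LT | EQ | GT

definition cmpn :: "nat \<Rightarrow> nat \<Rightarrow> order" where
  "cmpn m n = (if m < n then LT else if m = n then EQ else GT)"

lemma cmpn_code: "cmpn 0 0 = EQ" "cmpn 0 (Suc n) = LT" "cmpn (Suc m) 0 = GT" "cmpn (Suc m) (Suc n) = cmpn m n"
  by (simp_all add: cmpn_def)

definition cmpl :: "nat list \<Rightarrow> nat list \<Rightarrow> order" where
  "cmpl k l = (if k < l then LT else if k = l then EQ else GT)"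

primrec cmp_then :: "order \<Rightarrow> nat list \<Rightarrow> nat list \<Rightarrow> order" where
  "cmp_then LT k l = LT" | "cmp_then GT k l = GT" | "cmp_then EQ k l = cmpl k l"

lemma cmpl_cases: "k < l \<Longrightarrow> cmpl k l = LT" "k = l \<Longrightarrow> cmpl k l = EQ" "l < k \<Longrightarrow> cmpl k l = GT"
  by (auto simp: cmpl_def)

lemma cmpl_code: "cmpl [] [] = EQ" "cmpl (m # k) [] = GT" "cmpl (m # k) (n # l) = cmp_then (cmpn m n) k l"
  by (auto simp: cmpl_def cmpn_def)

text \<open>Running maximum of keys, together with the list of all labels that attain it.\<close>

datatype 'a best = Best "nat list" "'a list"

primrec best_upd :: "order \<Rightarrow> 'a \<Rightarrow> nat list \<Rightarrow> 'a list \<Rightarrow> nat list \<Rightarrow> 'a best" where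
  "best_upd LT a k as b = Best b as" | "best_upd GT a k as b = Best k [a]" | "best_upd EQ a k as b = Best b (a # as)"

primrec best_step :: "'a \<times> nat list \<Rightarrow> 'a best \<Rightarrow> 'a best" where
  "best_step ak (Best b as) = best_upd (cmpl (snd ak) b) (fst ak) (snd ak) as b"

lemma best_step_code: "best_step (a, k) (Best b as) = best_upd (cmpl k b) a k as b" by simp

declare best_step.simps [simp del]

primrec argmax :: "('a \<times> nat list) list \<Rightarrow> 'a best \<Rightarrow> 'a best" where
  "argmax [] st = st"
| "argmax (ak # aks) st = argmax aks (best_step ak st)"

lemma argmax_sound:
  assumes "argmax aks (Best b as) = Best b' as'"
  shows "\<forall>a\<in>set as'. (a, b') \<in> set aks \<or> (a \<in> set as \<and> b' = b)"
  using assms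
proof (induction aks arbitrary: b as)
  case (Cons ak aks)
  obtain a k where ak: "ak = (a, k)" by (cases ak)
  consider "k < b" | "k = b" | "b < k" by (rule linorder_cases)
  then show ?case
  proof cases
    case 1
    then have "argmax aks (Best b as) = Best b' as'" using Cons.prems by (simp add: ak best_step_code cmpl_cases)
    from Cons.IH[OF this] show ?thesis by (auto simp: ak)
  next
    case 2
    then have "argmax aks (Best b (a # as)) = Best b' as'" using Cons.prems by (simp add: ak best_step_code cmpl_cases)
    from Cons.IH[OF this] show ?thesis using 2 by (auto simp: ak)
  next
    case 3
    then have "argmax aks (Best k [a]) = Best b' as'" using Cons.prems by (simp add: ak best_step_code cmpl_cases)
    from Cons.IH[OF this] show ?thesis by (auto simp: ak)
  qed
qed simp

text \<open>With the empty list, which is below every key, as the starting value, the result is the maximal key and the labels of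
  all its occurrences.\<close>

lemma argmax_spec:
  assumes "argmax aks (Best b as) = Best b' as'"
  shows "b' = Max (insert b (snd ` set aks)) \<and>
    length as' = length (filter (\<lambda>ak. snd ak = b') aks) + (if b' = b then length as else 0) \<and>
    set as' = {a. (a, b') \<in> set aks} \<union> (if b' = b then set as else {})"
  using assms
proof (induction aks arbitrary: b as)
  case (Cons ak aks)
  obtain a k where ak: "ak = (a, k)" by (cases ak)
  have mx: "Max (insert b (snd ` set (ak # aks))) = Max (insert (max b k) (snd ` set aks))"
    by (cases "set aks = {}") (auto simp: ak max.assoc)
  have ge: "max b k \<le> Max (insert (max b k) (snd ` set aks))" by (rule Max_ge) auto
  consider "k < b" | "k = b" | "b < k" by (rule linorder_cases)
  then show ?case
  proof cases
    case 1
    then have m: "max b k = b" by simp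
    have "argmax aks (Best b as) = Best b' as'" using Cons.prems 1 by (simp add: ak best_step_code cmpl_cases)
    note IH = Cons.IH[OF this]
    have "b \<le> b'" using IH ge unfolding m by simp
    then have ne: "k \<noteq> b'" "b' \<noteq> k" using 1 by auto
    show ?thesis
    proof (intro conjI)
      show "b' = Max (insert b (snd ` set (ak # aks)))" using IH mx unfolding m by simp
      show "length as' = length (filter (\<lambda>ak. snd ak = b') (ak # aks)) + (if b' = b then length as else 0)"
        using IH ne by (cases "b' = b") (auto simp: ak)
      show "set as' = {a. (a, b') \<in> set (ak # aks)} \<union> (if b' = b then set as else {})"
        using IH ne by (cases "b' = b") (auto simp: ak)
    qed
  next
    case 2
    then have m: "max b k = b" by simp
    have "argmax aks (Best b (a # as)) = Best b' as'" using Cons.prems 2 by (simp add: ak best_step_code cmpl_cases)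
    note IH = Cons.IH[OF this]
    show ?thesis
    proof (intro conjI)
      show "b' = Max (insert b (snd ` set (ak # aks)))" using IH mx unfolding m by simp
      show "length as' = length (filter (\<lambda>ak. snd ak = b') (ak # aks)) + (if b' = b then length as else 0)"
        using IH 2 by (cases "b' = b") (simp_all add: ak)
      show "set as' = {a. (a, b') \<in> set (ak # aks)} \<union> (if b' = b then set as else {})"
        using IH 2 by (cases "b' = b") (simp_all add: ak, blast+)
    qed
  next
    case 3
    then have m: "max b k = k" by simp
    have "argmax aks (Best k [a]) = Best b' as'" using Cons.prems 3 by (simp add: ak best_step_code cmpl_cases)
    note IH = Cons.IH[OF this]
    have "k \<le> b'" using IH ge unfolding m by simp
    then have ne: "b \<noteq> b'" "b' \<noteq> b" using 3 by auto
    show ?thesis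
    proof (intro conjI)
      show "b' = Max (insert b (snd ` set (ak # aks)))" using IH mx unfolding m by simp
      show "length as' = length (filter (\<lambda>ak. snd ak = b') (ak # aks)) + (if b' = b then length as else 0)"
        using IH ne 3 by (cases "b' = k") (auto simp: ak)
      show "set as' = {a. (a, b') \<in> set (ak # aks)} \<union> (if b' = b then set as else {})"
        using IH ne 3 by (cases "b' = k") (auto simp: ak)
    qed
  qed
qed auto

lemma argmax_nonempty:
  assumes "argmax aks (Best b as) = Best b' as'" "as \<noteq> [] \<or> b = [] \<and> aks \<noteq> []"
  shows "as' \<noteq> []"
  using assms
proof (induction aks arbitrary: b as)
  case (Cons ak aks)
  obtain a k where ak: "ak = (a, k)" by (cases ak)
  consider "k < b" | "k = b" | "b < k" by (rule linorder_cases)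
  then show ?case
  proof cases
    case 1
    then have "argmax aks (Best b as) = Best b' as'" using Cons.prems by (simp add: ak best_step_code cmpl_cases)
    from Cons.IH[OF this] show ?thesis using 1 Cons.prems(2) by auto
  next
    case 2
    then have "argmax aks (Best b (a # as)) = Best b' as'" using Cons.prems by (simp add: ak best_step_code cmpl_cases)
    from Cons.IH[OF this] show ?thesis by simp
  next
    case 3
    then have "argmax aks (Best k [a]) = Best b' as'" using Cons.prems by (simp add: ak best_step_code cmpl_cases)
    from Cons.IH[OF this] show ?thesis by simp
  qed
qed simp

datatype parity = Plus | Minus | Mixed

primrec join :: "parity \<Rightarrow> bool \<Rightarrow> parity" where
  "join Plus x = (if x then Mixed else Plus)" | "join Minus x = (if x then Minus else Mixed)" | "join Mixed x = Mixed"

lemma join_code: "join Plus False = Plus" "join Plus True = Mixed" "join Minus True = Minus" "join Minus False = Mixed"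
  by simp_all

primrec parity_from :: "parity \<Rightarrow> bool list \<Rightarrow> parity" where
  "parity_from p [] = p" | "parity_from p (x # xs) = parity_from (join p x) xs"

primrec parity_of :: "bool list \<Rightarrow> parity" where
  "parity_of [] = Plus" | "parity_of (x # xs) = parity_from (join (if x then Minus else Plus) x) xs"

lemma parity_of_code: "parity_of (True # xs) = parity_from Minus xs" "parity_of (False # xs) = parity_from Plus xs"
  by simp_all

lemma parity_from_Mixed [simp]: "parity_from Mixed xs = Mixed" by (induction xs) auto

lemma parity_from_spec:
  "parity_from Plus xs = (if True \<in> set xs then Mixed else Plus)"
  "parity_from Minus xs = (if False \<in> set xs then Mixed else Minus)"
  by (induction xs) auto

lemma parity_of_spec:
  assumes "xs \<noteq> []"
  shows "parity_of xs = (if True \<notin> set xs then Plus else if False \<notin> set xs then Minus else Mixed)"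
  using assms by (cases xs) (auto simp: parity_from_spec)

subsection \<open>The moved arrays, modulo permutations of rows and columns\<close>

definition pred :: "nat \<Rightarrow> nat" where "pred n = n - 1"

lemma pred_code: "pred 0 = 0" "pred (Suc n) = n"
  by (simp_all add: pred_def)

primrec emit :: "nat \<Rightarrow> cube \<Rightarrow> (nat \<times> cube) list \<Rightarrow> (nat \<times> cube) list" where
  "emit 0 q rest = rest" | "emit (Suc n) q rest = (Suc n, q) # rest"

fun cells :: "cube \<Rightarrow> (nat \<times> cube) list" where
  "cells (Cube (M x0 x1 x2 x3 x4 x5 x6 x7 x8) (M y0 y1 y2 y3 y4 y5 y6 y7 y8) Z) =
   emit y0 (Cube (M (Suc x0) x1 x2 x3 x4 x5 x6 x7 x8) (M (pred y0) y1 y2 y3 y4 y5 y6 y7 y8) Z) (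
   emit y1 (Cube (M x0 (Suc x1) x2 x3 x4 x5 x6 x7 x8) (M y0 (pred y1) y2 y3 y4 y5 y6 y7 y8) Z) (
   emit y2 (Cube (M x0 x1 (Suc x2) x3 x4 x5 x6 x7 x8) (M y0 y1 (pred y2) y3 y4 y5 y6 y7 y8) Z) (
   emit y3 (Cube (M x0 x1 x2 (Suc x3) x4 x5 x6 x7 x8) (M y0 y1 y2 (pred y3) y4 y5 y6 y7 y8) Z) (
   emit y4 (Cube (M x0 x1 x2 x3 (Suc x4) x5 x6 x7 x8) (M y0 y1 y2 y3 (pred y4) y5 y6 y7 y8) Z) (
   emit y5 (Cube (M x0 x1 x2 x3 x4 (Suc x5) x6 x7 x8) (M y0 y1 y2 y3 y4 (pred y5) y6 y7 y8) Z) (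
   emit y6 (Cube (M x0 x1 x2 x3 x4 x5 (Suc x6) x7 x8) (M y0 y1 y2 y3 y4 y5 (pred y6) y7 y8) Z) (
   emit y7 (Cube (M x0 x1 x2 x3 x4 x5 x6 (Suc x7) x8) (M y0 y1 y2 y3 y4 y5 y6 (pred y7) y8) Z) (
   emit y8 (Cube (M x0 x1 x2 x3 x4 x5 x6 x7 (Suc x8)) (M y0 y1 y2 y3 y4 y5 y6 y7 (pred y8)) Z) ([])))))))))"

lemma emit_sum: "(\<Sum>(n, q)\<leftarrow>emit n q rest. of_nat n * F q) = of_nat n * F q + (\<Sum>(n, q)\<leftarrow>rest. of_nat n * F q :: complex)"
  by (cases n) auto

lemma cells_sum: "(\<Sum>(n, q')\<leftarrow>cells q. of_nat n * F (arr_of q')) = moves F (arr_of q)"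
proof -
  obtain X Y Z where q: "q = Cube X Y Z" by (cases q)
  obtain x0 x1 x2 x3 x4 x5 x6 x7 x8 where X: "X = M x0 x1 x2 x3 x4 x5 x6 x7 x8" by (cases X)
  obtain y0 y1 y2 y3 y4 y5 y6 y7 y8 where Y: "Y = M y0 y1 y2 y3 y4 y5 y6 y7 y8" by (cases Y)
  have mv: "move j k (arr_of (Cube X Y Z)) = arr_of (Cube (mat_of ((entry X)(j := (entry X j)(k := entry X j k + 1))))
     (mat_of ((entry Y)(j := (entry Y j)(k := entry Y j k - 1)))) Z)" for j k
    by (auto simp: fun_eq_iff move_def tri_def)
  show ?thesis
    unfolding q moves_def mv
    by (simp add: X Y emit_sum sum_3 mat_of_def pred_def add.assoc)
qed

definition sigs :: "nat \<Rightarrow> nat \<Rightarrow> nat \<Rightarrow> nat \<Rightarrow> nat \<Rightarrow> nat \<Rightarrow> (perm3 \<times> nat list) list" where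
  "sigs a b c d e f = [(P123, [a, b, c, d, e, f]), (P132, [a, b, e, f, c, d]), (P213, [c, d, a, b, e, f]),
     (P231, [c, d, e, f, a, b]), (P312, [e, f, a, b, c, d]), (P321, [e, f, c, d, a, b])]"

fun row_sigs :: "cube \<Rightarrow> (perm3 \<times> nat list) list" where
  "row_sigs (Cube (M x0 x1 x2 x3 x4 x5 x6 x7 x8) (M y0 y1 y2 y3 y4 y5 y6 y7 y8) Z) =
     sigs (y0 + y1 + y2) (x0 + x1 + x2) (y3 + y4 + y5) (x3 + x4 + x5) (y6 + y7 + y8) (x6 + x7 + x8)"

fun col_sigs :: "cube \<Rightarrow> (perm3 \<times> nat list) list" where
  "col_sigs (Cube (M x0 x1 x2 x3 x4 x5 x6 x7 x8) (M y0 y1 y2 y3 y4 y5 y6 y7 y8) Z) =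
     sigs (y0 + y3 + y6) (x0 + x3 + x6) (y1 + y4 + y7) (x1 + x4 + x7) (y2 + y5 + y8) (x2 + x5 + x8)"

primrec args :: "'a best \<Rightarrow> 'a list" where "args (Best b as) = as"

text \<open>A canonical form modulo permutations of rows and columns. Only those permutations are tried that sort the
  row sums and the column sums of the first two slices, which leaves few candidates. Any
  representative of the class is sound; a consistent choice makes the cancellation visible.\<close>

definition canon :: "bool \<Rightarrow> bool \<Rightarrow> cube \<Rightarrow> bool best" where
  "canon s x q = argmax (rows_list s x (args (argmax (row_sigs q) (Best [] []))) (args (argmax (col_sigs q) (Best [] []))) q [])
     (Best [] [])"

lemma args_nonempty: "args (argmax (row_sigs q) (Best [] [])) \<noteq> []" "args (argmax (col_sigs q) (Best [] [])) \<noteq> []"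
proof -
  have "args (argmax ks (Best [] [])) \<noteq> []" if "ks \<noteq> []" for ks :: "(perm3 \<times> nat list) list"
  proof -
    obtain b as where *: "argmax ks (Best [] []) = Best b as" by (cases "argmax ks (Best [] [])")
    then show ?thesis using argmax_nonempty[OF *] that by simp
  qed
  moreover have "row_sigs q \<noteq> []" "col_sigs q \<noteq> []"
    by (cases q rule: row_sigs.cases, simp add: sigs_def, cases q rule: col_sigs.cases, simp add: sigs_def)
  ultimately show "args (argmax (row_sigs q) (Best [] [])) \<noteq> []" "args (argmax (col_sigs q) (Best [] [])) \<noteq> []" by auto
qed

definition equivariant :: "bool \<Rightarrow> (cube \<Rightarrow> complex) \<Rightarrow> bool" where
  "equivariant s \<psi> \<longleftrightarrow> (\<forall>r c q. \<psi> (colp c (rowp r q)) = of_int (psgn s (perm_fun r)) * of_int (psgn s (perm_fun c)) * \<psi> q)"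

lemma in_cols_list: "(x', k) \<in> set (cols_list s x cs q rest) \<Longrightarrow>
    (\<exists>c. x' = flip s c x \<and> k = flat (colp c q)) \<or> (x', k) \<in> set rest"
  by (induction cs) auto

lemma in_rows_list: "(x', k) \<in> set (rows_list s x rs cs q rest) \<Longrightarrow>
    (\<exists>r c. x' = flip s c (flip s r x) \<and> k = flat (colp c (rowp r q))) \<or> (x', k) \<in> set rest"
proof (induction rs)
  case (Cons r rs)
  then show ?case
    using in_cols_list[of x' k s "flip s r x" cs "rowp r q" "rows_list s x rs cs q rest"] by auto
qed simp

lemma psgn_square: "psgn s (perm_fun p) * psgn s (perm_fun p) = 1"
  by (simp add: psgn_def sign_perm_fun sval_square)

text \<open>An equivariant function takes the value at \<open>q\<close>, up to the recorded sign, at the representative. Labels of both signs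
  mean that the function vanishes there.\<close>

lemma canon_sound:
  assumes \<psi>: "equivariant s \<psi>" and c: "canon s x q = Best b xs"
  shows "xs \<noteq> []" "x' \<in> set xs \<Longrightarrow> of_int (sval x') * \<psi> (unflat b) = of_int (sval x) * \<psi> q"
proof -
  let ?R = "args (argmax (row_sigs q) (Best [] []))" and ?C = "args (argmax (col_sigs q) (Best [] []))"
  have "rows_list s x ?R ?C q [] \<noteq> []"
    using args_nonempty[of q] by (cases ?R; cases ?C) auto
  then show "xs \<noteq> []" using argmax_nonempty[OF c[unfolded canon_def]] by simp
  assume "x' \<in> set xs"
  then have "(x', b) \<in> set (rows_list s x ?R ?C q [])" using argmax_sound[OF c[unfolded canon_def]] by auto
  from in_rows_list[OF this] obtain r c where "x' = flip s c (flip s r x)" "b = flat (colp c (rowp r q))" by auto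
  then have "of_int (sval x') * \<psi> (unflat b) =
      of_int ((psgn s (perm_fun c) * psgn s (perm_fun c)) * (psgn s (perm_fun r) * psgn s (perm_fun r)) * sval x) * \<psi> q"
    using \<psi> by (simp add: equivariant_def sval_flip mult_ac)
  then show "of_int (sval x') * \<psi> (unflat b) = of_int (sval x) * \<psi> q" by (simp add: psgn_square)
qed

text \<open>A finite integer combination of keys, indexed by keys in unary notation: the left branch continues with the
  next entry, the right branch increments the current one.\<close>

datatype trie = Empty | Node int trie trie

fun insert_key :: "nat list \<Rightarrow> int \<Rightarrow> trie \<Rightarrow> trie" where
  "insert_key [] w Empty = Node w Empty Empty"
| "insert_key [] w (Node v t u) = Node (v + w) t u"
| "insert_key (0 # k) w Empty = Node 0 (insert_key k w Empty) Empty"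
| "insert_key (0 # k) w (Node v t u) = Node v (insert_key k w t) u"
| "insert_key (Suc n # k) w Empty = Node 0 Empty (insert_key (n # k) w Empty)"
| "insert_key (Suc n # k) w (Node v t u) = Node v t (insert_key (n # k) w u)"

primrec inc_head :: "nat list \<Rightarrow> nat list" where
  "inc_head [] = []" | "inc_head (n # k) = Suc n # k"

primrec trie_sum :: "trie \<Rightarrow> (nat list \<Rightarrow> complex) \<Rightarrow> complex" where
  "trie_sum Empty = (\<lambda>\<phi>. 0)"
| "trie_sum (Node v t u) = (\<lambda>\<phi>. of_int v * \<phi> [] + trie_sum t (\<lambda>k. \<phi> (0 # k)) + trie_sum u (\<lambda>k. \<phi> (inc_head k)))"

lemma trie_sum_insert: "trie_sum (insert_key k w t) \<phi> = trie_sum t \<phi> + of_int w * \<phi> k"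
  by (induction k w t arbitrary: \<phi> rule: insert_key.induct) (simp_all add: algebra_simps)

primrec all_zero :: "trie \<Rightarrow> bool" where
  "all_zero Empty = True" | "all_zero (Node v t u) = (v = 0 \<and> all_zero t \<and> all_zero u)"

lemma trie_sum_all_zero: "all_zero t \<Longrightarrow> trie_sum t \<phi> = 0"
  by (induction t arbitrary: \<phi>) auto

primrec put_parity :: "parity \<Rightarrow> int \<Rightarrow> nat list \<Rightarrow> trie \<Rightarrow> trie" where
  "put_parity Plus w b t = insert_key b w t" | "put_parity Minus w b t = insert_key b (- w) t" | "put_parity Mixed w b t = t"

primrec put :: "bool best \<Rightarrow> int \<Rightarrow> trie \<Rightarrow> trie" where
  "put (Best b xs) w t = put_parity (parity_of xs) w b t"

lemma trie_sum_put:
  assumes "equivariant s \<psi>"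
  shows "trie_sum (put (canon s x q) w t) (\<psi> \<circ> unflat) = trie_sum t (\<psi> \<circ> unflat) + of_int w * (of_int (sval x) * \<psi> q)"
proof -
  obtain b xs where c: "canon s x q = Best b xs" by (cases "canon s x q")
  note ne = canon_sound(1)[OF assms c] and val = canon_sound(2)[OF assms c]
  show ?thesis
  proof (cases "parity_of xs")
    case Plus
    then have "True \<notin> set xs" using parity_of_spec[OF ne] by (simp split: if_splits)
    moreover obtain y where "y \<in> set xs" using ne by (cases xs) auto
    ultimately have "False \<in> set xs" by (cases y) auto
    from val[OF this] show ?thesis by (simp add: c Plus trie_sum_insert sval_def)
  next
    case Minus
    then have "False \<notin> set xs" using parity_of_spec[OF ne] by (simp split: if_splits)
    moreover obtain y where "y \<in> set xs" using ne by (cases xs) auto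
    ultimately have "True \<in> set xs" by (cases y) auto
    from val[OF this] have "- \<psi> (unflat b) = of_int (sval x) * \<psi> q" by (simp add: sval_def[of True])
    then have "\<psi> (unflat b) = - (of_int (sval x) * \<psi> q)" by (metis minus_minus)
    then show ?thesis by (simp add: c Minus trie_sum_insert)
  next
    case Mixed
    then have "True \<in> set xs" "False \<in> set xs" using parity_of_spec[OF ne] by (simp_all split: if_splits)
    from val[OF this(1)] val[OF this(2)] show ?thesis by (simp add: c Mixed sval_def split: if_splits)
  qed
qed

definition times :: "nat \<Rightarrow> int \<Rightarrow> int" where "times n w = int n * w"

lemma times_code: "times (Suc 0) w = w" "times (Suc (Suc n)) w = w + times (Suc n) w"
  by (simp_all add: times_def algebra_simps)

primrec put_cells :: "bool \<Rightarrow> bool \<Rightarrow> int \<Rightarrow> (nat \<times> cube) list \<Rightarrow> trie \<Rightarrow> trie" where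
  "put_cells s x w [] t = t"
| "put_cells s x w (c # cs) t = put_cells s x w cs (put (canon s x (snd c)) (times (fst c) w) t)"

primrec put_views :: "bool \<Rightarrow> int \<Rightarrow> (bool \<times> cube) list \<Rightarrow> trie \<Rightarrow> trie" where
  "put_views s w [] t = t"
| "put_views s w (v # vs) t = put_views s w vs (put_cells s (fst v) w (cells (snd v)) t)"

lemma trie_sum_put_cells:
  assumes "equivariant s \<psi>"
  shows "trie_sum (put_cells s x w cs t) (\<psi> \<circ> unflat) =
    trie_sum t (\<psi> \<circ> unflat) + of_int w * (of_int (sval x) * (\<Sum>(n, q)\<leftarrow>cs. of_nat n * \<psi> q))"
  by (induction cs arbitrary: t) (auto simp: trie_sum_put[OF assms] times_def algebra_simps)

lemma trie_sum_put_views: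
  assumes "equivariant s \<psi>"
  shows "trie_sum (put_views s w vs t) (\<psi> \<circ> unflat) =
    trie_sum t (\<psi> \<circ> unflat) + of_int w * (\<Sum>(x, q)\<leftarrow>vs. of_int (sval x) * moves (\<psi> \<circ> cube_of) (arr_of q))"
proof -
  have m: "(\<Sum>(n, q')\<leftarrow>cells q. of_nat n * \<psi> q') = moves (\<psi> \<circ> cube_of) (arr_of q)" for q
    using cells_sum[where F = "\<psi> \<circ> cube_of" and q = q] by simp
  show ?thesis
    by (induction vs arbitrary: t) (auto simp: trie_sum_put_cells[OF assms] m algebra_simps)
qed

subsection \<open>Averaging over rows and columns\<close>

lemma psgn_comp: "\<sigma> \<in> perms3 \<Longrightarrow> \<tau> \<in> perms3 \<Longrightarrow> psgn s (\<sigma> \<circ> \<tau>) = psgn s \<sigma> * psgn s \<tau>"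
  by (simp add: psgn_def sign_compose perms3_def permutation_permutes) (metis finite permutation_permutes sign_compose)

lemma sum_perms3_comp:
  assumes "\<sigma> \<in> perms3"
  shows "(\<Sum>\<tau>\<in>perms3. F (\<sigma> \<circ> \<tau>)) = (\<Sum>\<tau>\<in>perms3. F \<tau>)"
proof -
  have inj: "inj_on ((\<circ>) \<sigma>) perms3"
    using assms by (intro inj_onI) (auto simp: perms3_def fun_eq_iff dest: permutes_inj injD)
  moreover have "(\<circ>) \<sigma> ` perms3 \<subseteq> perms3"
    using assms by (auto simp: perms3_def permutes_compose)
  ultimately have "bij_betw ((\<circ>) \<sigma>) perms3 perms3"
    by (simp add: bij_betw_def endo_inj_surj)
  then show ?thesis by (rule sum.reindex_bij_betw)
qed

text \<open>The signed sum over permutations of rows and columns, an equivariant function of the array.\<close>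

definition rc_sum :: "bool \<Rightarrow> (arr \<Rightarrow> complex) \<Rightarrow> arr \<Rightarrow> complex" where
  "rc_sum s \<phi> E = (\<Sum>\<beta>\<in>perms3. \<Sum>\<gamma>\<in>perms3. of_int (psgn s \<beta>) * of_int (psgn s \<gamma>) * \<phi> (slice_act id \<beta> \<gamma> E))"

lemma rc_sum_equivariant: "equivariant s (\<lambda>q. rc_sum s \<phi> (arr_of q))"
  unfolding equivariant_def
proof (intro allI)
  fix r c q
  let ?r = "perm_fun r" and ?c = "perm_fun c"
  define H where "H \<beta> \<gamma> = of_int (psgn s \<beta>) * of_int (psgn s \<gamma>) * \<phi> (slice_act id \<beta> \<gamma> (arr_of q))" for \<beta> \<gamma>
  have sq: "of_int (psgn s (perm_fun p)) * (of_int (psgn s (perm_fun p)) * z) = z" for p and z :: complex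
    using psgn_square[of s p] by (metis mult.assoc mult_1_left of_int_1 of_int_mult)
  have "slice_act id \<beta> \<gamma> (arr_of (colp c (rowp r q))) = slice_act id (?r \<circ> \<beta>) (?c \<circ> \<gamma>) (arr_of q)" for \<beta> \<gamma>
    by (auto simp: colp_def rowp_def slice_act_def)
  then have "rc_sum s \<phi> (arr_of (colp c (rowp r q))) =
      (\<Sum>\<beta>\<in>perms3. \<Sum>\<gamma>\<in>perms3. of_int (psgn s ?r) * of_int (psgn s ?c) * H (?r \<circ> \<beta>) (?c \<circ> \<gamma>))"
    unfolding rc_sum_def H_def by (intro sum.cong refl) (simp add: psgn_comp mult_ac sq)
  also have "\<dots> = of_int (psgn s ?r) * of_int (psgn s ?c) * (\<Sum>\<beta>\<in>perms3. \<Sum>\<gamma>\<in>perms3. H (?r \<circ> \<beta>) (?c \<circ> \<gamma>))"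
    by (simp add: sum_distrib_left)
  also have "(\<Sum>\<beta>\<in>perms3. \<Sum>\<gamma>\<in>perms3. H (?r \<circ> \<beta>) (?c \<circ> \<gamma>)) = (\<Sum>\<beta>\<in>perms3. \<Sum>\<gamma>\<in>perms3. H \<beta> \<gamma>)"
    by (subst sum_perms3_comp[OF perm_fun_in, of "\<lambda>\<gamma>. H _ \<gamma>"]) (rule sum_perms3_comp[OF perm_fun_in, of "\<lambda>\<beta>. \<Sum>\<gamma>\<in>perms3. H \<beta> \<gamma>"])
  finally show "rc_sum s \<phi> (arr_of (colp c (rowp r q))) = of_int (psgn s ?r) * of_int (psgn s ?c) * rc_sum s \<phi> (arr_of q)"
    by (simp add: H_def rc_sum_def)
qed

lemma moves_slice_act:
  assumes "\<beta> \<in> perms3" "\<gamma> \<in> perms3"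
  shows "moves \<phi> (slice_act id \<beta> \<gamma> E) = moves (\<lambda>F. \<phi> (slice_act id \<beta> \<gamma> F)) E"
proof -
  have bij: "bij \<beta>" "bij \<gamma>" using assms by (simp_all add: perms3_def permutes_bij)
  have mv: "move j k (slice_act id \<beta> \<gamma> E) = slice_act id \<beta> \<gamma> (move (\<beta> j) (\<gamma> k) E)" for j k
    using bij by (auto simp: move_def slice_act_def fun_eq_iff bij_is_inj inj_eq)
  have "moves \<phi> (slice_act id \<beta> \<gamma> E) = (\<Sum>j\<in>UNIV. \<Sum>k\<in>UNIV. of_nat (E (2, \<beta> j, \<gamma> k)) * \<phi> (slice_act id \<beta> \<gamma> (move (\<beta> j) (\<gamma> k) E)))"
    unfolding moves_def mv by (simp add: slice_act_def)
  also have "\<dots> = (\<Sum>j\<in>UNIV. \<Sum>k\<in>UNIV. of_nat (E (2, \<beta> j, k)) * \<phi> (slice_act id \<beta> \<gamma> (move (\<beta> j) k E)))"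
    by (intro sum.cong refl sum.reindex_bij_betw[OF bij(2), of "\<lambda>k. of_nat (E (2, \<beta> _, k)) * \<phi> (slice_act id \<beta> \<gamma> (move (\<beta> _) k E))"])
  also have "\<dots> = (\<Sum>j\<in>UNIV. \<Sum>k\<in>UNIV. of_nat (E (2, j, k)) * \<phi> (slice_act id \<beta> \<gamma> (move j k E)))"
    by (rule sum.reindex_bij_betw[OF bij(1), of "\<lambda>j. \<Sum>k\<in>UNIV. of_nat (E (2, j, k)) * \<phi> (slice_act id \<beta> \<gamma> (move j k E))"])
  finally show ?thesis by (simp add: moves_def)
qed

lemma sum_swap4:
  "(\<Sum>j\<in>A. \<Sum>k\<in>B. \<Sum>\<beta>\<in>C. \<Sum>\<gamma>\<in>D. T j k \<beta> \<gamma>) = (\<Sum>\<beta>\<in>C. \<Sum>\<gamma>\<in>D. \<Sum>j\<in>A. \<Sum>k\<in>B. T j k \<beta> \<gamma>)"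
proof -
  have "(\<Sum>j\<in>A. \<Sum>k\<in>B. \<Sum>\<beta>\<in>C. \<Sum>\<gamma>\<in>D. T j k \<beta> \<gamma>) = (\<Sum>j\<in>A. \<Sum>\<beta>\<in>C. \<Sum>k\<in>B. \<Sum>\<gamma>\<in>D. T j k \<beta> \<gamma>)"
    by (rule sum.cong[OF refl], rule sum.swap)
  also have "\<dots> = (\<Sum>\<beta>\<in>C. \<Sum>j\<in>A. \<Sum>k\<in>B. \<Sum>\<gamma>\<in>D. T j k \<beta> \<gamma>)"
    by (rule sum.swap)
  also have "\<dots> = (\<Sum>\<beta>\<in>C. \<Sum>j\<in>A. \<Sum>\<gamma>\<in>D. \<Sum>k\<in>B. T j k \<beta> \<gamma>)"
    by (rule sum.cong[OF refl], rule sum.cong[OF refl], rule sum.swap)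
  also have "\<dots> = (\<Sum>\<beta>\<in>C. \<Sum>\<gamma>\<in>D. \<Sum>j\<in>A. \<Sum>k\<in>B. T j k \<beta> \<gamma>)"
    by (rule sum.cong[OF refl], rule sum.swap)
  finally show ?thesis .
qed

text \<open>Since \<open>moves\<close> only refers to the slices 1 and 2 of the first direction, it commutes with row and column permutations. The
  sum over 1296 group elements thus reduces to 36 views and the function \<open>rc_sum s \<phi>\<close>.\<close>

lemma sum_G_moves:
  "(\<Sum>g\<in>G. of_int (gsgn s g) * moves \<phi> (gact g (arr_of q))) =
    (\<Sum>(x, q')\<leftarrow>views s q. of_int (sval x) * moves (rc_sum s \<phi>) (arr_of q'))"
proof -
  have rc: "moves (rc_sum s \<phi>) E = (\<Sum>\<beta>\<in>perms3. \<Sum>\<gamma>\<in>perms3. of_int (psgn s \<beta>) * of_int (psgn s \<gamma>) * moves \<phi> (slice_act id \<beta> \<gamma> E))" for E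
  proof -
    have "moves (rc_sum s \<phi>) E = (\<Sum>j\<in>UNIV. \<Sum>k\<in>UNIV. \<Sum>\<beta>\<in>perms3. \<Sum>\<gamma>\<in>perms3.
        of_int (psgn s \<beta>) * of_int (psgn s \<gamma>) * (of_nat (E (2, j, k)) * \<phi> (slice_act id \<beta> \<gamma> (move j k E))))"
      unfolding moves_def rc_sum_def sum_distrib_left by (intro sum.cong refl) (simp add: mult_ac)
    also have "\<dots> = (\<Sum>\<beta>\<in>perms3. \<Sum>\<gamma>\<in>perms3. of_int (psgn s \<beta>) * of_int (psgn s \<gamma>) * moves (\<lambda>F. \<phi> (slice_act id \<beta> \<gamma> F)) E)"
      by (subst sum_swap4) (simp only: moves_def sum_distrib_left)
    finally show ?thesis by (simp add: moves_slice_act cong: sum.cong)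
  qed
  have "gact (\<alpha>, \<beta>, \<gamma>, \<delta>) E = slice_act id \<beta> \<gamma> (slice_act \<alpha> id id (dir_act \<delta> E))" for \<alpha> \<beta> \<gamma> \<delta> E
    by (auto simp: gact_def slice_act_def)
  then have "(\<Sum>g\<in>G. of_int (gsgn s g) * moves \<phi> (gact g (arr_of q))) = (\<Sum>\<delta>\<in>perms3. \<Sum>\<alpha>\<in>perms3.
     (\<lambda>x E. of_int x * moves (rc_sum s \<phi>) E) (psgn s \<alpha> * psgn s \<delta>) (slice_act \<alpha> id id (dir_act \<delta> (arr_of q))))"
    unfolding sum_G gsgn_eq rc by (simp add: sum_distrib_left mult_ac)
  also have "\<dots> = (\<Sum>(x, q')\<leftarrow>views s q. of_int (sval x) * moves (rc_sum s \<phi>) (arr_of q'))"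
    by (rule sum_views)
  finally show ?thesis .
qed

subsection \<open>Stabilisers and the complete check\<close>

lemma in_range_flat: "(x, k) \<in> set (images_list s vs) \<Longrightarrow> k \<in> range flat"
proof -
  assume "(x, k) \<in> set (images_list s vs)"
  then show "k \<in> range flat"
  proof (induction vs)
    case (Cons v vs)
    then show ?case
      using in_rows_list[of x k s "fst v" all_perms all_perms "snd v" "images_list s vs"] by auto
  qed simp
qed

lemma of_nat_length_filter:
  "of_nat (length (filter (\<lambda>(x, k). P x k) L)) = (\<Sum>(x, k)\<leftarrow>L. if P x k then 1 else 0 :: complex)"
  by (induction L) auto

lemma count_images:
  "length (filter (\<lambda>(x, k). P (sval x) \<and> k = flat (cube_of E')) (images_list s (views s q))) =
    card {g \<in> G. P (gsgn s g) \<and> gact g (arr_of q) = E'}"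
proof -
  have "of_nat (length (filter (\<lambda>(x, k). P (sval x) \<and> k = flat (cube_of E')) (images_list s (views s q)))) =
      (\<Sum>(x, k)\<leftarrow>images_list s (views s q). if P (sval x) \<and> arr_of (unflat k) = E' then 1 else 0 :: complex)"
    unfolding of_nat_length_filter
  proof (intro arg_cong[where f = sum_list] map_cong refl, clarify)
    fix x k assume "(x, k) \<in> set (images_list s (views s q))"
    then obtain q' where "k = flat q'" using in_range_flat by blast
    then show "(if P (sval x) \<and> k = flat (cube_of E') then 1 else 0 :: complex) = (if P (sval x) \<and> arr_of (unflat k) = E' then 1 else 0)"
      by (auto simp: flat_inject)
  qed
  also have "\<dots> = (\<Sum>g\<in>G. if P (gsgn s g) \<and> gact g (arr_of q) = E' then 1 else 0)"
    by (rule sum_images[where F = "\<lambda>x E. if P x \<and> E = E' then 1 else 0", symmetric])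
  also have "\<dots> = of_nat (card {g \<in> G. P (gsgn s g) \<and> gact g (arr_of q) = E'})"
    by (simp add: sum.inter_filter[symmetric])
  finally show ?thesis by (simp only: of_nat_eq_iff)
qed

lemma image_in_list:
  "(\<exists>x. P (sval x) \<and> (x, flat (cube_of E')) \<in> set (images_list s (views s q))) \<longleftrightarrow> (\<exists>g\<in>G. P (gsgn s g) \<and> gact g (arr_of q) = E')"
proof -
  have "(\<exists>x. P (sval x) \<and> (x, flat (cube_of E')) \<in> set (images_list s (views s q))) \<longleftrightarrow>
      length (filter (\<lambda>(x, k). P (sval x) \<and> k = flat (cube_of E')) (images_list s (views s q))) \<noteq> 0"
    by (auto simp: filter_empty_conv)
  also have "\<dots> \<longleftrightarrow> (\<exists>g\<in>G. P (gsgn s g) \<and> gact g (arr_of q) = E')"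
    unfolding count_images by (auto simp: card_eq_0_iff)
  finally show ?thesis .
qed

text \<open>The maximal key is a complete invariant of the orbit.\<close>

definition max_key :: "arr \<Rightarrow> nat list" where
  "max_key E = Max ((\<lambda>E'. flat (cube_of E')) ` orb E)"

lemma image_keys: "snd ` set (images_list s (views s q)) = (\<lambda>E'. flat (cube_of E')) ` orb (arr_of q)"
proof
  show "snd ` set (images_list s (views s q)) \<subseteq> (\<lambda>E'. flat (cube_of E')) ` orb (arr_of q)"
  proof clarsimp
    fix x k assume *: "(x, k) \<in> set (images_list s (views s q))"
    then obtain q' where k: "k = flat q'" using in_range_flat by blast
    then have "\<exists>g\<in>G. gact g (arr_of q) = arr_of q'"
      using image_in_list[of "\<lambda>_. True" "arr_of q'" s q] * by auto
    then show "k \<in> (\<lambda>E'. flat (cube_of E')) ` orb (arr_of q)" by (force simp: k orb_def)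
  qed
  show "(\<lambda>E'. flat (cube_of E')) ` orb (arr_of q) \<subseteq> snd ` set (images_list s (views s q))"
    using image_in_list[of "\<lambda>_. True" _ s q] by (force simp: orb_def)
qed

text \<open>The images with maximal key form a coset of the stabiliser. Their number is its order, and
  the alternating sum survives if and only if they all carry the same sign.\<close>

lemma stabilizer_info:
  assumes "argmax (images_list s (views s q)) (Best [] []) = Best b xs"
  shows "b = max_key (arr_of q)" "length xs = card (stab (arr_of q))" "parity_of xs \<noteq> Mixed \<Longrightarrow> even_stab s (arr_of q)"
proof -
  let ?E = "arr_of q" and ?I = "images_list s (views s q)"
  note spec = argmax_spec[OF assms]
  let ?K = "(\<lambda>E'. flat (cube_of E')) ` orb ?E"
  have ne: "?K \<noteq> {}" using orb_self[of ?E] by auto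
  have "Max (insert [] ?K) = max [] (Max ?K)" using ne by (intro Max_insert) auto
  then have "Max (insert [] ?K) = Max ?K" by (simp add: max_def)
  then show b: "b = max_key ?E" using spec unfolding image_keys max_key_def by simp
  have "Max ?K \<in> ?K" using ne by (intro Max_in) auto
  then obtain g0 where g0: "g0 \<in> G" and bE: "b = flat (cube_of (gact g0 ?E))"
    using b unfolding max_key_def orb_def by auto
  have "length xs = length (filter (\<lambda>ak. snd ak = b) ?I)" using spec by simp
  also have "\<dots> = card {g \<in> G. gact g ?E = gact g0 ?E}"
    using count_images[of "\<lambda>_. True" "gact g0 ?E" s q] by (simp add: bE case_prod_unfold)
  also have "\<dots> = card (stab ?E)"
    unfolding fibre_gact[OF g0] by (rule card_image) (rule inj_on_subset[OF inj_gmul[OF g0]], simp)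
  finally show len: "length xs = card (stab ?E)" .
  assume "parity_of xs \<noteq> Mixed"
  moreover have "xs \<noteq> []"
  proof -
    have "card (stab ?E) \<noteq> 0" using card_orb[of ?E] by auto
    then show ?thesis using len by auto
  qed
  ultimately have "True \<notin> set xs \<or> False \<notin> set xs"
    using parity_of_spec[of xs] by (simp split: if_splits)
  moreover have "x = False \<or> x = True" for x by blast
  ultimately have "set xs \<subseteq> {False} \<or> set xs \<subseteq> {True}" by (metis singletonI subsetI)
  then obtain y where y: "set xs \<subseteq> {y}" by blast
  have sgn: "gsgn s g = sval y" if "g \<in> G" "gact g ?E = gact g0 ?E" for g
  proof -
    have "gsgn s g = 1 \<or> gsgn s g = - 1" using gsgn_square[of s g] by (metis square_eq_1_iff)
    then obtain x where x: "gsgn s g = sval x" by (metis sval_def)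
    have "(\<exists>x'. sval x' = sval x \<and> (x', b) \<in> set ?I)"
      unfolding bE using image_in_list[of "\<lambda>z. z = sval x" "gact g0 ?E" s q] that x by auto
    then have "(x, b) \<in> set ?I" by (auto simp: sval_def split: if_splits)
    then have "x \<in> set xs" using spec by simp
    then show ?thesis using y x by auto
  qed
  show "even_stab s ?E" unfolding even_stab_def
  proof
    fix h assume "h \<in> stab ?E"
    then have h: "h \<in> G" "gact h ?E = ?E" by (auto simp: stab_def)
    have "gsgn s (gmul g0 h) = sval y" by (rule sgn) (simp_all add: gmul_in_G gact_gmul g0 h)
    then have "sval y * gsgn s h = sval y" using sgn[OF g0 refl] by (simp add: gsgn_gmul g0 h)
    then show "gsgn s h = 1" by (auto simp: sval_def split: if_splits)
  qed
qed

primrec fresh_order :: "order \<Rightarrow> bool \<Rightarrow> bool" where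
  "fresh_order LT f = f" | "fresh_order GT f = f" | "fresh_order EQ f = False"

primrec fresh :: "nat list \<Rightarrow> nat list list \<Rightarrow> bool" where
  "fresh k [] = True" | "fresh k (l # ls) = fresh_order (cmpl k l) (fresh k ls)"

lemma fresh_iff: "fresh k ls \<longleftrightarrow> k \<notin> set ls"
  by (induction ls) (auto simp: cmpl_def)

primrec count :: "'a list \<Rightarrow> int \<Rightarrow> int" where
  "count [] n = n" | "count (x # xs) n = count xs (n + 1)"

lemma count_eq: "count xs n = n + int (length xs)"
  by (induction xs arbitrary: n) auto

definition orbit_size :: "int \<Rightarrow> int" where "orbit_size n = 1296 div n"

text \<open>The orders of stabilisers that occur.\<close>

lemma orbit_size_code: "orbit_size 1 = 1296" "orbit_size 2 = 648" "orbit_size 3 = 432" "orbit_size 4 = 324"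
  "orbit_size 6 = 216" "orbit_size 8 = 162" "orbit_size 12 = 108" "orbit_size 18 = 72" "orbit_size 24 = 54"
  "orbit_size 36 = 36" "orbit_size 48 = 27"
  by (simp_all add: orbit_size_def)

lemma orbit_size_stab: "orbit_size (int (card (stab E))) = int (card (orb E))"
proof -
  have "card (orb E) = 1296 div card (stab E)"
    using card_orb[of E] by (metis nonzero_mult_div_cancel_right mult_zero_right zero_neq_numeral)
  then show ?thesis by (simp add: orbit_size_def zdiv_int)
qed

datatype result = Fail | Result trie int "nat list list"

text \<open>One step of the check, for the array \<open>q\<close> with coefficient \<open>c\<close>: its maximal key has to be new (a new orbit), the signs in the
  stabiliser have to be even, the orbit size is added to the number of terms, and the moved
  arrays are added to the trie. The step is divided into several functions so that each one only inspects an evaluated argument.\<close>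

primrec step3 :: "bool \<Rightarrow> int \<Rightarrow> nat list \<Rightarrow> bool \<Rightarrow> int \<Rightarrow> cube \<Rightarrow> trie \<Rightarrow> int \<Rightarrow> nat list list \<Rightarrow> result" where
  "step3 False n b s c q t N ks = Fail"
| "step3 True n b s c q t N ks = Result (put_views s (c * n) (views s q) t) (N + n) (b # ks)"

primrec step2 :: "parity \<Rightarrow> bool \<Rightarrow> int \<Rightarrow> nat list \<Rightarrow> bool \<Rightarrow> int \<Rightarrow> cube \<Rightarrow> trie \<Rightarrow> int \<Rightarrow> nat list list \<Rightarrow> result" where
  "step2 Plus f n b s c q t N ks = step3 f n b s c q t N ks"
| "step2 Minus f n b s c q t N ks = step3 f n b s c q t N ks"
| "step2 Mixed f n b s c q t N ks = Fail"

primrec step1 :: "bool best \<Rightarrow> bool \<Rightarrow> int \<Rightarrow> cube \<Rightarrow> trie \<Rightarrow> int \<Rightarrow> nat list list \<Rightarrow> result" where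
  "step1 (Best b xs) s c q t N ks = step2 (parity_of xs) (fresh b ks) (orbit_size (count xs 0)) b s c q t N ks"

primrec step :: "bool \<Rightarrow> int \<Rightarrow> cube \<Rightarrow> result \<Rightarrow> result" where
  "step s c q Fail = Fail"
| "step s c q (Result t N ks) = step1 (argmax (images_list s (views s q)) (Best [] [])) s c q t N ks"

primrec run :: "bool \<Rightarrow> (int \<times> cube) list \<Rightarrow> result \<Rightarrow> result" where
  "run s [] r = r"
| "run s (e # L) r = run s L (step s (fst e) (snd e) r)"

lemma step_spec:
  assumes "step s c q (Result t N ks) = Result t' N' ks'"
  shows "even_stab s (arr_of q)" "N' = N + int (card (orb (arr_of q)))" "max_key (arr_of q) \<notin> set ks" "ks' = max_key (arr_of q) # ks"
    "t' = put_views s (c * int (card (orb (arr_of q)))) (views s q) t"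
proof -
  obtain b xs where b: "argmax (images_list s (views s q)) (Best [] []) = Best b xs"
    by (cases "argmax (images_list s (views s q)) (Best [] [])")
  note info = stabilizer_info[OF b]
  have par: "parity_of xs \<noteq> Mixed" using assms by (auto simp: b)
  have "orbit_size (count xs 0) = int (card (orb (arr_of q)))"
    by (simp add: count_eq info(2) orbit_size_stab)
  then have "step3 (fresh b ks) (int (card (orb (arr_of q)))) b s c q t N ks = Result t' N' ks'"
    using assms par by (cases "parity_of xs") (simp_all add: b)
  then have "fresh b ks \<and> t' = put_views s (c * int (card (orb (arr_of q)))) (views s q) t \<and> N' = N + int (card (orb (arr_of q))) \<and> ks' = b # ks"
    by (cases "fresh b ks") auto
  then show "even_stab s (arr_of q)" "N' = N + int (card (orb (arr_of q)))" "max_key (arr_of q) \<notin> set ks" "ks' = max_key (arr_of q) # ks"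
    "t' = put_views s (c * int (card (orb (arr_of q)))) (views s q) t"
    using info par by (auto simp: fresh_iff)
qed

lemma run_Fail [simp]: "run s L Fail = Fail"
  by (induction L) auto

lemma run_spec:
  assumes "run s L (Result t N ks) = Result t' N' ks'" "distinct ks"
  shows "(\<forall>(c, q)\<in>set L. even_stab s (arr_of q)) \<and> N' = N + (\<Sum>(c, q)\<leftarrow>L. int (card (orb (arr_of q)))) \<and>
    distinct (map (max_key \<circ> arr_of \<circ> snd) L @ ks) \<and>
    (\<forall>\<psi>. equivariant s \<psi> \<longrightarrow> trie_sum t' (\<psi> \<circ> unflat) = trie_sum t (\<psi> \<circ> unflat) +
      (\<Sum>(c, q)\<leftarrow>L. of_int c * of_nat (card (orb (arr_of q))) * (\<Sum>(x, q')\<leftarrow>views s q. of_int (sval x) * moves (\<psi> \<circ> cube_of) (arr_of q'))))"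
  using assms
proof (induction L arbitrary: t N ks)
  case (Cons e L)
  obtain c q where e: "e = (c, q)" by (cases e)
  obtain t1 N1 ks1 where st: "step s c q (Result t N ks) = Result t1 N1 ks1"
    using Cons.prems(1) by (cases "step s c q (Result t N ks)") (auto simp: e)
  note sp = step_spec[OF st]
  have "run s L (Result t1 N1 ks1) = Result t' N' ks'" using Cons.prems(1) by (simp add: e st del: step.simps)
  moreover have "distinct ks1" using sp Cons.prems(2) by simp
  ultimately have IH: "(\<forall>(c, q)\<in>set L. even_stab s (arr_of q)) \<and> N' = N1 + (\<Sum>(c, q)\<leftarrow>L. int (card (orb (arr_of q)))) \<and>
    distinct (map (max_key \<circ> arr_of \<circ> snd) L @ ks1) \<and>
    (\<forall>\<psi>. equivariant s \<psi> \<longrightarrow> trie_sum t' (\<psi> \<circ> unflat) = trie_sum t1 (\<psi> \<circ> unflat) +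
      (\<Sum>(c, q)\<leftarrow>L. of_int c * of_nat (card (orb (arr_of q))) * (\<Sum>(x, q')\<leftarrow>views s q. of_int (sval x) * moves (\<psi> \<circ> cube_of) (arr_of q'))))"
    by (rule Cons.IH)
  have tr: "trie_sum t1 (\<psi> \<circ> unflat) = trie_sum t (\<psi> \<circ> unflat) +
      of_int c * of_nat (card (orb (arr_of q))) * (\<Sum>(x, q')\<leftarrow>views s q. of_int (sval x) * moves (\<psi> \<circ> cube_of) (arr_of q'))"
    if "equivariant s \<psi>" for \<psi>
    unfolding sp(5) trie_sum_put_views[OF that] by simp
  show ?case
  proof (intro conjI allI impI)
    show "\<forall>(c, q)\<in>set (e # L). even_stab s (arr_of q)" using IH sp(1) by (simp add: e)
    show "N' = N + (\<Sum>(c, q)\<leftarrow>e # L. int (card (orb (arr_of q))))" using IH sp(2) by (simp add: e)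
    show "distinct (map (max_key \<circ> arr_of \<circ> snd) (e # L) @ ks)" using IH sp(3,4) by (auto simp: e)
  next
    fix \<psi> assume "equivariant s \<psi>"
    then show "trie_sum t' (\<psi> \<circ> unflat) = trie_sum t (\<psi> \<circ> unflat) +
      (\<Sum>(c, q)\<leftarrow>e # L. of_int c * of_nat (card (orb (arr_of q))) * (\<Sum>(x, q')\<leftarrow>views s q. of_int (sval x) * moves (\<psi> \<circ> cube_of) (arr_of q')))"
      using IH tr by (simp add: e)
  qed
qed simp

primrec verdict :: "result \<Rightarrow> (bool \<times> int)" where
  "verdict Fail = (False, 0)" | "verdict (Result t N ks) = (all_zero t, N)"

definition entries :: "(int \<times> cube) list \<Rightarrow> (int \<times> arr) list" where
  "entries L = map (\<lambda>(c, q). (c, arr_of q)) L"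

fun shape_ok :: "nat \<Rightarrow> int \<times> cube \<Rightarrow> bool" where
  "shape_ok n (c, q) \<longleftrightarrow> c \<noteq> 0 \<and> margins n (arr_of q)"

text \<open>The outcome \<open>(True, N)\<close> certifies everything that is needed about the family: all orbits distinct, no cancellation in the orbit
  sums, \<open>N\<close> terms, and annihilation by the root vector, as the trie has only zero values.\<close>

theorem verified_family:
  assumes "verdict (run s L (Result Empty 0 [])) = (True, N)" "list_all (shape_ok n) L"
  shows "good_family s (entries L)" "annihilated s (entries L)" "int (num_terms (family_sum s (entries L))) = N"
    "\<And>c E. (c, E) \<in> set (entries L) \<Longrightarrow> margins n E"
proof -
  obtain t ks where r: "run s L (Result Empty 0 []) = Result t N ks" and z: "all_zero t"
    using assms(1) by (cases "run s L (Result Empty 0 [])") auto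
  note sp = run_spec[OF r distinct.simps(1)[THEN iffD2, OF TrueI]]
  have "distinct (map (orb \<circ> snd) (entries L))"
  proof -
    have "distinct (map (max_key \<circ> snd) (entries L))"
      using sp by (simp add: entries_def comp_def case_prod_unfold)
    moreover have "map (max_key \<circ> snd) (entries L) =
        map (\<lambda>S. Max ((\<lambda>E'. flat (cube_of E')) ` S)) (map (orb \<circ> snd) (entries L))"
      by (simp add: max_key_def comp_def)
    ultimately show ?thesis by (metis distinct_map)
  qed
  moreover have "\<forall>(c, E)\<in>set (entries L). c \<noteq> 0 \<and> even_stab s E \<and> margins n E"
    using sp assms(2) by (fastforce simp: entries_def list_all_iff)
  ultimately show good: "good_family s (entries L)" and "\<And>c E. (c, E) \<in> set (entries L) \<Longrightarrow> margins n E"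
    by (auto simp: good_family_def)
  show "int (num_terms (family_sum s (entries L))) = N"
  proof -
    have "(\<Sum>(c, E)\<leftarrow>entries L. card (orb E)) = (\<Sum>(c, q)\<leftarrow>L. card (orb (arr_of q)))"
      by (simp add: entries_def comp_def case_prod_unfold)
    moreover have "int (\<Sum>(c, q)\<leftarrow>L. card (orb (arr_of q))) = (\<Sum>(c, q)\<leftarrow>L. int (card (orb (arr_of q))))"
      by (induction L) auto
    ultimately show ?thesis using sp keys_family_sum(2)[OF good] by simp
  qed
  show "annihilated s (entries L)" unfolding annihilated_def
  proof
    fix \<phi> :: "arr \<Rightarrow> complex"
    have "(\<lambda>q. rc_sum s \<phi> (arr_of q)) \<circ> cube_of = rc_sum s \<phi>" by (simp add: fun_eq_iff)
    then have "0 = (\<Sum>(c, q)\<leftarrow>L. of_int c * of_nat (card (orb (arr_of q))) * (\<Sum>(x, q')\<leftarrow>views s q. of_int (sval x) * moves (rc_sum s \<phi>) (arr_of q')))"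
      using sp rc_sum_equivariant[of s \<phi>] trie_sum_all_zero[OF z] by force
    also have "\<dots> = (\<Sum>(c, E)\<leftarrow>entries L. of_int c * of_nat (card (orb E)) * (\<Sum>g\<in>G. of_int (gsgn s g) * moves \<phi> (gact g E)))"
      unfolding sum_G_moves[symmetric] by (simp add: entries_def comp_def case_prod_unfold)
    finally show "(\<Sum>(c, E)\<leftarrow>entries L. of_int c * of_nat (card (orb E)) * (\<Sum>g\<in>G. of_int (gsgn s g) * moves \<phi> (gact g E))) = 0" by simp
  qed
qed

section \<open>The three polynomials\<close>

subsection \<open>Rewriting rules for the computation\<close>

text \<open>Shortcuts for the evaluation: compositions of permutations and flattening in one rule, and folds instead of
  lists of 1296 images.\<close>

definition col_key :: "perm3 \<Rightarrow> cube \<Rightarrow> nat list" where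
  "col_key p q = flat (colp p q)"

lemma col_key_code:
  "col_key P123 (Cube (M x0 x1 x2 x3 x4 x5 x6 x7 x8) (M y0 y1 y2 y3 y4 y5 y6 y7 y8) (M z0 z1 z2 z3 z4 z5 z6 z7 z8)) =
     [y0, y1, y2, y3, y4, y5, y6, y7, y8, x0, x1, x2, x3, x4, x5, x6, x7, x8, z0, z1, z2, z3, z4, z5, z6, z7, z8]"
  "col_key P132 (Cube (M x0 x1 x2 x3 x4 x5 x6 x7 x8) (M y0 y1 y2 y3 y4 y5 y6 y7 y8) (M z0 z1 z2 z3 z4 z5 z6 z7 z8)) =
     [y0, y2, y1, y3, y5, y4, y6, y8, y7, x0, x2, x1, x3, x5, x4, x6, x8, x7, z0, z2, z1, z3, z5, z4, z6, z8, z7]"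
  "col_key P213 (Cube (M x0 x1 x2 x3 x4 x5 x6 x7 x8) (M y0 y1 y2 y3 y4 y5 y6 y7 y8) (M z0 z1 z2 z3 z4 z5 z6 z7 z8)) =
     [y1, y0, y2, y4, y3, y5, y7, y6, y8, x1, x0, x2, x4, x3, x5, x7, x6, x8, z1, z0, z2, z4, z3, z5, z7, z6, z8]"
  "col_key P231 (Cube (M x0 x1 x2 x3 x4 x5 x6 x7 x8) (M y0 y1 y2 y3 y4 y5 y6 y7 y8) (M z0 z1 z2 z3 z4 z5 z6 z7 z8)) =
     [y1, y2, y0, y4, y5, y3, y7, y8, y6, x1, x2, x0, x4, x5, x3, x7, x8, x6, z1, z2, z0, z4, z5, z3, z7, z8, z6]"
  "col_key P312 (Cube (M x0 x1 x2 x3 x4 x5 x6 x7 x8) (M y0 y1 y2 y3 y4 y5 y6 y7 y8) (M z0 z1 z2 z3 z4 z5 z6 z7 z8)) =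
     [y2, y0, y1, y5, y3, y4, y8, y6, y7, x2, x0, x1, x5, x3, x4, x8, x6, x7, z2, z0, z1, z5, z3, z4, z8, z6, z7]"
  "col_key P321 (Cube (M x0 x1 x2 x3 x4 x5 x6 x7 x8) (M y0 y1 y2 y3 y4 y5 y6 y7 y8) (M z0 z1 z2 z3 z4 z5 z6 z7 z8)) =
     [y2, y1, y0, y5, y4, y3, y8, y7, y6, x2, x1, x0, x5, x4, x3, x8, x7, x6, z2, z1, z0, z5, z4, z3, z8, z7, z6]"
  by (simp_all add: col_key_def colp_code colm_code flat_code)

lemma rowp_cube_code:
  "rowp P123 (Cube (M x0 x1 x2 x3 x4 x5 x6 x7 x8) (M y0 y1 y2 y3 y4 y5 y6 y7 y8) (M z0 z1 z2 z3 z4 z5 z6 z7 z8)) =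
     Cube (M x0 x1 x2 x3 x4 x5 x6 x7 x8) (M y0 y1 y2 y3 y4 y5 y6 y7 y8) (M z0 z1 z2 z3 z4 z5 z6 z7 z8)"
  "rowp P132 (Cube (M x0 x1 x2 x3 x4 x5 x6 x7 x8) (M y0 y1 y2 y3 y4 y5 y6 y7 y8) (M z0 z1 z2 z3 z4 z5 z6 z7 z8)) =
     Cube (M x0 x1 x2 x6 x7 x8 x3 x4 x5) (M y0 y1 y2 y6 y7 y8 y3 y4 y5) (M z0 z1 z2 z6 z7 z8 z3 z4 z5)"
  "rowp P213 (Cube (M x0 x1 x2 x3 x4 x5 x6 x7 x8) (M y0 y1 y2 y3 y4 y5 y6 y7 y8) (M z0 z1 z2 z3 z4 z5 z6 z7 z8)) =
     Cube (M x3 x4 x5 x0 x1 x2 x6 x7 x8) (M y3 y4 y5 y0 y1 y2 y6 y7 y8) (M z3 z4 z5 z0 z1 z2 z6 z7 z8)"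
  "rowp P231 (Cube (M x0 x1 x2 x3 x4 x5 x6 x7 x8) (M y0 y1 y2 y3 y4 y5 y6 y7 y8) (M z0 z1 z2 z3 z4 z5 z6 z7 z8)) =
     Cube (M x3 x4 x5 x6 x7 x8 x0 x1 x2) (M y3 y4 y5 y6 y7 y8 y0 y1 y2) (M z3 z4 z5 z6 z7 z8 z0 z1 z2)"
  "rowp P312 (Cube (M x0 x1 x2 x3 x4 x5 x6 x7 x8) (M y0 y1 y2 y3 y4 y5 y6 y7 y8) (M z0 z1 z2 z3 z4 z5 z6 z7 z8)) =
     Cube (M x6 x7 x8 x0 x1 x2 x3 x4 x5) (M y6 y7 y8 y0 y1 y2 y3 y4 y5) (M z6 z7 z8 z0 z1 z2 z3 z4 z5)"
  "rowp P321 (Cube (M x0 x1 x2 x3 x4 x5 x6 x7 x8) (M y0 y1 y2 y3 y4 y5 y6 y7 y8) (M z0 z1 z2 z3 z4 z5 z6 z7 z8)) =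
     Cube (M x6 x7 x8 x3 x4 x5 x0 x1 x2) (M y6 y7 y8 y3 y4 y5 y0 y1 y2) (M z6 z7 z8 z3 z4 z5 z0 z1 z2)"
  by (simp_all add: rowp_code rowm_code)

primrec cols_best :: "bool \<Rightarrow> bool \<Rightarrow> perm3 list \<Rightarrow> cube \<Rightarrow> bool best \<Rightarrow> bool best" where
  "cols_best s x [] q st = st"
| "cols_best s x (p # ps) q st = cols_best s x ps q (best_step (flip s p x, col_key p q) st)"

primrec rows_best :: "bool \<Rightarrow> bool \<Rightarrow> perm3 list \<Rightarrow> perm3 list \<Rightarrow> cube \<Rightarrow> bool best \<Rightarrow> bool best" where
  "rows_best s x [] cs q st = st"
| "rows_best s x (p # ps) cs q st = rows_best s x ps cs q (cols_best s (flip s p x) cs (rowp p q) st)"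

primrec images_best :: "bool \<Rightarrow> (bool \<times> cube) list \<Rightarrow> bool best \<Rightarrow> bool best" where
  "images_best s [] st = st"
| "images_best s (v # vs) st = images_best s vs (rows_best s (fst v) all_perms all_perms (snd v) st)"

lemma argmax_cols_list: "argmax (cols_list s x cs q rest) st = argmax rest (cols_best s x cs q st)"
  by (induction cs arbitrary: st) (simp_all add: col_key_def)

lemma argmax_rows_list: "argmax (rows_list s x rs cs q rest) st = argmax rest (rows_best s x rs cs q st)"
  by (induction rs arbitrary: st) (simp_all add: argmax_cols_list)

lemma argmax_images_list: "argmax (images_list s vs) st = images_best s vs st"
  by (induction vs arbitrary: st) (simp_all add: argmax_rows_list)

lemma step_code:
  "step s c q Fail = Fail"
  "step s c q (Result t N ks) = step1 (images_best s (views s q) (Best [] [])) s c q t N ks"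
  by (simp_all add: argmax_images_list)

lemma canon_code:
  "canon s x q = rows_best s x (args (argmax (row_sigs q) (Best [] []))) (args (argmax (col_sigs q) (Best [] []))) q (Best [] [])"
  by (simp add: canon_def argmax_rows_list)

text \<open>The contribution of one array is collected in a trie of its own, which is then merged into the
  accumulated one. Rewriting pays for the size of every argument at every step, so updates of a small
  trie are much cheaper than updates of the accumulated one.\<close>

fun merge :: "trie \<Rightarrow> trie \<Rightarrow> trie" where
  "merge Empty t = t"
| "merge (Node v a b) Empty = Node v a b"
| "merge (Node v a b) (Node w c d) = Node (v + w) (merge a c) (merge b d)"

lemma insert_key_merge: "insert_key k w (merge a t) = merge (insert_key k w a) t"
proof (induction k w a arbitrary: t rule: insert_key.induct)
  case (1 w)
  then show ?case by (cases t) simp_all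
next
  case (2 w v a b)
  then show ?case by (cases t) simp_all
next
  case (3 k w)
  show ?case
  proof (cases t)
    case (Node v c d)
    then show ?thesis using 3[of c] by simp
  qed simp
next
  case (4 k w v a b)
  then show ?case by (cases t) simp_all
next
  case (5 n k w)
  show ?case
  proof (cases t)
    case (Node v c d)
    then show ?thesis using 5[of d] by simp
  qed simp
next
  case (6 n k w v a b)
  then show ?case by (cases t) simp_all
qed

lemma put_merge: "put p w (merge a t) = merge (put p w a) t"
proof (cases p)
  case (Best b xs)
  then show ?thesis by (cases "parity_of xs") (simp_all add: insert_key_merge)
qed

lemma put_views_merge: "put_views s w vs (merge a t) = merge (put_views s w vs a) t"
proof -
  have "put_cells s x w cs (merge a t) = merge (put_cells s x w cs a) t" for x cs a
    by (induction cs arbitrary: a) (simp_all add: put_merge)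
  then show ?thesis by (induction vs arbitrary: a) simp_all
qed

lemma step3_code:
  "step3 False n b s c q t N ks = Fail"
  "step3 True n b s c q t N ks = Result (merge (put_views s (c * n) (views s q) Empty) t) (N + n) (b # ks)"
  using put_views_merge[of s "c * n" "views s q" Empty t] by simp_all

declare run.simps [simp del]

lemmas evaluation =
  run.simps step_code step1.simps step2.simps step3_code merge.simps verdict.simps
  images_best.simps rows_best.simps cols_best.simps views_def dirs_list.simps slices_list.simps
  all_perms_def flip_code not_True_eq_False not_False_eq_True
  col_key_code rowp_cube_code slicep_code dirp_code
  argmax.simps best_step_code best_upd.simps cmpl_code cmp_then.simps cmpn_code
  parity_of_code parity_from.simps join_code fresh.simps fresh_order.simps count.simps orbit_size_code
  put_views.simps put_cells.simps put.simps put_parity.simps cells.simps emit.simps pred_code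
  canon_code args.simps row_sigs.simps col_sigs.simps sigs_def times_code insert_key.simps all_zero.simps
  fst_conv snd_conv simp_thms add_Suc arith_simps rel_simps arith_special add_0_right minus_zero minus_minus
  mult_minus1 mult_minus1_right mult_1_left mult_1_right

lemma subscripts_code:
  "subscripts 111 = (1, 1, 1)" "subscripts 112 = (1, 1, 2)" "subscripts 113 = (1, 1, 3)"
  "subscripts 121 = (1, 2, 1)" "subscripts 122 = (1, 2, 2)" "subscripts 123 = (1, 2, 3)"
  "subscripts 131 = (1, 3, 1)" "subscripts 132 = (1, 3, 2)" "subscripts 133 = (1, 3, 3)"
  "subscripts 211 = (2, 1, 1)" "subscripts 212 = (2, 1, 2)" "subscripts 213 = (2, 1, 3)"
  "subscripts 221 = (2, 2, 1)" "subscripts 222 = (2, 2, 2)" "subscripts 223 = (2, 2, 3)"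
  "subscripts 231 = (2, 3, 1)" "subscripts 232 = (2, 3, 2)" "subscripts 233 = (2, 3, 3)"
  "subscripts 311 = (3, 1, 1)" "subscripts 312 = (3, 1, 2)" "subscripts 313 = (3, 1, 3)"
  "subscripts 321 = (3, 2, 1)" "subscripts 322 = (3, 2, 2)" "subscripts 323 = (3, 2, 3)"
  "subscripts 331 = (3, 3, 1)" "subscripts 332 = (3, 3, 2)" "subscripts 333 = (3, 3, 3)"
  by (simp_all add: subscripts_def)


lemmas encoding = cube_of_def mat_of_def array_of_def subscripts_code


definition L6 :: "(int \<times> cube) list" where
  "L6 = map (\<lambda>(c, ns). (c, cube_of (array_of ns)))
   [(- 10, [123,132,213,231,312,321]), (- 4, [132,133,213,221,311,322]),
    (- 2, [133,133,221,222,311,312]), (1, [133,133,222,222,311,311]),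
    (2, [132,133,221,223,311,312]), (2, [132,133,213,222,311,321]),
    (4, [133,133,212,221,311,322]), (8, [123,132,213,231,311,322])]"

lemma I6_family: "I6 = family_sum False (entries L6)"
  by (simp add: I6_def family_sum_def entries_def L6_def osum_def)

definition L9 :: "(int \<times> cube) list" where
  "L9 = map (\<lambda>ns. (1, cube_of (array_of ns)))
   [[123,132,133,213,221,232,311,311,322],
    [123,132,133,213,221,231,312,312,321],
    [123,132,133,213,221,222,311,312,331],
    [123,132,133,213,221,221,311,312,332],
    [123,132,133,212,223,231,311,312,321],
    [123,132,133,212,222,231,311,311,323],
    [123,132,133,212,221,232,311,313,321],
    [123,132,133,212,221,231,311,313,322],
    [123,132,133,212,213,221,312,321,331],
    [123,132,133,212,212,231,313,321,321],
    [123,132,133,211,212,232,311,321,323],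
    [123,132,132,213,221,231,311,312,323],
    [123,132,132,213,221,222,311,311,333],
    [123,132,132,213,213,231,312,321,321]]"

lemma I9_family: "I9 = family_sum True (entries L9)"
  by (simp add: I9_def family_sum_def entries_def L9_def osum_def add.assoc)

definition digits :: "nat \<Rightarrow> m9" where
  "digits b = mat_of (\<lambda>j k. b div 10 ^ (8 - (3 * digit_pos j + digit_pos k)) mod 10)"

lemma block_array_digits: "block_array b1 b2 b3 = arr_of (Cube (digits b1) (digits b2) (digits b3))"
  by (simp add: fun_eq_iff block_array_def digits_def tri_def)

definition L12 :: "(int \<times> cube) list" where
  "L12 = concat (map (\<lambda>(b1, es). map (\<lambda>(c, b2, b3). (c, Cube (digits b1) (digits b2) (digits b3))) es) I12_data)"

lemma I12_family: "I12 = family_sum False (entries L12)"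
proof -
  have "(\<Sum>(b1, es)\<leftarrow>D. \<Sum>(c, b2, b3)\<leftarrow>es. of_int c * sym_orbit_sum (block_array b1 b2 b3)) =
      family_sum False (entries (concat (map (\<lambda>(b1, es). map (\<lambda>(c, b2, b3). (c, Cube (digits b1) (digits b2) (digits b3))) es) D)))"
    for D :: "(nat \<times> (int \<times> nat \<times> nat) list) list"
    by (induction D) (auto simp: family_sum_def entries_def osum_def block_array_digits comp_def case_prod_unfold)
  then show ?thesis by (simp add: I12_def L12_def)
qed

subsection \<open>Decimal digits\<close>

text \<open>The digits of a block are found by long division of the binary numeral by 10, one binary digit at a time.\<close>

definition double :: "nat \<Rightarrow> nat" where "double q = 2 * q"
definition odd_double :: "nat \<Rightarrow> nat" where "odd_double q = 2 * q + 1"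

lemma double_code:
  "double 0 = 0" "double 1 = numeral (num.Bit0 num.One)" "double (numeral k) = numeral (num.Bit0 k)"
  "odd_double 0 = 1" "odd_double 1 = numeral (num.Bit1 num.One)" "odd_double (numeral k) = numeral (num.Bit1 k)"
  by (simp_all add: double_def odd_double_def numeral_Bit0 numeral_Bit1)

definition divmod10 :: "nat \<Rightarrow> nat \<times> nat" where "divmod10 n = (n div 10, n mod 10)"

definition push0 :: "nat \<times> nat \<Rightarrow> nat \<times> nat" where
  "push0 p = (2 * fst p + 2 * snd p div 10, 2 * snd p mod 10)"

definition push1 :: "nat \<times> nat \<Rightarrow> nat \<times> nat" where
  "push1 p = (2 * fst p + (2 * snd p + 1) div 10, (2 * snd p + 1) mod 10)"

lemma push_code:
  "push0 (q, 0) = (double q, 0)"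
  "push0 (q, (Suc 0)) = (double q, (Suc (Suc 0)))"
  "push0 (q, (Suc (Suc 0))) = (double q, (Suc (Suc (Suc (Suc 0)))))"
  "push0 (q, (Suc (Suc (Suc 0)))) = (double q, (Suc (Suc (Suc (Suc (Suc (Suc 0)))))))"
  "push0 (q, (Suc (Suc (Suc (Suc 0))))) = (double q, (Suc (Suc (Suc (Suc (Suc (Suc (Suc (Suc 0)))))))))"
  "push0 (q, (Suc (Suc (Suc (Suc (Suc 0)))))) = (odd_double q, 0)"
  "push0 (q, (Suc (Suc (Suc (Suc (Suc (Suc 0))))))) = (odd_double q, (Suc (Suc 0)))"
  "push0 (q, (Suc (Suc (Suc (Suc (Suc (Suc (Suc 0)))))))) = (odd_double q, (Suc (Suc (Suc (Suc 0)))))"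
  "push0 (q, (Suc (Suc (Suc (Suc (Suc (Suc (Suc (Suc 0))))))))) = (odd_double q, (Suc (Suc (Suc (Suc (Suc (Suc 0)))))))"
  "push0 (q, (Suc (Suc (Suc (Suc (Suc (Suc (Suc (Suc (Suc 0)))))))))) = (odd_double q, (Suc (Suc (Suc (Suc (Suc (Suc (Suc (Suc 0)))))))))"
  "push1 (q, 0) = (double q, (Suc 0))"
  "push1 (q, (Suc 0)) = (double q, (Suc (Suc (Suc 0))))"
  "push1 (q, (Suc (Suc 0))) = (double q, (Suc (Suc (Suc (Suc (Suc 0))))))"
  "push1 (q, (Suc (Suc (Suc 0)))) = (double q, (Suc (Suc (Suc (Suc (Suc (Suc (Suc 0))))))))"
  "push1 (q, (Suc (Suc (Suc (Suc 0))))) = (double q, (Suc (Suc (Suc (Suc (Suc (Suc (Suc (Suc (Suc 0))))))))))"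
  "push1 (q, (Suc (Suc (Suc (Suc (Suc 0)))))) = (odd_double q, (Suc 0))"
  "push1 (q, (Suc (Suc (Suc (Suc (Suc (Suc 0))))))) = (odd_double q, (Suc (Suc (Suc 0))))"
  "push1 (q, (Suc (Suc (Suc (Suc (Suc (Suc (Suc 0)))))))) = (odd_double q, (Suc (Suc (Suc (Suc (Suc 0))))))"
  "push1 (q, (Suc (Suc (Suc (Suc (Suc (Suc (Suc (Suc 0))))))))) = (odd_double q, (Suc (Suc (Suc (Suc (Suc (Suc (Suc 0))))))))"
  "push1 (q, (Suc (Suc (Suc (Suc (Suc (Suc (Suc (Suc (Suc 0)))))))))) = (odd_double q, (Suc (Suc (Suc (Suc (Suc (Suc (Suc (Suc (Suc 0))))))))))"
  by (simp_all add: push0_def push1_def double_def odd_double_def)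

lemma divmod10_code:
  "divmod10 0 = (0, 0)" "divmod10 1 = (0, Suc 0)" "divmod10 (numeral num.One) = (0, Suc 0)"
  "divmod10 (numeral (num.Bit0 k)) = push0 (divmod10 (numeral k))"
  "divmod10 (numeral (num.Bit1 k)) = push1 (divmod10 (numeral k))"
proof -
  have carry: "(a + 10 * c) div 10 = c + a div 10" "(a + 10 * c) mod 10 = a mod 10" for a c :: nat by simp_all
  define n where "n = (numeral k :: nat)"
  have e: "2 * n = 2 * (n mod 10) + 10 * (2 * (n div 10))" "2 * n + 1 = (2 * (n mod 10) + 1) + 10 * (2 * (n div 10))"
    using mult_div_mod_eq[of 10 n] by linarith+
  have "divmod10 (2 * n) = push0 (divmod10 n)"
    using carry[of "2 * (n mod 10)" "2 * (n div 10)"] unfolding e[symmetric] divmod10_def push0_def fst_conv snd_conv by blast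
  moreover have "divmod10 (2 * n + 1) = push1 (divmod10 n)"
    using carry[of "2 * (n mod 10) + 1" "2 * (n div 10)"] unfolding e[symmetric] divmod10_def push1_def fst_conv snd_conv by blast
  moreover have "numeral (num.Bit0 k) = 2 * n" "numeral (num.Bit1 k) = 2 * n + 1"
    by (simp_all add: n_def numeral_Bit0 numeral_Bit1)
  ultimately show "divmod10 (numeral (num.Bit0 k)) = push0 (divmod10 (numeral k))"
    "divmod10 (numeral (num.Bit1 k)) = push1 (divmod10 (numeral k))"
    unfolding n_def by metis+
qed (simp_all add: divmod10_def)

primrec digit_list :: "nat \<Rightarrow> nat \<times> nat \<Rightarrow> nat list \<Rightarrow> nat list" where
  "digit_list 0 p ds = ds"
| "digit_list (Suc n) p ds = digit_list n (divmod10 (fst p)) (snd p # ds)"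

fun slice_of :: "nat list \<Rightarrow> m9" where
  "slice_of [a, b, c, d, e, f, g, h, i] = M a b c d e f g h i" | "slice_of _ = M 0 0 0 0 0 0 0 0 0"

lemma digits_code:
  "digits b = slice_of (digit_list (Suc (Suc (Suc (Suc (Suc (Suc (Suc (Suc (Suc 0))))))))) (divmod10 b) [])"
  by (simp add: digits_def mat_of_def digit_pos_def divmod10_def div_mult2_eq[symmetric])

lemmas decoding = L12_def I12_data_def concat.simps list.map append.simps prod.case digits_code slice_of.simps(1)
  digit_list.simps divmod10_code push_code double_code fst_conv snd_conv

subsection \<open>Checking the shape\<close>

primrec eq_then :: "order \<Rightarrow> bool \<Rightarrow> bool" where
  "eq_then LT x = False" | "eq_then EQ x = x" | "eq_then GT x = False"

primrec lt_then :: "order \<Rightarrow> bool \<Rightarrow> bool" where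
  "lt_then LT x = x" | "lt_then EQ x = False" | "lt_then GT x = False"

primrec all_eq :: "nat \<Rightarrow> nat list \<Rightarrow> bool" where
  "all_eq n [] = True" | "all_eq n (k # ks) = eq_then (cmpn k n) (all_eq n ks)"

primrec all_lt :: "nat \<Rightarrow> nat list \<Rightarrow> bool" where
  "all_lt n [] = True" | "all_lt n (k # ks) = lt_then (cmpn k n) (all_lt n ks)"

lemma all_eq_iff: "all_eq n ks \<longleftrightarrow> (\<forall>k\<in>set ks. k = n)"
  by (induction ks) (auto simp: cmpn_def)

lemma all_lt_iff: "all_lt n ks \<longleftrightarrow> (\<forall>k\<in>set ks. k < n)"
  by (induction ks) (auto simp: cmpn_def)

fun slice_sums :: "cube \<Rightarrow> nat list" where
  "slice_sums (Cube (M x0 x1 x2 x3 x4 x5 x6 x7 x8) (M y0 y1 y2 y3 y4 y5 y6 y7 y8) (M z0 z1 z2 z3 z4 z5 z6 z7 z8)) =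
   [x0 + x1 + x2 + x3 + x4 + x5 + x6 + x7 + x8,
    y0 + y1 + y2 + y3 + y4 + y5 + y6 + y7 + y8,
    z0 + z1 + z2 + z3 + z4 + z5 + z6 + z7 + z8,
    x0 + x1 + x2 + y0 + y1 + y2 + z0 + z1 + z2,
    x3 + x4 + x5 + y3 + y4 + y5 + z3 + z4 + z5,
    x6 + x7 + x8 + y6 + y7 + y8 + z6 + z7 + z8,
    x0 + x3 + x6 + y0 + y3 + y6 + z0 + z3 + z6,
    x1 + x4 + x7 + y1 + y4 + y7 + z1 + z4 + z7,
    x2 + x5 + x8 + y2 + y5 + y8 + z2 + z5 + z8]"

lemma margins_code: "margins n (arr_of q) \<longleftrightarrow> all_eq n (slice_sums q)"
  by (cases q rule: slice_sums.cases) (simp add: margins_def forall_3 slice_sum_eqs sum_3 add.assoc all_eq_iff)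

lemma entries_less_code: "(\<forall>t. arr_of q t < n) \<longleftrightarrow> all_lt n (flat q)"
  by (cases q rule: slice_sums.cases) (simp add: forall_3 all_lt_iff flat_code conj_ac)

definition checked :: "nat \<Rightarrow> (int \<times> cube) list \<Rightarrow> bool" where
  "checked n L \<longleftrightarrow> list_all (shape_ok n) L \<and> list_all (\<lambda>(c, q). \<forall>t. arr_of q t < 4) L"

lemma checked_code:
  "checked n [] = True"
  "checked n ((c, q) # L) = (c \<noteq> 0 \<and> all_eq n (slice_sums q) \<and> all_lt (Suc (Suc (Suc (Suc 0)))) (flat q) \<and> checked n L)"
  unfolding checked_def entries_less_code by (auto simp: margins_code eval_nat_numeral)

lemmas shape_evaluation =
  checked_code slice_sums.simps all_eq.simps all_lt.simps eq_then.simps lt_then.simps cmpn_code flat_code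
  add_Suc add_0_left add_0_right simp_thms rel_simps zero_neq_one one_neq_zero neg_equal_0_iff_equal

subsection \<open>The evaluations\<close>

lemma checked_L6: "checked (Suc (Suc 0)) L6"
  by (simp add: L6_def encoding) (simp only: shape_evaluation)

lemma checked_L9: "checked (Suc (Suc (Suc 0))) L9"
  by (simp add: L9_def encoding) (simp only: shape_evaluation)

lemma checked_L12: "checked (Suc (Suc (Suc (Suc 0)))) L12"
  by (simp only: decoding shape_evaluation)

lemma shape_L6: "list_all (shape_ok 2) L6"
  and shape_L9: "list_all (shape_ok 3) L9"
  and shape_L12: "list_all (shape_ok 4) L12"
  and entries_L12: "list_all (\<lambda>(c, q). \<forall>t. arr_of q t < 4) L12"
  using checked_L6 checked_L9 checked_L12 by (simp_all add: checked_def eval_nat_numeral)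

lemma run_L6: "verdict (run False L6 (Result Empty 0 [])) = (True, 1152)"
  by (simp add: L6_def encoding) (simp only: evaluation)

lemma run_L9: "verdict (run True L9 (Result Empty 0 [])) = (True, 9216)"
  by (simp add: L9_def encoding) (simp only: evaluation)

lemma run_L12: "verdict (run False L12 (Result Empty 0 [])) = (True, 209061)"
  by (simp only: decoding evaluation)

subsection \<open>The Cartan point of type (1, 0, 0)\<close>

text \<open>A monomial that does not vanish at \<open>cartan 1 0 0\<close> involves only the three cells of the diagonal, and then the slice sum
  \<open>n\<close> is a single entry.\<close>

lemma monom_val_diagonal:
  assumes "margins n E" "\<And>t. E t < n"
  shows "monom_val (cartan 1 0 0) E = 0"
proof (rule ccontr)
  assume nz: "monom_val (cartan 1 0 0) E \<noteq> 0"
  have "E t = 0" if "cartan 1 0 0 t = 0" for t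
    using nz that by (cases t) (auto simp: monom_val_def)
  then have "E (1, j, k) = 0" if "(j, k) \<noteq> (1, 1)" for j k
    using that by (auto simp: cartan_def)
  then have "slice_sum E 1 1 = E (1, 1, 1)"
    by (simp add: slice_sum_eqs sum_3)
  then show False using assms by (metis margins_def less_irrefl)
qed

text \<open>No array in the list has an entry 4.\<close>

lemma peval_cartan_I12: "peval (cartan 1 0 0) I12 = 0"
proof -
  note V = verified_family[OF run_L12 shape_L12]
  have "monom_val (cartan 1 0 0) (Poly_Mapping.lookup m) = 0" if "m \<in> Poly_Mapping.keys I12" for m
  proof -
    from that obtain c E E' where E: "(c, E) \<in> set (entries L12)" "E' \<in> orb E" "m = expo E'"
      unfolding I12_family keys_family_sum(1)[OF V(1)] by auto
    have lt: "E t < 4" for t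
      using E(1) entries_L12 by (cases t) (fastforce simp: entries_def list_all_iff)
    from E(2) obtain g where g: "g \<in> G" "E' = gact g E" by (auto simp: orb_def)
    have "margins 4 E'" using margins_gact[OF g(1) V(4)[OF E(1)]] g(2) by simp
    moreover have "E' t < 4" for t
      using lt by (cases g; cases t) (simp add: g(2) gact_def slice_act_def dir_act_def)
    ultimately show ?thesis using monom_val_diagonal E(3) by simp
  qed
  then show ?thesis by (simp add: peval_def)
qed

subsection \<open>The orbits in degree 6\<close>

text \<open>There are no further orbits in degree 6: the arrays with slice sums 2 are enumerated, slice by slice, and there
  are just as many as the eight known orbits contain together.\<close>

primrec compositions :: "nat \<Rightarrow> nat \<Rightarrow> nat list list" where
  "compositions 0 n = (if n = 0 then [[]] else [])"
| "compositions (Suc k) n = concat (map (\<lambda>a. map ((#) a) (compositions k (n - a))) [0..<Suc n])"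

lemma compositions: "length l = k \<Longrightarrow> sum_list l = n \<Longrightarrow> l \<in> set (compositions k n)"
proof (induction k arbitrary: l n)
  case (Suc k)
  obtain a l' where l: "l = a # l'" using Suc.prems(1) by (cases l) simp_all
  have "l' \<in> set (compositions k (n - a))" using Suc by (simp add: l)
  then show ?case using Suc.prems by (force simp: l)
qed simp

definition slices2 :: "m9 list" where 
  "slices2 = map slice_of (compositions (Suc (Suc (Suc (Suc (Suc (Suc (Suc (Suc (Suc 0))))))))) (Suc (Suc 0)))"

fun sums2 :: "m9 \<Rightarrow> m9 \<Rightarrow> nat list" where
  "sums2 (M x0 x1 x2 x3 x4 x5 x6 x7 x8) (M y0 y1 y2 y3 y4 y5 y6 y7 y8) =
    [x0 + x1 + x2 + y0 + y1 + y2, x3 + x4 + x5 + y3 + y4 + y5, x6 + x7 + x8 + y6 + y7 + y8,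
     x0 + x3 + x6 + y0 + y3 + y6, x1 + x4 + x7 + y1 + y4 + y7, x2 + x5 + x8 + y2 + y5 + y8]"

fun add_line_sums :: "nat list \<Rightarrow> m9 \<Rightarrow> nat list" where
  "add_line_sums [r0, r1, r2, c0, c1, c2] (M z0 z1 z2 z3 z4 z5 z6 z7 z8) =
    [r0 + z0 + z1 + z2, r1 + z3 + z4 + z5, r2 + z6 + z7 + z8, c0 + z0 + z3 + z6, c1 + z1 + z4 + z7, c2 + z2 + z5 + z8]"
| "add_line_sums ks Z = ks"

primrec bump :: "bool \<Rightarrow> nat \<Rightarrow> nat" where "bump False n = n" | "bump True n = n + 1"

primrec thirds :: "nat list \<Rightarrow> m9 list \<Rightarrow> nat \<Rightarrow> nat" where
  "thirds ks [] n = n" | "thirds ks (Z # Zs) n = thirds ks Zs (bump (all_eq (Suc (Suc 0)) (add_line_sums ks Z)) n)"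

primrec guarded_thirds :: "bool \<Rightarrow> nat list \<Rightarrow> m9 list \<Rightarrow> nat \<Rightarrow> nat" where
  "guarded_thirds False ks Zs n = n" | "guarded_thirds True ks Zs n = thirds ks Zs n"

primrec seconds :: "m9 \<Rightarrow> m9 list \<Rightarrow> m9 list \<Rightarrow> nat \<Rightarrow> nat" where
  "seconds X [] Zs n = n"
| "seconds X (Y # Ys) Zs n = seconds X Ys Zs (guarded_thirds (all_lt (Suc (Suc (Suc 0))) (sums2 X Y)) (sums2 X Y) Zs n)"

primrec firsts :: "m9 list \<Rightarrow> m9 list \<Rightarrow> m9 list \<Rightarrow> nat \<Rightarrow> nat" where
  "firsts [] Ys Zs n = n" | "firsts (X # Xs) Ys Zs n = firsts Xs Ys Zs (seconds X Ys Zs n)"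

lemma bump_eq: "bump b n = n + (if b then 1 else 0)" by (cases b) auto

lemma guarded_thirds_eq: "guarded_thirds b ks Zs n = (if b then thirds ks Zs n else n)" by (cases b) auto

definition completes :: "m9 \<Rightarrow> m9 \<Rightarrow> m9 \<Rightarrow> bool" where
  "completes X Y Z \<longleftrightarrow> all_eq (Suc (Suc 0)) (add_line_sums (sums2 X Y) Z)"

lemma completes_le: "completes X Y Z \<Longrightarrow> all_lt (Suc (Suc (Suc 0))) (sums2 X Y)"
  by (cases X; cases Y; cases Z) (auto simp: completes_def all_lt_iff all_eq_iff)

lemma thirds_eq: "thirds (sums2 X Y) Zs n = n + length (filter (completes X Y) Zs)"
  by (induction Zs arbitrary: n) (auto simp: bump_eq completes_def)

lemma seconds_eq: "seconds X Ys Zs n = n + (\<Sum>Y\<leftarrow>Ys. length (filter (completes X Y) Zs))"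
proof (induction Ys arbitrary: n)
  case (Cons Y Ys)
  have "filter (completes X Y) Zs = []" if "\<not> all_lt (Suc (Suc (Suc 0))) (sums2 X Y)"
    using that completes_le by (auto simp: filter_empty_conv)
  then show ?case by (simp add: Cons.IH guarded_thirds_eq thirds_eq)
qed simp

lemma firsts_eq: "firsts Xs Ys Zs n = n + (\<Sum>X\<leftarrow>Xs. \<Sum>Y\<leftarrow>Ys. length (filter (completes X Y) Zs))"
  by (induction Xs arbitrary: n) (auto simp: seconds_eq)

lemma margins2_slices:
  assumes "margins 2 (arr_of (Cube X Y Z))"
  shows "X \<in> set slices2" "Y \<in> set slices2" "Z \<in> set slices2" "completes X Y Z"
proof -
  obtain x0 x1 x2 x3 x4 x5 x6 x7 x8 where X: "X = M x0 x1 x2 x3 x4 x5 x6 x7 x8" by (cases X)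
  obtain y0 y1 y2 y3 y4 y5 y6 y7 y8 where Y: "Y = M y0 y1 y2 y3 y4 y5 y6 y7 y8" by (cases Y)
  obtain z0 z1 z2 z3 z4 z5 z6 z7 z8 where Z: "Z = M z0 z1 z2 z3 z4 z5 z6 z7 z8" by (cases Z)
  note m = assms[unfolded X Y Z margins_code slice_sums.simps]
  have *: "M a b c d e f g h i \<in> set slices2" if "a + b + c + d + e + f + g + h + i = 2" for a b c d e f g h i
    unfolding slices2_def set_map
    by (rule image_eqI[of _ _ "[a, b, c, d, e, f, g, h, i]"]) (simp, rule compositions, use that in auto)
  note m' = m[unfolded all_eq_iff list.set ball_simps]
  show "X \<in> set slices2" unfolding X by (rule *) (rule m'[THEN conjunct1])
  show "Y \<in> set slices2" unfolding Y by (rule *) (rule m'[THEN conjunct2, THEN conjunct1])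
  show "Z \<in> set slices2" unfolding Z by (rule *) (rule m'[THEN conjunct2, THEN conjunct2, THEN conjunct1])
  show "completes X Y Z"
    unfolding X Y Z completes_def sums2.simps add_line_sums.simps all_eq_iff list.set ball_simps numeral_2_eq_2[symmetric]
    using m' by (elim conjE) (intro conjI TrueI; assumption)
qed

primrec cons_all :: "nat \<Rightarrow> nat list list \<Rightarrow> nat list list \<Rightarrow> nat list list" where
  "cons_all a [] rest = rest" | "cons_all a (l # ls) rest = (a # l) # cons_all a ls rest"

lemma compositions_code:
  "compositions 0 0 = [[]]" "compositions 0 (Suc n) = []"
  "compositions (Suc k) 0 = cons_all 0 (compositions k 0) []"
  "compositions (Suc k) (Suc 0) = cons_all 0 (compositions k (Suc 0)) (cons_all (Suc 0) (compositions k 0) [])"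
  "compositions (Suc k) (Suc (Suc 0)) = cons_all 0 (compositions k (Suc (Suc 0)))
     (cons_all (Suc 0) (compositions k (Suc 0)) (cons_all (Suc (Suc 0)) (compositions k 0) []))"
proof -
  have "cons_all a ls rest = map ((#) a) ls @ rest" for a ls rest
    by (induction ls) simp_all
  then show "compositions 0 0 = [[]]" "compositions 0 (Suc n) = []"
    "compositions (Suc k) 0 = cons_all 0 (compositions k 0) []"
    "compositions (Suc k) (Suc 0) = cons_all 0 (compositions k (Suc 0)) (cons_all (Suc 0) (compositions k 0) [])"
    "compositions (Suc k) (Suc (Suc 0)) = cons_all 0 (compositions k (Suc (Suc 0)))
       (cons_all (Suc 0) (compositions k (Suc 0)) (cons_all (Suc (Suc 0)) (compositions k 0) []))"
    by simp_all
qed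

lemma count_margins2: "firsts slices2 slices2 slices2 0 = 1152"
  by (simp only: slices2_def compositions_code cons_all.simps list.map slice_of.simps(1) firsts.simps seconds.simps
      guarded_thirds.simps thirds.simps bump.simps all_eq.simps all_lt.simps eq_then.simps lt_then.simps
      add_line_sums.simps(1) sums2.simps cmpn_code add_Suc add_0_left add_0_right arith_simps arith_special one_add_one simp_thms)

lemma card_margins2: "finite {E. margins 2 E}" "card {E. margins 2 E} \<le> 1152"
proof -
  define S where "S = concat (map (\<lambda>X. concat (map (\<lambda>Y. map (Cube X Y) (filter (completes X Y) slices2)) slices2)) slices2)"
  have sub: "{E. margins 2 E} \<subseteq> arr_of ` set S"
  proof
    fix E :: arr assume E: "E \<in> {E. margins 2 E}"
    obtain X Y Z where q: "cube_of E = Cube X Y Z" by (cases "cube_of E")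
    have "margins 2 (arr_of (Cube X Y Z))" using E by (simp flip: q)
    from margins2_slices[OF this] have "Cube X Y Z \<in> set S" by (auto simp: S_def)
    then show "E \<in> arr_of ` set S" by (metis arr_of_cube_of image_eqI q)
  qed
  then show "finite {E. margins 2 E}" by (rule finite_subset) simp
  have "length S = firsts slices2 slices2 slices2 0"
    by (simp add: S_def firsts_eq length_concat comp_def)
  then have "card (set S) \<le> 1152" using card_length[of S] by (simp only: count_margins2)
  moreover have "card {E. margins 2 E} \<le> card (arr_of ` set S)" using sub by (intro card_mono) auto
  moreover have "card (arr_of ` set S) \<le> card (set S)" by (rule card_image_le) simp
  ultimately show "card {E. margins 2 E} \<le> 1152" by simp
qed

lemma weight_zero_arrays_eq: "weight_zero_arrays (3 * n) = {E. margins n E}"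
  by (simp add: weight_zero_arrays_def weight_zero_margins)

text \<open>The 1152 terms of \<open>I6\<close> exhaust the arrays with slice sums 2.\<close>

lemma orbits_degree_6:
  assumes R: "R = snd ` set (entries L6)"
  shows "orbit ` R = orbit ` weight_zero_arrays 6"
proof -
  note V = verified_family[OF run_L6 shape_L6]
  have wz: "weight_zero_arrays 6 = {E. margins 2 E}" using weight_zero_arrays_eq[of 2] by simp
  have sub: "(\<Union>E\<in>R. orb E) \<subseteq> {E. margins 2 E}"
    using V(4) margins_gact by (force simp: R orb_def)
  have u: "(\<Union>E\<in>R. orb E) = (\<Union>(c, E)\<in>set (entries L6). orb E)" by (auto simp: R)
  have "num_terms (family_sum False (entries L6)) = card (\<Union>E\<in>R. orb E)"
    unfolding num_terms_def keys_family_sum(1)[OF V(1)] u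
    by (rule card_image) (metis injI inj_on_subset lookup_expo subset_UNIV)
  then have "card (\<Union>E\<in>R. orb E) = 1152" using V(3) by simp
  then have eq: "(\<Union>E\<in>R. orb E) = {E. margins 2 E}"
    using card_margins2 sub by (intro card_seteq) auto
  have "orbit E \<in> orbit ` R" if "margins 2 E" for E
  proof -
    from that eq obtain E0 where "E0 \<in> R" "E \<in> orb E0" by blast
    then have "orb E = orb E0" using orb_disjoint[of E E0] orb_self[of E] by blast
    then show ?thesis using \<open>E0 \<in> R\<close> by (auto simp: orbit_inject[symmetric])
  qed
  moreover have "margins 2 E" if "E \<in> R" for E using that V(4) by (auto simp: R)
  ultimately show ?thesis unfolding wz by auto
qed

subsection \<open>Free generators and numbers of terms\<close>

lemma fundamental_eq: "fundamental = tri I6 I9 I12"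
  by (simp add: fundamental_def tri_def fun_eq_iff)

theorem theorem5p7:
  shows "freely_generates fundamental invariants
    \<and> homogeneous 6 I6 \<and> homogeneous 9 I9 \<and> homogeneous 12 I12
    \<and> card (orbit ` weight_zero_arrays 6) = 8
    \<and> (\<exists>R (c :: arr \<Rightarrow> complex). R \<subseteq> weight_zero_arrays 6 \<and> card R = 8 \<and> inj_on orbit R
          \<and> orbit ` R = orbit ` weight_zero_arrays 6
          \<and> I6 = (\<Sum>E\<in>R. pconst (c E) * sym_orbit_sum E))
    \<and> num_terms I6 = 1152
    \<and> (\<exists>R. R \<subseteq> weight_zero_arrays 9 \<and> card R = 14 \<and> inj_on orbit R
          \<and> (\<forall>E\<in>R. alt_orbit_sum E \<noteq> 0)
          \<and> I9 = (\<Sum>E\<in>R. alt_orbit_sum E))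
    \<and> num_terms I9 = 9216
    \<and> (\<exists>R (c :: arr \<Rightarrow> complex). R \<subseteq> weight_zero_arrays 12 \<and> card R = 235 \<and> inj_on orbit R
          \<and> (\<forall>E\<in>R. c E \<noteq> 0)
          \<and> I12 = (\<Sum>E\<in>R. pconst (c E) * sym_orbit_sum E))
    \<and> num_terms I12 = 209061"
proof -
  note V6 = verified_family[OF run_L6 shape_L6, folded I6_family]
  note V9 = verified_family[OF run_L9 shape_L9, folded I9_family]
  note V12 = verified_family[OF run_L12 shape_L12, folded I12_family]
  have terms: "num_terms I6 = 1152" "num_terms I9 = 9216" "num_terms I12 = 209061"
    using V6(3) V9(3) V12(3) by simp_all
  then have nz: "I6 \<noteq> 0" "I9 \<noteq> 0" "I12 \<noteq> 0" by (auto simp: num_terms_def)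
  have hom: "homogeneous 6 I6" "homogeneous 9 I9" "homogeneous 12 I12"
    using homogeneous_family_sum[OF V6(1,4)] homogeneous_family_sum[OF V9(1,4)] homogeneous_family_sum[OF V12(1,4)]
    by (simp_all add: I6_family I9_family I12_family)
  have inv: "I6 \<in> invariants" "I9 \<in> invariants" "I12 \<in> invariants"
    unfolding I6_family I9_family I12_family
    by (rule family_sum_invariant[OF V6(2,1,4)] family_sum_invariant[OF V9(2,1,4)] family_sum_invariant[OF V12(2,1,4)]; assumption)+
  have free: "freely_generates fundamental invariants"
    unfolding fundamental_eq by (intro free_generation inv hom nz peval_cartan_I12)
  have wz: "weight_zero_arrays 6 = {E. margins 2 E}" "weight_zero_arrays 9 = {E. margins 3 E}" "weight_zero_arrays 12 = {E. margins 4 E}"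
    using weight_zero_arrays_eq[of 2] weight_zero_arrays_eq[of 3] weight_zero_arrays_eq[of 4] by simp_all

  obtain R6 c6 where R6: "R6 = snd ` set (entries L6)" "card R6 = length (entries L6)" "inj_on orbit R6"
      "\<And>E. E \<in> R6 \<Longrightarrow> c6 E \<noteq> 0" "I6 = (\<Sum>E\<in>R6. pconst (of_int (c6 E)) * osum False E)"
      "\<And>a E. (a, E) \<in> set (entries L6) \<Longrightarrow> c6 E = a"
    by (rule family_sum_representatives[OF V6(1), folded I6_family]) blast
  have "length (entries L6) = 8" unfolding entries_def L6_def length_map by simp
  with R6(2) have card6: "card R6 = 8" by simp
  have "R6 \<subseteq> weight_zero_arrays 6" using V6(4) by (auto simp: wz R6(1))
  moreover have orb6: "orbit ` R6 = orbit ` weight_zero_arrays 6" by (rule orbits_degree_6[OF R6(1)])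
  ultimately have ex6: "\<exists>R (c :: arr \<Rightarrow> complex). R \<subseteq> weight_zero_arrays 6 \<and> card R = 8 \<and> inj_on orbit R
          \<and> orbit ` R = orbit ` weight_zero_arrays 6 \<and> I6 = (\<Sum>E\<in>R. pconst (c E) * sym_orbit_sum E)"
    using R6(3,5) card6 by (intro exI[of _ R6] exI[of _ "\<lambda>E. of_int (c6 E)"]) (simp add: osum_def)
  have eight: "card (orbit ` weight_zero_arrays 6) = 8"
    using card_image[OF R6(3)] card6 by (simp add: orb6)

  obtain R9 c9 where R9: "R9 = snd ` set (entries L9)" "card R9 = length (entries L9)" "inj_on orbit R9"
      "\<And>E. E \<in> R9 \<Longrightarrow> c9 E \<noteq> 0" "I9 = (\<Sum>E\<in>R9. pconst (of_int (c9 E)) * osum True E)"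
      "\<And>a E. (a, E) \<in> set (entries L9) \<Longrightarrow> c9 E = a"
    by (rule family_sum_representatives[OF V9(1), folded I9_family]) blast
  have "length (entries L9) = 14" unfolding entries_def L9_def length_map by simp
  with R9(2) have card9: "card R9 = 14" by simp
  have one: "c9 E = 1" if E9: "E \<in> R9" for E
  proof -
    obtain a where a: "(a, E) \<in> set (entries L9)" using E9 unfolding R9(1) by force
    moreover have "\<forall>e\<in>set L9. fst e = 1" unfolding L9_def set_map by (rule ballI) (erule imageE, simp only: fst_conv)
    ultimately have "a = 1" unfolding entries_def by fastforce
    then show ?thesis using R9(6)[OF a] by simp
  qed
  have "pconst 1 = (1 :: cube_poly)" by (simp add: pconst_def)
  then have I9: "I9 = (\<Sum>E\<in>R9. alt_orbit_sum E)"
    unfolding R9(5) by (intro sum.cong refl) (simp add: one osum_def)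
  have "alt_orbit_sum E \<noteq> 0" if "E \<in> R9" for E
  proof -
    have "even_stab True E" using that V9(1) by (auto simp: R9(1) good_family_def)
    from keys_osum[OF this] orb_self[of E] show ?thesis by (auto simp: osum_def)
  qed
  moreover have "R9 \<subseteq> weight_zero_arrays 9" using V9(4) by (auto simp: wz R9(1))
  ultimately have ex9: "\<exists>R. R \<subseteq> weight_zero_arrays 9 \<and> card R = 14 \<and> inj_on orbit R
          \<and> (\<forall>E\<in>R. alt_orbit_sum E \<noteq> 0) \<and> I9 = (\<Sum>E\<in>R. alt_orbit_sum E)"
    using R9(3) card9 I9 by (intro exI[of _ R9]) simp

  obtain R12 c12 where R12: "R12 = snd ` set (entries L12)" "card R12 = length (entries L12)" "inj_on orbit R12"
      "\<And>E. E \<in> R12 \<Longrightarrow> c12 E \<noteq> 0" "I12 = (\<Sum>E\<in>R12. pconst (of_int (c12 E)) * osum False E)"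
      "\<And>a E. (a, E) \<in> set (entries L12) \<Longrightarrow> c12 E = a"
    by (rule family_sum_representatives[OF V12(1), folded I12_family]) blast
  have "count L12 0 = 235"
    by (simp only: L12_def I12_data_def concat.simps list.map append.simps prod.case count.simps
        add_0_left arith_simps arith_special one_add_one)
  then have "length (entries L12) = 235" using count_eq[of L12 0] by (simp add: entries_def)
  with R12(2) have card12: "card R12 = 235" by simp
  have "R12 \<subseteq> weight_zero_arrays 12" using V12(4) by (auto simp: wz R12(1))
  then have ex12: "\<exists>R (c :: arr \<Rightarrow> complex). R \<subseteq> weight_zero_arrays 12 \<and> card R = 235 \<and> inj_on orbit R
          \<and> (\<forall>E\<in>R. c E \<noteq> 0) \<and> I12 = (\<Sum>E\<in>R. pconst (c E) * sym_orbit_sum E)"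
    using R12(3,4,5) card12 by (intro exI[of _ R12] exI[of _ "\<lambda>E. of_int (c12 E)"]) (simp add: osum_def)

  show ?thesis by (intro conjI free hom eight ex6 terms ex9 ex12)
qed

end
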